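(* There exist absolute constants $k_0,c_0,c_1>0$, a function $\epsilon_1:(c_1,\infty)\to\mathbb{R}$ with $\epsilon_1(c)\to 0$ as $c\to\infty$, and a function $\epsilon_0:(0,c_0)\to\mathbb{R}$ with $\epsilon_0(c)\to 1$ as $c\to 0$, such that the following holds for all integers $k,p$ with $k_0\le k\le p$. 1. For any $c>c_1$, if $\lambda\ge c\,\lambda_1(k,p)$, then $\epsilon^*(p,k,\lambda)\le \epsilon_1(c)$. 2. Conversely, for any $0<c<c_0$, if $0\le\lambda\le c\,\lambda_0(k,p)$, then $\epsilon^*(p,k,\lambda)\ge \epsilon_0(c)-o_{p\to\infty}(1)$, where for each fixed $c$ the term $o_{p\to\infty}(1)$ is a quantity depending only on $p$ and $c$ that tends to $0$ as $p\to\infty$.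
   Context: A $p\times p$ real matrix is called $k$-sparse if each of its rows and each of its columns has at most $k$ nonzero entries; $\mathcal{M}(p,k)$ denotes the set of all $k$-sparse matrices in $\mathbb{R}^{p\times p}$. $\|M\|_2$ denotes the spectral norm (largest singular value). Define $$\Theta(p,k,\lambda)=\{M\in\mathbb{R}^{p\times p}: M\in\mathcal{M}(p,k),\ \|M\|_2\ge\lambda\}.$$ One observes $X=M+Z\in\mathbb{R}^{p\times p}$, where $M$ is an unknown deterministic matrix and $Z$ has i.i.d. $N(0,1)$ entries; $\mathbb{P}_M$ denotes the law of $X$, and $\mathbb{P}_0$ is the law when $M=0$. The problem is to test $H_0: M=0$ against $H_1: M\in\Theta(p,k,\lambda)$. The optimal sum of Type-I and Type-II error probabilities is $$\epsilon^*(p,k,\lambda)=\inf_{\phi}\Big\{\mathbb{P}_0(\phi(X)=1)+\sup_{M\in\Theta(p,k,\lambda)}\mathbb{P}_M(\phi(X)=0)\Big\},$$ where the infimum is over all (measurable) decision rules $\phi:\mathbb{R}^{p\times p}\to\{0,1\}$. With $\log$ the natural logarithm, define $$\lambda_1(k,p)=\begin{cases} k\sqrt{\log p} & \text{if } k\le (p/\log p)^{1/3},\\ \big(kp\log\frac{ep}{k}\big)^{1/4} & \text{if } k\ge (p/\log p)^{1/3},\end{cases}$$ $$\lambda_0(k,p)=\begin{cases} k\sqrt{\log\big(\frac{p\log p}{k^3}\big)} & \text{if } k\le (p\log p)^{1/3},\\ \big(kp\log\frac{ep}{k}\big)^{1/4} & \text{if } k\ge (p\log p)^{1/3}.\end{cases}$$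 *)

theory Defs
  imports "HOL-Probability.Probability" "Jordan_Normal_Form.Char_Poly"
begin

definition sparse_mats :: "nat \<Rightarrow> nat \<Rightarrow> real mat set" where
  "sparse_mats p k = {M \<in> carrier_mat p p.
     (\<forall>i<p. card {j. j < p \<and> M $$ (i, j) \<noteq> 0} \<le> k) \<and>
     (\<forall>j<p. card {i. i < p \<and> M $$ (i, j) \<noteq> 0} \<le> k)}"

definition singular_values :: "real mat \<Rightarrow> real set" where
  "singular_values M = {s. 0 \<le> s \<and> eigenvalue (transpose_mat M * M) (s\<^sup>2)}"

text \<open>Only meaningful for matrices with at least one column; otherwise the set of singular
  values is empty.\<close>

definition spectral_norm :: "real mat \<Rightarrow> real" where
  "spectral_norm M = Max (singular_values M)"

definition Theta :: "nat \<Rightarrow> nat \<Rightarrow> real \<Rightarrow> real mat set" where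
  "Theta p k lam = {M \<in> sparse_mats p k. lam \<le> spectral_norm M}"

text \<open>The Borel sigma-algebra on the real \<open>p \<times> p\<close> matrices, pulled back from the product
  sigma-algebra on families of entries.\<close>

definition mat_borel :: "nat \<Rightarrow> real mat measure" where
  "mat_borel p = vimage_algebra (carrier_mat p p)
     (\<lambda>A. \<lambda>ij\<in>{..<p} \<times> {..<p}. A $$ ij)
     (PiM ({..<p} \<times> {..<p}) (\<lambda>_. borel))"

text \<open>The law of a \<open>p \<times> p\<close> matrix \<open>Z\<close> with i.i.d. standard normal entries.\<close>

definition gaussian_mat :: "nat \<Rightarrow> real mat measure" where
  "gaussian_mat p = distr (PiM ({..<p} \<times> {..<p}) (\<lambda>_. density lborel std_normal_density))
     (mat_borel p) (\<lambda>z. mat p p z)"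

text \<open>The law of \<open>X = M + Z\<close>.\<close>

definition obs_law :: "nat \<Rightarrow> real mat \<Rightarrow> real mat measure" where
  "obs_law p M = distr (gaussian_mat p) (mat_borel p) (\<lambda>Z. M + Z)"

definition decision_rules :: "nat \<Rightarrow> (real mat \<Rightarrow> nat) set" where
  "decision_rules p = mat_borel p \<rightarrow>\<^sub>M count_space {0, 1}"

definition opt_error :: "nat \<Rightarrow> nat \<Rightarrow> real \<Rightarrow> real" where
  "opt_error p k lam = (INF \<phi>\<in>decision_rules p.
     measure (obs_law p (0\<^sub>m p p)) {X \<in> carrier_mat p p. \<phi> X = 1} +
     (SUP M\<in>Theta p k lam. measure (obs_law p M) {X \<in> carrier_mat p p. \<phi> X = 0}))"

text \<open>The two branches of each rate function need not agree at the threshold, but for integers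
  \<open>p \<ge> 2\<close> and \<open>k\<close> the threshold is never attained: \<open>ln p\<close> is transcendental.\<close>

definition lambda1 :: "nat \<Rightarrow> nat \<Rightarrow> real" where
  "lambda1 k p =
     (if real k \<le> (real p / ln (real p)) powr (1/3)
      then real k * sqrt (ln (real p))
      else (real k * real p * ln (exp 1 * real p / real k)) powr (1/4))"

definition lambda0 :: "nat \<Rightarrow> nat \<Rightarrow> real" where
  "lambda0 k p =
     (if real k \<le> (real p * ln (real p)) powr (1/3)
      then real k * sqrt (ln (real p * ln (real p) / real k ^ 3))
      else (real k * real p * ln (exp 1 * real p / real k)) powr (1/4))"

end

theory Submission
  imports Defs "HOL-Real_Asymp.Real_Asymp"
begin

text \<open>
  Throughout, \<open>L = ln (e p / k)\<close>.

  Upper bound. For small \<open>k\<close> sparsity alone forces a large entry: by the Schur test the spectral norm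
  of a \<open>k\<close>-sparse matrix is at most \<open>k\<close> times its largest entry, and pure noise has no entry far above
  \<open>sqrt (ln p)\<close> (\<open>entrywise_test\<close>). For large \<open>k\<close> the test scans bilinear forms \<open>u\<^sup>T X v\<close>
  (\<open>scan_test\<close>). Rounding the coordinates of a top pair of singular vectors towards zero on a grid of
  mesh \<open>\<tau>\<close> changes \<open>u\<^sup>T M v\<close> by at most \<open>2 F sqrt k \<tau>\<close>, where \<open>F\<close> is the Frobenius norm of \<open>M\<close>, since a
  row or column of \<open>M\<close> meets at most \<open>k\<close> of the rounding errors. A Frobenius norm above the order of
  \<open>sqrt p\<close> is visible in the sum of squares of the entries of \<open>X\<close>; below it, \<open>\<tau>\<^sup>2 = sqrt (L / (k p))\<close> makes the
  loss small compared with \<open>\<lambda>\<close>. The rounded vectors number only \<open>exp (O (sqrt (k p L)))\<close>, and that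
  is the cardinality that a union bound over Gaussian tails can afford at level \<open>\<lambda> = c (k p L) powr (1/4)\<close>.

  Lower bound. The minimax error is bounded below by the error of testing pure noise against a random
  matrix. Two random index sets \<open>A\<close> and \<open>B\<close> of about \<open>s = sqrt (k p / L)\<close> elements are
  chosen, then independent signs \<open>\<sigma>\<close> and \<open>\<delta>\<close>, then each position of \<open>A \<times> B\<close> with probability
  \<open>q = \<eta> k / s\<close>; the entries at these positions are \<open>\<mu> \<sigma> i \<delta> j\<close>. Rows and columns have about \<open>\<eta> k\<close> entries. The few that
  have more than \<open>k\<close> are emptied (\<open>thin\<close>), which costs a small fraction of the entries when \<open>\<eta>\<close> is small
  (\<open>good_support_probability\<close>). The sign vectors on \<open>A\<close> and \<open>B\<close> certify a spectral norm of order \<open>\<eta> k \<mu>\<close>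
  (\<open>prior_matrix_in_Theta\<close>).

  Indistinguishability is measured by the second moment of the likelihood ratio, the mean of
  \<open>exp \<langle>M, M'\<rangle>\<close> for two independent draws (\<open>mixture_testing_lower_bound\<close>). Thinning destroys the
  independence of the positions, but not the bound: expanding the exponential over sets of common
  positions gives coefficients that are nonnegative by a Griffiths inequality, and thinning only
  lowers the probability that a set of positions occurs (\<open>thinned_overlap_le_sign_avg\<close>). What is left
  depends on the overlaps \<open>a\<close> and \<open>b\<close> of the two row sets and of the two column sets, both with mean \<open>k / L\<close>.
  Typical overlaps contribute a factor near 1 because the signs cancel, and large overlaps are too
  rare to matter (\<open>sign_avg_overlap_bound\<close>). With \<open>x = \<mu>\<^sup>2\<close>, all that this requires of the signal is
  \<open>exp x - 1 \<le> sqrt (p L / k ^ 3)\<close> (\<open>opt_error_lower_bound_calibrated\<close>), and both branches of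
  \<open>lambda0\<close> are instances of this inequality (\<open>signal_small_at_lambda0\<close>).
\<close>

section \<open>Spectral norms and bilinear forms\<close>

text \<open>
  Vectors are functions of which only the first \<open>p\<close> values matter. The unit sphere can then be taken
  inside a product of intervals, which is compact by Tychonoff's theorem.
\<close>

definition image_sqnorm :: "nat \<Rightarrow> (nat \<Rightarrow> nat \<Rightarrow> real) \<Rightarrow> (nat \<Rightarrow> real) \<Rightarrow> real" where
  "image_sqnorm p A y = (\<Sum>i<p. (\<Sum>j<p. A i j * y j)\<^sup>2)"

text \<open>
  Pinning the coordinates from \<open>p\<close> on to 0 makes the sphere a closed subset of a compact cube;
  homogeneity carries the maximum over the sphere to all vectors.
\<close>

lemma image_sqnorm_attains_max_on_sphere:
  assumes "0 < p"
  obtains x where "(\<Sum>j<p. (x j)\<^sup>2) = 1" "\<And>y. image_sqnorm p A y \<le> image_sqnorm p A x * (\<Sum>j<p. (y j)\<^sup>2)"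
proof -
  define S where "S = PiE UNIV (\<lambda>j. if j < p then {-1..1::real} else {0})"
  define T where "T = S \<inter> {x. (\<Sum>j<p. (x j)\<^sup>2) = 1}"
  have "compactin (product_topology (\<lambda>_. euclidean) UNIV) S"
    unfolding S_def by (subst compactin_PiE) auto
  then have "compact S"
    by (simp add: euclidean_product_topology)
  have contc: "continuous_on UNIV (\<lambda>x::nat \<Rightarrow> real. x j)" for j
    by (rule continuous_on_product_coordinates)
  have "closed {x. (\<Sum>j<p. (x j)\<^sup>2) = (1::real)}"
    by (intro closed_Collect_eq continuous_intros contc)
  then have "compact T"
    unfolding T_def using \<open>compact S\<close> by blast
  have "(\<lambda>j. if j = 0 then 1 else 0) \<in> T"
    unfolding T_def S_def using assms by (auto simp: if_distrib[of "\<lambda>x. x\<^sup>2"] cong: if_cong)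
  then have "T \<noteq> {}" by blast
  have "continuous_on T (image_sqnorm p A)"
    unfolding image_sqnorm_def
    by (intro continuous_intros continuous_on_subset[OF contc]) auto
  then obtain x where x: "x \<in> T" "\<And>y. y \<in> T \<Longrightarrow> image_sqnorm p A y \<le> image_sqnorm p A x"
    using continuous_attains_sup[OF \<open>compact T\<close> \<open>T \<noteq> {}\<close>] by blast
  have "image_sqnorm p A y \<le> image_sqnorm p A x * (\<Sum>j<p. (y j)\<^sup>2)" for y
  proof (cases "(\<Sum>j<p. (y j)\<^sup>2) = 0")
    case True
    then have "\<And>j. j < p \<Longrightarrow> y j = 0"
      by (subst (asm) sum_nonneg_eq_0_iff) auto
    then have "image_sqnorm p A y = 0" by (simp add: image_sqnorm_def)
    with True show ?thesis by simp
  next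
    case False
    define r where "r = (\<Sum>j<p. (y j)\<^sup>2)"
    have r: "r > 0" using False unfolding r_def by (simp add: sum_nonneg order_less_le)
    define z where "z = (\<lambda>j. if j < p then y j / sqrt r else 0)"
    have z1: "(\<Sum>j<p. (z j)\<^sup>2) = 1"
      using r by (simp add: z_def power_divide sum_divide_distrib[symmetric] r_def[symmetric])
    have "\<bar>z j\<bar> \<le> 1" if "j < p" for j
    proof -
      have "(z j)\<^sup>2 \<le> (\<Sum>j<p. (z j)\<^sup>2)"
        using that by (intro member_le_sum) auto
      then show ?thesis unfolding z1 by (simp add: abs_square_le_1)
    qed
    then have "z j \<in> {-1..1}" if "j < p" for j
      using that by (simp add: abs_le_iff minus_le_iff)
    moreover have "z j = 0" if "\<not> j < p" for j using that by (simp add: z_def)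
    ultimately have "z \<in> T"
      using z1 unfolding T_def S_def by auto
    then have "image_sqnorm p A z \<le> image_sqnorm p A x" by (rule x)
    moreover have "image_sqnorm p A z = image_sqnorm p A y / r"
      using r by (simp add: image_sqnorm_def z_def sum_divide_distrib[symmetric] power_divide)
    ultimately show ?thesis using r by (simp add: r_def[symmetric] field_simps)
  qed
  with x(1) show ?thesis by (intro that[of x]) (auto simp: T_def)
qed

lemma linear_term_zero:
  fixes a b :: real
  assumes "\<And>t. 0 \<le> t * b + t\<^sup>2 * a"
  shows "b = 0"
proof (rule ccontr)
  assume "b \<noteq> 0"
  define r where "r = \<bar>a\<bar> + 1"
  have r: "r > 0" "a < r" unfolding r_def by auto
  have "0 \<le> (-b/r) * b + (-b/r)\<^sup>2 * a" by (rule assms)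
  also have "\<dots> = (b/r)\<^sup>2 * (a - r)" using r by (simp add: field_simps power2_eq_square)
  also have "\<dots> < 0" using r \<open>b \<noteq> 0\<close> by (intro mult_pos_neg) auto
  finally show False by simp
qed

text \<open>
  Along \<open>x + t e\<close>, with \<open>e\<close> the \<open>j\<close>-th unit vector, the gap between the two sides of the maximality condition
  is a nonnegative quadratic polynomial in \<open>t\<close> that vanishes at 0. Its linear coefficient, which is twice
  the \<open>j\<close>-th coordinate of the eigenvector equation, must be 0.
\<close>

lemma image_sqnorm_maximizer_is_eigenvector:
  assumes x1: "(\<Sum>j<p. (x j)\<^sup>2) = 1"
    and max: "\<And>y. image_sqnorm p A y \<le> image_sqnorm p A x * (\<Sum>j<p. (y j)\<^sup>2)" and j: "j < p"
  shows "(\<Sum>i<p. A i j * (\<Sum>l<p. A i l * x l)) = image_sqnorm p A x * x j"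
proof -
  define e where "e = (\<lambda>l. if l = j then 1 else 0 :: real)"
  have Ae: "(\<Sum>l<p. A i l * e l) = A i j" for i
    using j by (simp add: e_def if_distrib[of "(*) _"] cong: if_cong)
  have "0 \<le> t * (2 * (image_sqnorm p A x * x j - (\<Sum>i<p. A i j * (\<Sum>l<p. A i l * x l))))
             + t\<^sup>2 * (image_sqnorm p A x - (\<Sum>i<p. (A i j)\<^sup>2))" for t
  proof -
    have 1: "(\<Sum>l<p. (x l + t * e l)\<^sup>2) = 1 + 2 * t * x j + t\<^sup>2"
    proof -
      have "(x l + t * e l)\<^sup>2 = (x l)\<^sup>2 + (if l = j then 2 * t * x l + t\<^sup>2 else 0)" for l
        by (simp add: e_def power2_eq_square algebra_simps)
      then show ?thesis using x1 j by (simp add: sum.distrib)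
    qed
    have 2: "image_sqnorm p A (\<lambda>l. x l + t * e l) = image_sqnorm p A x
        + 2 * t * (\<Sum>i<p. A i j * (\<Sum>l<p. A i l * x l)) + t\<^sup>2 * (\<Sum>i<p. (A i j)\<^sup>2)"
    proof -
      have "(\<Sum>l<p. A i l * (x l + t * e l)) = (\<Sum>l<p. A i l * x l) + t * A i j" for i
        using Ae[of i] by (simp add: algebra_simps sum.distrib sum_distrib_left[symmetric])
      then show ?thesis
        by (simp add: image_sqnorm_def power2_sum sum.distrib sum_distrib_left power_mult_distrib mult_ac)
    qed
    show ?thesis using max[of "\<lambda>l. x l + t * e l"] unfolding 1 2 by (simp add: algebra_simps)
  qed
  from linear_term_zero[OF this] show ?thesis by simp
qed

lemma eigenvalue_gram_iff:
  fixes M :: "real mat"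
  assumes M: "M \<in> carrier_mat p p"
  shows "eigenvalue (transpose_mat M * M) e \<longleftrightarrow>
    (\<exists>x. (\<Sum>j<p. (x j)\<^sup>2) > 0 \<and> (\<forall>j<p. (\<Sum>i<p. M $$ (i,j) * (\<Sum>l<p. M $$ (i,l) * x l)) = e * x j))"
    (is "?L \<longleftrightarrow> ?R")
proof -
  have comp: "(transpose_mat M * M *\<^sub>v v) $ j = (\<Sum>i<p. M $$ (i,j) * (\<Sum>l<p. M $$ (i,l) * v $ l))"
    if v: "v \<in> carrier_vec p" and j: "j < p" for v j
  proof -
    have "transpose_mat M * M *\<^sub>v v = transpose_mat M *\<^sub>v (M *\<^sub>v v)"
      using M v by (intro assoc_mult_mat_vec) auto
    also have "\<dots> $ j = (\<Sum>i<p. M $$ (i,j) * (\<Sum>l<p. M $$ (i,l) * v $ l))"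
      using M v j by (auto simp: scalar_prod_def row_def col_def atLeast0LessThan intro!: sum.cong)
    finally show ?thesis .
  qed
  show ?thesis
  proof
    assume ?L
    then obtain v where v: "v \<in> carrier_vec p" "v \<noteq> 0\<^sub>v p" "transpose_mat M * M *\<^sub>v v = e \<cdot>\<^sub>v v"
      unfolding eigenvalue_def eigenvector_def using M by auto
    obtain j0 where j0: "j0 < p" "v $ j0 \<noteq> 0"
      using v(1,2) by (metis carrier_vecD dim_vec eq_vecI index_zero_vec)
    have "(\<Sum>j<p. (v $ j)\<^sup>2) > 0"
      using j0 by (intro sum_pos2[of _ j0]) auto
    moreover have "(\<Sum>i<p. M $$ (i,j) * (\<Sum>l<p. M $$ (i,l) * v $ l)) = e * v $ j" if "j < p" for j
      using comp[OF v(1) that] v(1,3) that by simp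
    ultimately show ?R by (intro exI[of _ "\<lambda>j. v $ j"]) auto
  next
    assume ?R
    then obtain x where x: "(\<Sum>j<p. (x j)\<^sup>2) > 0"
      "\<And>j. j < p \<Longrightarrow> (\<Sum>i<p. M $$ (i,j) * (\<Sum>l<p. M $$ (i,l) * x l)) = e * x j" by blast
    define v where "v = vec p x"
    have vc: "v \<in> carrier_vec p" by (simp add: v_def)
    have "v \<noteq> 0\<^sub>v p"
    proof
      assume "v = 0\<^sub>v p"
      then have "x j = 0" if "j < p" for j using that unfolding v_def by (metis index_vec index_zero_vec(1))
      then show False using x(1) by simp
    qed
    moreover have "transpose_mat M * M *\<^sub>v v = e \<cdot>\<^sub>v v"
    proof (rule eq_vecI)
      fix j assume "j < dim_vec (e \<cdot>\<^sub>v v)"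
      then have j: "j < p" by (simp add: v_def)
      show "(transpose_mat M * M *\<^sub>v v) $ j = (e \<cdot>\<^sub>v v) $ j"
        unfolding comp[OF vc j] using x(2)[OF j] j by (simp add: v_def)
    qed (use M in \<open>simp add: v_def\<close>)
    ultimately show ?L
      unfolding eigenvalue_def eigenvector_def using vc M by auto
  qed
qed

lemma image_sqnorm_eq_gram:
  "image_sqnorm p A x = (\<Sum>j<p. x j * (\<Sum>i<p. A i j * (\<Sum>l<p. A i l * x l)))"
proof -
  have "image_sqnorm p A x = (\<Sum>i<p. (\<Sum>j<p. x j * (A i j * (\<Sum>l<p. A i l * x l))))"
    unfolding image_sqnorm_def power2_eq_square
    by (intro sum.cong refl) (simp add: sum_distrib_right mult_ac)
  then show ?thesis by (subst (asm) sum.swap) (simp add: sum_distrib_left)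
qed

lemma finite_singular_values:
  assumes M: "M \<in> carrier_mat p p"
  shows "finite (singular_values M)"
proof -
  let ?G = "transpose_mat M * M"
  have G: "?G \<in> carrier_mat p p" using M by simp
  have "char_poly ?G \<noteq> 0" using degree_monic_char_poly[OF G] by auto
  then have "finite {e. eigenvalue ?G e}"
    using poly_roots_finite[of "char_poly ?G"] eigenvalue_root_char_poly[OF G] by simp
  then have "finite (sqrt ` {e. eigenvalue ?G e})" by simp
  moreover have "singular_values M \<subseteq> sqrt ` {e. eigenvalue ?G e}"
    unfolding singular_values_def by (auto simp: image_iff intro!: exI[of _ "_\<^sup>2"])
  ultimately show ?thesis by (rule rev_finite_subset)
qed

text \<open>
  The maximum of the Rayleigh quotient of the Gram matrix is one of its eigenvalues and bounds all
  others. In particular there are singular values, so that the maximum in the definition of the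
  spectral norm is a genuine one.
\<close>

lemma spectral_norm_attained:
  assumes M: "M \<in> carrier_mat p p" and p: "0 < p"
  obtains x where "(\<Sum>j<p. (x j)\<^sup>2) = 1" "spectral_norm M \<ge> 0"
    "image_sqnorm p (\<lambda>i j. M $$ (i,j)) x = (spectral_norm M)\<^sup>2"
    "\<And>y. image_sqnorm p (\<lambda>i j. M $$ (i,j)) y \<le> (spectral_norm M)\<^sup>2 * (\<Sum>j<p. (y j)\<^sup>2)"
proof -
  let ?A = "\<lambda>i j. M $$ (i,j)"
  obtain x where x1: "(\<Sum>j<p. (x j)\<^sup>2) = 1"
    and max: "\<And>y. image_sqnorm p ?A y \<le> image_sqnorm p ?A x * (\<Sum>j<p. (y j)\<^sup>2)"
    using image_sqnorm_attains_max_on_sphere[OF p, of ?A] by blast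
  have q0: "image_sqnorm p ?A x \<ge> 0" unfolding image_sqnorm_def by (intro sum_nonneg) auto
  have "eigenvalue (transpose_mat M * M) (image_sqnorm p ?A x)"
    unfolding eigenvalue_gram_iff[OF M]
    using x1 image_sqnorm_maximizer_is_eigenvector[OF x1 max] by (intro exI[of _ x]) auto
  then have mem: "sqrt (image_sqnorm p ?A x) \<in> singular_values M"
    using q0 by (simp add: singular_values_def)
  have "spectral_norm M = sqrt (image_sqnorm p ?A x)"
    unfolding spectral_norm_def
  proof (rule Max_eqI[OF finite_singular_values[OF M] _ mem])
    fix s assume "s \<in> singular_values M"
    then have s: "s \<ge> 0" "eigenvalue (transpose_mat M * M) (s\<^sup>2)"
      by (auto simp: singular_values_def)
    then obtain y where y: "(\<Sum>j<p. (y j)\<^sup>2) > 0"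
      "\<And>j. j < p \<Longrightarrow> (\<Sum>i<p. M $$ (i,j) * (\<Sum>l<p. M $$ (i,l) * y l)) = s\<^sup>2 * y j"
      unfolding eigenvalue_gram_iff[OF M] by blast
    have "image_sqnorm p ?A y = s\<^sup>2 * (\<Sum>j<p. (y j)\<^sup>2)"
      unfolding image_sqnorm_eq_gram using y(2) by (simp add: sum_distrib_left power2_eq_square mult_ac)
    then have "s\<^sup>2 \<le> image_sqnorm p ?A x" using max[of y] y(1) by simp
    then show "s \<le> sqrt (image_sqnorm p ?A x)" using s(1) by (simp add: real_le_rsqrt)
  qed
  then have "(spectral_norm M)\<^sup>2 = image_sqnorm p ?A x" "spectral_norm M \<ge> 0" using q0 by auto
  with x1 max show ?thesis by (intro that[of x]) auto
qed

lemma bilinear_le_spectral_norm: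
  assumes M: "M \<in> carrier_mat p p" and p: "0 < p"
    and u: "(\<Sum>i<p. (u i)\<^sup>2) \<le> r" and v: "(\<Sum>j<p. (v j)\<^sup>2) \<le> r"
  shows "(\<Sum>i<p. \<Sum>j<p. M $$ (i,j) * u i * v j) \<le> spectral_norm M * r"
proof -
  let ?A = "\<lambda>i j. M $$ (i,j)"
  obtain x where x: "spectral_norm M \<ge> 0"
     "\<And>y. image_sqnorm p ?A y \<le> (spectral_norm M)\<^sup>2 * (\<Sum>j<p. (y j)\<^sup>2)"
    using spectral_norm_attained[OF M p] by metis
  have r0: "r \<ge> 0" using u by (meson order_trans sum_nonneg zero_le_power2)
  have "(\<Sum>i<p. \<Sum>j<p. M $$ (i,j) * u i * v j) = (\<Sum>i<p. u i * (\<Sum>j<p. M $$ (i,j) * v j))"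
    by (simp add: sum_distrib_left mult_ac)
  also have "\<dots> \<le> \<bar>\<Sum>i<p. u i * (\<Sum>j<p. M $$ (i,j) * v j)\<bar>" by simp
  also have "\<dots> \<le> sqrt ((\<Sum>i<p. (u i)\<^sup>2) * image_sqnorm p ?A v)"
    unfolding image_sqnorm_def by (rule real_le_rsqrt) (use Cauchy_Schwarz_ineq_sum in simp)
  also have "\<dots> \<le> sqrt (r * ((spectral_norm M)\<^sup>2 * r))"
    using u v x r0 by (intro real_sqrt_le_mono mult_mono order_trans[OF x(2)] sum_nonneg)
      (auto simp: image_sqnorm_def intro!: sum_nonneg mult_left_mono)
  also have "\<dots> = spectral_norm M * r"
    using x(1) r0 by (simp add: real_sqrt_mult mult_ac)
  finally show ?thesis .
qed

lemma spectral_norm_singular_vectors: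
  assumes M: "M \<in> carrier_mat p p" and p: "0 < p" and pos: "spectral_norm M > 0"
  obtains u v where "(\<Sum>i<p. (u i)\<^sup>2) = 1" "(\<Sum>j<p. (v j)\<^sup>2) = 1"
    "(\<Sum>i<p. \<Sum>j<p. M $$ (i,j) * u i * v j) = spectral_norm M"
proof -
  let ?A = "\<lambda>i j. M $$ (i,j)"
  obtain v where v: "(\<Sum>j<p. (v j)\<^sup>2) = 1" "image_sqnorm p ?A v = (spectral_norm M)\<^sup>2"
    using spectral_norm_attained[OF M p] by metis
  define u where "u = (\<lambda>i. (\<Sum>j<p. M $$ (i,j) * v j) / spectral_norm M)"
  have "(\<Sum>i<p. (u i)\<^sup>2) = image_sqnorm p ?A v / (spectral_norm M)\<^sup>2"
    by (simp add: u_def image_sqnorm_def power_divide sum_divide_distrib[symmetric])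
  then have u1: "(\<Sum>i<p. (u i)\<^sup>2) = 1" using v(2) pos by simp
  have "(\<Sum>i<p. \<Sum>j<p. M $$ (i,j) * u i * v j) = (\<Sum>i<p. u i * (spectral_norm M * u i))"
    using pos by (simp add: u_def sum_distrib_left sum_divide_distrib mult_ac)
  also have "\<dots> = spectral_norm M * (\<Sum>i<p. (u i)\<^sup>2)"
    by (simp add: sum_distrib_left power2_eq_square mult_ac)
  finally show ?thesis using u1 v(1) that by simp
qed

section \<open>Standard Gaussian vectors and their shifts\<close>

abbreviation std_gauss :: "real measure" where
  "std_gauss \<equiv> density lborel std_normal_density"

abbreviation gauss_vec :: "'i set \<Rightarrow> ('i \<Rightarrow> real) measure" where
  "gauss_vec I \<equiv> PiM I (\<lambda>_. std_gauss)"

interpretation std_gauss: prob_space std_gauss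
  by (rule prob_space_normal_density) simp

interpretation gauss_product: product_sigma_finite "\<lambda>_. std_gauss"
  by (intro product_sigma_finite.intro prob_space_imp_sigma_finite std_gauss.prob_space_axioms)

lemma prob_space_gauss_vec: "prob_space (gauss_vec I)"
  by (intro prob_space_PiM std_gauss.prob_space_axioms)

lemma sets_gauss_vec [measurable_cong]: "sets (gauss_vec I) = sets (PiM I (\<lambda>_. borel))"
  by (intro sets_PiM_cong) auto

lemma gauss_moment_0: "has_bochner_integral std_gauss (\<lambda>z. 1 :: real) 1"
  unfolding has_bochner_integral_iff lebesgue_integral_const std_gauss.prob_space by simp

lemma gauss_moments:
  "has_bochner_integral std_gauss (\<lambda>z. z) 0"
  "has_bochner_integral std_gauss (\<lambda>z. z ^ 2) 1"
  "has_bochner_integral std_gauss (\<lambda>z. z ^ 3) 0"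
  "has_bochner_integral std_gauss (\<lambda>z. z ^ 4) 3"
  using std_normal_moment_odd[of 0] std_normal_moment_even[of 1]
    std_normal_moment_odd[of 1] std_normal_moment_even[of 2]
  by (auto intro!: has_bochner_integral_density simp: fact_numeral eval_nat_numeral)

text \<open>
  Completing the square turns the integrand into a multiple of the normal density with mean \<open>a\<close>.
\<close>

lemma gauss_mgf: "has_bochner_integral std_gauss (\<lambda>z. exp (a * z)) (exp (a\<^sup>2 / 2))"
proof (rule has_bochner_integral_density)
  have "std_normal_density z * exp (a * z) = exp (a\<^sup>2/2) * normal_density a 1 z" for z
    by (simp add: normal_density_def mult_exp_exp power2_eq_square field_simps)
  moreover have "has_bochner_integral lborel (\<lambda>z. exp (a\<^sup>2/2) * normal_density a 1 z) (exp (a\<^sup>2/2) * 1)"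
    by (intro has_bochner_integral_mult_right) (auto simp: has_bochner_integral_iff)
  ultimately show "has_bochner_integral lborel (\<lambda>x. std_normal_density x *\<^sub>R exp (a * x)) (exp (a\<^sup>2/2))"
    by simp
qed auto

lemma gauss_vec_mgf:
  assumes [simp]: "finite I"
  shows "has_bochner_integral (gauss_vec I) (\<lambda>z. exp (\<Sum>i\<in>I. a i * z i)) (exp ((\<Sum>i\<in>I. (a i)\<^sup>2) / 2))"
proof -
  have int: "integrable std_gauss (\<lambda>z. exp (b * z))" and eq: "(\<integral>z. exp (b * z) \<partial>std_gauss) = exp (b\<^sup>2/2)" for b
    using gauss_mgf[of b] by (auto simp: has_bochner_integral_iff)
  show ?thesis
    unfolding has_bochner_integral_iff
    using gauss_product.product_integrable_prod[of I "\<lambda>i z. exp (a i * z)"]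
      gauss_product.product_integral_prod[of I "\<lambda>i z. exp (a i * z)"]
    by (simp add: exp_sum int eq sum_divide_distrib)
qed

text \<open>
  The Chernoff bound with its optimal parameter, which is \<open>t\<close> itself when the variance is 1.
\<close>

lemma gauss_vec_linear_tail:
  assumes I: "finite I" and a: "(\<Sum>i\<in>I. (a i)\<^sup>2) \<le> 1" and t: "t \<ge> 0"
  shows "measure (gauss_vec I) {z \<in> space (gauss_vec I). (\<Sum>i\<in>I. a i * z i) \<ge> t} \<le> exp (- t\<^sup>2 / 2)"
proof (cases "t = 0")
  case True
  interpret prob_space "gauss_vec I" by (rule prob_space_gauss_vec)
  show ?thesis using True by simp
next
  case False
  have mgf: "integrable (gauss_vec I) (\<lambda>z. exp (\<Sum>i\<in>I. (t * a i) * z i))"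
      "(\<integral>z. exp (\<Sum>i\<in>I. (t * a i) * z i) \<partial>gauss_vec I) = exp ((\<Sum>i\<in>I. (t * a i)\<^sup>2) / 2)"
    using gauss_vec_mgf[OF I, of "\<lambda>i. t * a i"] by (auto simp: has_bochner_integral_iff)
  have "measure (gauss_vec I) {z \<in> space (gauss_vec I). exp (\<Sum>i\<in>I. (t * a i) * z i) \<ge> exp (t\<^sup>2)}
      \<le> exp ((\<Sum>i\<in>I. (t * a i)\<^sup>2) / 2) / exp (t\<^sup>2)"
    using integral_Markov_inequality_measure[OF mgf(1), of "{}" "exp (t\<^sup>2)"] mgf(2) by simp
  moreover have "exp (\<Sum>i\<in>I. (t * a i) * z i) \<ge> exp (t\<^sup>2) \<longleftrightarrow> (\<Sum>i\<in>I. a i * z i) \<ge> t" for z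
    using False t by (simp add: mult.assoc sum_distrib_left[symmetric] power2_eq_square)
  ultimately have "measure (gauss_vec I) {z \<in> space (gauss_vec I). (\<Sum>i\<in>I. a i * z i) \<ge> t}
      \<le> exp ((\<Sum>i\<in>I. (t * a i)\<^sup>2) / 2 - t\<^sup>2)" by (simp add: exp_diff)
  also have "\<dots> \<le> exp (- t\<^sup>2 / 2)"
    using mult_left_mono[OF a, of "t\<^sup>2"] by (simp add: power_mult_distrib sum_distrib_left[symmetric])
  finally show ?thesis .
qed

lemma gauss_vec_integral_pair:
  fixes g :: "'i \<Rightarrow> real \<Rightarrow> real"
  assumes I: "finite I" and i: "i \<in> I" and j: "j \<in> I"
    and g: "\<And>l. integrable std_gauss (g l)" "\<And>l. integrable std_gauss (\<lambda>z. (g l z)\<^sup>2)"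
    and g0: "\<And>l. (\<integral>z. g l z \<partial>std_gauss) = 0"
  shows "has_bochner_integral (gauss_vec I) (\<lambda>z. g i (z i) * g j (z j))
     (if i = j then (\<integral>z. (g i z)\<^sup>2 \<partial>std_gauss) else 0)"
proof -
  define f where "f = (\<lambda>l z. (if l = i then g i z else 1) * (if l = j then g j z else 1))"
  have one: "has_bochner_integral std_gauss (\<lambda>z. 1 :: real) 1" by (rule gauss_moment_0)
  have f_eq: "f l = (if l = i \<and> l = j then (\<lambda>z. (g i z)\<^sup>2) else if l = i then g i else if l = j then g j else (\<lambda>z. 1))" for l
    by (auto simp: f_def fun_eq_iff power2_eq_square)
  have int: "integrable std_gauss (f l)" for l
    using g one unfolding f_eq has_bochner_integral_iff by presburger
  have prod: "(\<Prod>l\<in>I. f l (z l)) = g i (z i) * g j (z j)" for z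
    unfolding f_def prod.distrib using I i j by simp
  have "(\<Prod>l\<in>I. \<integral>z. f l z \<partial>std_gauss) = (if i = j then (\<integral>z. (g i z)\<^sup>2 \<partial>std_gauss) else 0)"
  proof (cases "i = j")
    case True
    have "(\<integral>z. f l z \<partial>std_gauss) = (if l = i then (\<integral>z. (g i z)\<^sup>2 \<partial>std_gauss) else 1)" for l
      using True one by (simp add: f_eq has_bochner_integral_iff)
    then show ?thesis using True I i by simp
  next
    case False
    then have "(\<integral>z. f i z \<partial>std_gauss) = 0" using g0[of i] by (simp add: f_eq)
    then show ?thesis using False I i by (auto intro!: prod_zero)
  qed
  then show ?thesis
    unfolding has_bochner_integral_iff
    using gauss_product.product_integrable_prod[of I f, OF I int]
      gauss_product.product_integral_prod[of I f, OF I int] by (simp add: prod)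
qed

text \<open>
  For \<open>X = a + z\<close> the sum is the squared length of \<open>X\<close> minus that of \<open>a\<close>, minus \<open>card I\<close>. Its terms are centred
  and uncorrelated, with second moments \<open>2 + 4 (a i)\<^sup>2\<close>, so this is Chebyshev's inequality.
\<close>

lemma gauss_vec_quadratic_tail:
  assumes I: "finite I" and t: "t > 0"
  shows "measure (gauss_vec I) {z \<in> space (gauss_vec I). \<bar>\<Sum>i\<in>I. (z i)\<^sup>2 - 1 + 2 * a i * z i\<bar> \<ge> t}
    \<le> (\<Sum>i\<in>I. 2 + 4 * (a i)\<^sup>2) / t\<^sup>2"
proof -
  interpret prob_space "gauss_vec I" by (rule prob_space_gauss_vec)
  define g where "g = (\<lambda>i z. z\<^sup>2 - 1 + 2 * a i * z)"
  have 1: "has_bochner_integral std_gauss (g i) 0" for i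
  proof -
    have "has_bochner_integral std_gauss (\<lambda>z. z\<^sup>2 - 1 + (2 * a i) * z) (1 - 1 + (2 * a i) * 0)"
      by (intro has_bochner_integral_add has_bochner_integral_diff has_bochner_integral_mult_right
          gauss_moments gauss_moment_0)
    then show ?thesis by (simp add: g_def)
  qed
  have 2: "has_bochner_integral std_gauss (\<lambda>z. (g i z)\<^sup>2) (2 + 4 * (a i)\<^sup>2)" for i
  proof -
    have "has_bochner_integral std_gauss (\<lambda>z. z^4 + (4 * (a i)\<^sup>2 - 2) * z\<^sup>2 + 1 + (4 * a i) * z ^ 3 - (4 * a i) * z)
       (3 + (4 * (a i)\<^sup>2 - 2) * 1 + 1 + (4 * a i) * 0 - (4 * a i) * 0)"
      by (intro has_bochner_integral_add has_bochner_integral_diff has_bochner_integral_mult_right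
          gauss_moments gauss_moment_0)
    also have "(\<lambda>z. z^4 + (4 * (a i)\<^sup>2 - 2) * z\<^sup>2 + 1 + (4 * a i) * z ^ 3 - (4 * a i) * z) = (\<lambda>z. (g i z)\<^sup>2)"
      by (simp add: g_def fun_eq_iff power2_eq_square power3_eq_cube power4_eq_xxxx algebra_simps)
    finally show ?thesis by simp
  qed
  have g: "\<And>l. integrable std_gauss (g l)" "\<And>l. integrable std_gauss (\<lambda>z. (g l z)\<^sup>2)"
     "\<And>l. (\<integral>z. g l z \<partial>std_gauss) = 0" "\<And>l. (\<integral>z. (g l z)\<^sup>2 \<partial>std_gauss) = 2 + 4 * (a l)\<^sup>2"
    using 1 2 by (auto simp: has_bochner_integral_iff)
  have "has_bochner_integral (gauss_vec I) (\<lambda>z. \<Sum>i\<in>I. \<Sum>j\<in>I. g i (z i) * g j (z j))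
     (\<Sum>i\<in>I. \<Sum>j\<in>I. if i = j then (\<integral>z. (g i z)\<^sup>2 \<partial>std_gauss) else 0)"
    using gauss_vec_integral_pair[OF I, of _ _ g] g by (intro has_bochner_integral_sum) auto
  also have "(\<lambda>z. \<Sum>i\<in>I. \<Sum>j\<in>I. g i (z i) * g j (z j)) = (\<lambda>z. (\<Sum>i\<in>I. g i (z i))\<^sup>2)"
    by (simp add: power2_eq_square sum_product)
  also have "(\<Sum>i\<in>I. \<Sum>j\<in>I. if i = j then (\<integral>z. (g i z)\<^sup>2 \<partial>std_gauss) else 0) = (\<Sum>i\<in>I. 2 + 4 * (a i)\<^sup>2)"
    using I g by (intro sum.cong refl) simp
  finally have sq: "has_bochner_integral (gauss_vec I) (\<lambda>z. (\<Sum>i\<in>I. g i (z i))\<^sup>2) (\<Sum>i\<in>I. 2 + 4 * (a i)\<^sup>2)" .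
  have "(\<lambda>z. \<Sum>i\<in>I. g i (z i)) \<in> borel_measurable (gauss_vec I)"
    unfolding g_def by measurable
  from second_moment_method[OF this _ t] sq show ?thesis
    by (simp add: has_bochner_integral_iff g_def)
qed

text \<open>
  The likelihood ratio of \<open>a + z\<close> against \<open>z\<close>, for a standard Gaussian vector \<open>z\<close> (Cameron and Martin).
\<close>

definition shift_lr :: "'i set \<Rightarrow> ('i \<Rightarrow> real) \<Rightarrow> ('i \<Rightarrow> real) \<Rightarrow> real" where
  "shift_lr I a z = exp ((\<Sum>i\<in>I. a i * z i) - (\<Sum>i\<in>I. (a i)\<^sup>2) / 2)"

lemma shift_lr_measurable [measurable]: "shift_lr I a \<in> borel_measurable (PiM I (\<lambda>_. borel))"
  unfolding shift_lr_def[abs_def] by measurable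

lemma gauss_shift_emeasure:
  assumes [measurable]: "S \<in> sets borel"
  shows "(\<integral>\<^sup>+z. indicator S (a + z) \<partial>std_gauss) = (\<integral>\<^sup>+z. ennreal (exp (a * z - a\<^sup>2/2)) * indicator S z \<partial>std_gauss)"
proof -
  have eq: "normal_density 0 1 z * exp (a * z - a\<^sup>2/2) = normal_density 0 1 (z - a)" for z
    by (simp add: normal_density_def mult_exp_exp power2_eq_square field_simps)
  have "(\<integral>\<^sup>+z. ennreal (exp (a * z - a\<^sup>2/2)) * indicator S z \<partial>std_gauss)
     = (\<integral>\<^sup>+z. ennreal (normal_density 0 1 z) * (ennreal (exp (a * z - a\<^sup>2/2)) * indicator S z) \<partial>lborel)"
    by (subst nn_integral_density) auto
  also have "\<dots> = (\<integral>\<^sup>+z. ennreal (normal_density 0 1 (z - a)) * indicator S z \<partial>lborel)"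
    by (simp add: mult.assoc[symmetric] ennreal_mult'[symmetric] eq)
  also have "\<dots> = (\<integral>\<^sup>+z. ennreal (normal_density 0 1 (a + z - a)) * indicator S (a + z) \<partial>lborel)"
    by (subst nn_integral_real_affine[where c = 1 and t = a]) auto
  also have "\<dots> = (\<integral>\<^sup>+z. indicator S (a + z) \<partial>std_gauss)"
    by (subst nn_integral_density) auto
  finally show ?thesis by simp
qed

text \<open>
  Both sides are product measures, since the likelihood ratio is a product over the coordinates. They
  agree on boxes by the change of variables in each coordinate.
\<close>

lemma gauss_vec_shift:
  assumes I: "finite I"
  shows "distr (gauss_vec I) (PiM I (\<lambda>_. borel)) (\<lambda>z. \<lambda>i\<in>I. a i + z i) = density (gauss_vec I) (shift_lr I a)"
    (is "?D = ?E")
proof -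
  define N where "N = (\<lambda>i. density std_gauss (\<lambda>z. ennreal (exp (a i * z - (a i)\<^sup>2/2))))"
  have emN: "emeasure (N i) S = (\<integral>\<^sup>+z. indicator S (a i + z) \<partial>std_gauss)" if "S \<in> sets borel" for i S
    unfolding N_def using that by (subst emeasure_density) (auto simp: gauss_shift_emeasure)
  have "emeasure (N i) (space (N i)) = 1" for i
    using emN[of UNIV i] std_gauss.emeasure_space_1 by (simp add: N_def)
  then have ps: "prob_space (N i)" for i by (rule prob_spaceI)
  interpret N: product_sigma_finite N
    by (intro product_sigma_finite.intro prob_space_imp_sigma_finite ps)
  have setsN: "sets (N i) = sets borel" for i by (simp add: N_def)
  have setsP: "sets (PiM I N) = sets (PiM I (\<lambda>_. borel))"
    by (intro sets_PiM_cong) (auto simp: setsN)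
  have ind: "indicator (PiE I A) z = (\<Prod>i\<in>I. indicator (A i) (z i) :: ennreal)" if "z \<in> extensional I" for A z
    using I that by (auto simp: indicator_def PiE_def Pi_def prod_zero_iff)
  have "?D = PiM I N"
  proof (rule N.PiM_eqI[OF I])
    show "sets ?D = sets (PiM I N)" using setsP by simp
    fix A assume "\<And>i. i \<in> I \<Longrightarrow> A i \<in> sets (N i)"
    then have A: "\<And>i. i \<in> I \<Longrightarrow> A i \<in> sets borel" by (simp add: setsN)
    then have [measurable]: "PiE I A \<in> sets (PiM I (\<lambda>_. borel))" by (intro sets_PiM_I_finite I) auto
    have "emeasure ?D (PiE I A) = (\<integral>\<^sup>+z. indicator (PiE I A) z \<partial>?D)" by simp
    also have "\<dots> = (\<integral>\<^sup>+z. indicator (PiE I A) (\<lambda>i\<in>I. a i + z i) \<partial>gauss_vec I)"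
      by (subst nn_integral_distr) auto
    also have "\<dots> = (\<integral>\<^sup>+z. (\<Prod>i\<in>I. indicator (A i) (a i + z i)) \<partial>gauss_vec I)"
      by (intro nn_integral_cong) (simp add: ind)
    also have "\<dots> = (\<Prod>i\<in>I. \<integral>\<^sup>+z. indicator (A i) (a i + z) \<partial>std_gauss)"
      by (rule gauss_product.product_nn_integral_prod[OF I, of "\<lambda>i z. indicator (A i) (a i + z)"]) (use A in measurable)
    also have "\<dots> = (\<Prod>i\<in>I. emeasure (N i) (A i))"
      by (intro prod.cong refl) (simp add: emN A)
    finally show "emeasure ?D (PiE I A) = (\<Prod>i\<in>I. emeasure (N i) (A i))" .
  qed
  moreover have "?E = PiM I N"
  proof (rule N.PiM_eqI[OF I])
    show "sets ?E = sets (PiM I N)" using setsP by (simp add: sets_gauss_vec)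
    fix A assume "\<And>i. i \<in> I \<Longrightarrow> A i \<in> sets (N i)"
    then have A: "\<And>i. i \<in> I \<Longrightarrow> A i \<in> sets borel" by (simp add: setsN)
    then have [measurable]: "PiE I A \<in> sets (gauss_vec I)" unfolding sets_gauss_vec by (intro sets_PiM_I_finite I) auto
    have lr: "ennreal (shift_lr I a z) = (\<Prod>i\<in>I. ennreal (exp (a i * z i - (a i)\<^sup>2/2)))" for z
      by (simp add: shift_lr_def prod_ennreal exp_sum[symmetric] I sum_subtractf sum_divide_distrib)
    have "emeasure ?E (PiE I A) = (\<integral>\<^sup>+z. ennreal (shift_lr I a z) * indicator (PiE I A) z \<partial>gauss_vec I)"
      by (subst emeasure_density) auto
    also have "\<dots> = (\<integral>\<^sup>+z. (\<Prod>i\<in>I. ennreal (exp (a i * z i - (a i)\<^sup>2/2)) * indicator (A i) (z i)) \<partial>gauss_vec I)"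
      by (intro nn_integral_cong) (simp add: space_PiM PiE_iff ind lr prod.distrib del: PiE_def)
    also have "\<dots> = (\<Prod>i\<in>I. \<integral>\<^sup>+z. ennreal (exp (a i * z - (a i)\<^sup>2/2)) * indicator (A i) z \<partial>std_gauss)"
      by (rule gauss_product.product_nn_integral_prod[OF I, of "\<lambda>i z. ennreal (exp (a i * z - (a i)\<^sup>2/2)) * indicator (A i) z"])
        (use A in measurable)
    also have "\<dots> = (\<Prod>i\<in>I. emeasure (N i) (A i))"
      by (intro prod.cong refl) (simp add: emN A gauss_shift_emeasure)
    finally show "emeasure ?E (PiE I A) = (\<Prod>i\<in>I. emeasure (N i) (A i))" .
  qed
  ultimately show ?thesis by simp
qed

text \<open>
  The second identity is why the second moment method sees the shifts only through their inner
  products.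
\<close>

lemma shift_lr_moments:
  assumes I: "finite I"
  shows "has_bochner_integral (gauss_vec I) (shift_lr I a) 1"
    and "has_bochner_integral (gauss_vec I) (\<lambda>z. shift_lr I a z * shift_lr I b z) (exp (\<Sum>i\<in>I. a i * b i))"
proof -
  have *: "has_bochner_integral (gauss_vec I) (\<lambda>z. c * exp (\<Sum>i\<in>I. a i * z i)) (c * exp ((\<Sum>i\<in>I. (a i)\<^sup>2)/2))"
    for a and c :: real
    by (intro has_bochner_integral_mult_right gauss_vec_mgf I)
  have "shift_lr I a = (\<lambda>z. exp (- ((\<Sum>i\<in>I. (a i)\<^sup>2)/2)) * exp (\<Sum>i\<in>I. a i * z i))"
    by (simp add: shift_lr_def fun_eq_iff mult_exp_exp)
  then show "has_bochner_integral (gauss_vec I) (shift_lr I a) 1"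
    using *[of "exp (- ((\<Sum>i\<in>I. (a i)\<^sup>2)/2))" a] by (simp add: mult_exp_exp)
  have "shift_lr I a z * shift_lr I b z
      = exp (- ((\<Sum>i\<in>I. (a i)\<^sup>2)/2) - (\<Sum>i\<in>I. (b i)\<^sup>2)/2) * exp (\<Sum>i\<in>I. (a i + b i) * z i)" for z
    unfolding shift_lr_def mult_exp_exp by (simp add: sum.distrib distrib_right)
  moreover have "(\<Sum>i\<in>I. (a i + b i)\<^sup>2) = (\<Sum>i\<in>I. (a i)\<^sup>2) + (\<Sum>i\<in>I. (b i)\<^sup>2) + 2 * (\<Sum>i\<in>I. a i * b i)"
    by (simp add: power2_sum sum.distrib sum_distrib_left mult.assoc)
  ultimately show "has_bochner_integral (gauss_vec I) (\<lambda>z. shift_lr I a z * shift_lr I b z) (exp (\<Sum>i\<in>I. a i * b i))"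
    using *[of "exp (- ((\<Sum>i\<in>I. (a i)\<^sup>2)/2) - (\<Sum>i\<in>I. (b i)\<^sup>2)/2)" "\<lambda>i. a i + b i"]
    by (simp add: mult_exp_exp add_divide_distrib)
qed

section \<open>Testing against a mixture\<close>

text \<open>
  Le Cam's second moment method, with \<open>S\<close> the acceptance region. If \<open>l\<close> is the likelihood ratio of
  the mixture, the two errors add up to 1 minus the integral of \<open>1 - l\<close> over \<open>S\<close>, and that integral is at most the
  \<open>L\<^sup>1\<close> norm, hence at most the \<open>L\<^sup>2\<close> norm of \<open>1 - l\<close>. Weights of total mass below 1 arise when a prior is restricted
  to its well-behaved draws.
\<close>

lemma mixture_testing_lower_bound:
  fixes w :: "'w \<Rightarrow> real" and a :: "'w \<Rightarrow> 'i \<Rightarrow> real"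
  assumes I: "finite I" and W: "finite W" and w: "\<And>x. x \<in> W \<Longrightarrow> w x \<ge> 0"
    and S[measurable]: "S \<in> sets (gauss_vec I)"
  defines "V \<equiv> (\<Sum>x\<in>W. \<Sum>y\<in>W. w x * w y * exp (\<Sum>i\<in>I. a x i * a y i))"
  shows "measure (gauss_vec I) (space (gauss_vec I) - S) + (\<Sum>x\<in>W. w x * measure (density (gauss_vec I) (shift_lr I (a x))) S)
     \<ge> 1 - sqrt (1 - 2 * sum w W + V)"
proof -
  interpret prob_space "gauss_vec I" by (rule prob_space_gauss_vec)
  define l where "l = (\<lambda>z. \<Sum>x\<in>W. w x * shift_lr I (a x) z)"
  have l1: "has_bochner_integral (gauss_vec I) l (sum w W)"
    unfolding l_def using has_bochner_integral_sum[of W "gauss_vec I" "\<lambda>x z. w x * shift_lr I (a x) z" "\<lambda>x. w x * 1"]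
      has_bochner_integral_mult_right[OF shift_lr_moments(1)[OF I]] by simp
  have l2: "has_bochner_integral (gauss_vec I) (\<lambda>z. (l z)\<^sup>2) V"
  proof -
    have "has_bochner_integral (gauss_vec I) (\<lambda>z. \<Sum>x\<in>W. \<Sum>y\<in>W. (w x * w y) * (shift_lr I (a x) z * shift_lr I (a y) z)) V"
      unfolding V_def by (intro has_bochner_integral_sum has_bochner_integral_mult_right shift_lr_moments I)
    moreover have "(\<lambda>z. \<Sum>x\<in>W. \<Sum>y\<in>W. (w x * w y) * (shift_lr I (a x) z * shift_lr I (a y) z)) = (\<lambda>z. (l z)\<^sup>2)"
      by (simp add: l_def power2_eq_square sum_product mult_ac)
    ultimately show ?thesis by simp
  qed
  have d: "has_bochner_integral (gauss_vec I) (\<lambda>z. (1 - l z)\<^sup>2) (1 - 2 * sum w W + V)"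
  proof -
    have "has_bochner_integral (gauss_vec I) (\<lambda>z. 1 - 2 * l z + (l z)\<^sup>2) (1 - 2 * sum w W + V)"
      by (intro has_bochner_integral_add has_bochner_integral_diff has_bochner_integral_mult_right l1 l2)
        (auto simp: has_bochner_integral_iff prob_space)
    then show ?thesis by (simp add: power2_diff algebra_simps)
  qed
  have dint: "integrable (gauss_vec I) (\<lambda>z. 1 - l z)"
    using l1 by (auto simp: has_bochner_integral_iff)
  have E2: "(expectation (\<lambda>z. \<bar>1 - l z\<bar>))\<^sup>2 \<le> 1 - 2 * sum w W + V"
  proof -
    have "0 \<le> variance (\<lambda>z. \<bar>1 - l z\<bar>)" by (rule variance_positive)
    also have "\<dots> = expectation (\<lambda>z. \<bar>1 - l z\<bar>\<^sup>2) - (expectation (\<lambda>z. \<bar>1 - l z\<bar>))\<^sup>2"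
      using dint d by (intro variance_eq) (auto simp: has_bochner_integral_iff)
    finally show ?thesis using d by (simp add: has_bochner_integral_iff)
  qed
  have m: "measure (density (gauss_vec I) (shift_lr I b)) S = expectation (\<lambda>z. shift_lr I b z * indicator S z)" for b
  proof -
    have "measure (density (gauss_vec I) (shift_lr I b)) S = integral\<^sup>L (density (gauss_vec I) (shift_lr I b)) (indicator S)"
      using sets.sets_into_space[OF S] by (simp add: Int_absorb1 Int_absorb2)
    also have "\<dots> = expectation (\<lambda>z. shift_lr I b z * indicator S z)"
      by (subst integral_real_density) (auto simp: shift_lr_def)
    finally show ?thesis .
  qed
  have iS: "integrable (gauss_vec I) (\<lambda>z. shift_lr I b z * indicator S z)" for b
    using shift_lr_moments(1)[OF I, of b] by (intro integrable_real_mult_indicator) (auto simp: has_bochner_integral_iff)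
  have "measure (gauss_vec I) (space (gauss_vec I) - S) = 1 - expectation (indicator S)"
    using prob_compl[OF S] sets.sets_into_space[OF S] by (simp add: Int_absorb1 Int_absorb2)
  moreover have "(\<Sum>x\<in>W. w x * measure (density (gauss_vec I) (shift_lr I (a x))) S) = expectation (\<lambda>z. l z * indicator S z)"
    unfolding m l_def using iS by (simp add: sum_distrib_right mult.assoc)
  moreover have "expectation (\<lambda>z. l z * indicator S z) = expectation (indicator S) - expectation (\<lambda>z. (1 - l z) * indicator S z)"
  proof -
    have "expectation (\<lambda>z. (1 - l z) * indicator S z) = expectation (\<lambda>z. indicator S z - l z * indicator S z)"
      by (simp add: algebra_simps)
    also have "\<dots> = expectation (indicator S) - expectation (\<lambda>z. l z * indicator S z)"
      using l1 by (intro Bochner_Integration.integral_diff integrable_real_mult_indicator integrable_real_indicator)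
        (auto simp: has_bochner_integral_iff emeasure_finite less_top[symmetric])
    finally show ?thesis by simp
  qed
  moreover have "expectation (\<lambda>z. (1 - l z) * indicator S z) \<le> expectation (\<lambda>z. \<bar>1 - l z\<bar>)"
    using dint by (intro integral_mono integrable_real_mult_indicator) (auto split: split_indicator)
  moreover have "expectation (\<lambda>z. \<bar>1 - l z\<bar>) \<le> sqrt (1 - 2 * sum w W + V)"
    using E2 by (rule real_le_rsqrt)
  ultimately show ?thesis by linarith
qed

section \<open>Random subsets\<close>

text \<open>
  The expectation of \<open>f G\<close> for the random subset \<open>G\<close> of \<open>E\<close> that contains each element independently with
  probability \<open>q\<close>. As a finite sum it is linear and interchangeable with other sums unconditionally.
\<close>

definition bernE :: "real \<Rightarrow> 'a set \<Rightarrow> ('a set \<Rightarrow> real) \<Rightarrow> real" where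
  "bernE q E f = (\<Sum>G\<in>Pow E. q ^ card G * (1 - q) ^ card (E - G) * f G)"

lemma bernE_cong: "(\<And>G. G \<subseteq> E \<Longrightarrow> f G = g G) \<Longrightarrow> bernE q E f = bernE q E g"
  unfolding bernE_def by (intro sum.cong) auto

lemma bernE_add: "bernE q E (\<lambda>G. f G + g G) = bernE q E f + bernE q E g"
  by (simp add: bernE_def distrib_left sum.distrib)

lemma bernE_cmult: "bernE q E (\<lambda>G. c * f G) = c * bernE q E f"
  unfolding bernE_def sum_distrib_left by (intro sum.cong) simp_all

lemma bernE_cmult_right: "bernE q E (\<lambda>G. f G * c) = bernE q E f * c"
  unfolding bernE_def sum_distrib_right by (intro sum.cong) simp_all

lemma bernE_sum: "bernE q E (\<lambda>G. \<Sum>x\<in>X. f x G) = (\<Sum>x\<in>X. bernE q E (f x))"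
  unfolding bernE_def sum_distrib_left by (rule sum.swap)

lemma bernE_swap: "bernE q E (\<lambda>G. bernE r F (\<lambda>H. f G H)) = bernE r F (\<lambda>H. bernE q E (\<lambda>G. f G H))"
  unfolding bernE_def sum_distrib_left by (subst sum.swap) (simp add: mult_ac)

lemma bernE_mono:
  assumes "0 \<le> q" "q \<le> 1" "\<And>G. G \<subseteq> E \<Longrightarrow> f G \<le> g G"
  shows "bernE q E f \<le> bernE q E g"
  unfolding bernE_def using assms by (intro sum_mono mult_left_mono) auto

lemma bernE_nonneg:
  assumes "0 \<le> q" "q \<le> 1" "\<And>G. G \<subseteq> E \<Longrightarrow> f G \<ge> 0"
  shows "bernE q E f \<ge> 0"
  unfolding bernE_def using assms by (intro sum_nonneg mult_nonneg_nonneg) auto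

text \<open>
  Independence: each factor depends on one element only. Expanding the product of sums gives one
  term for each subset.
\<close>

lemma bernE_prod:
  assumes "finite E"
  shows "bernE q E (\<lambda>G. \<Prod>e\<in>E. h e (e \<in> G)) = (\<Prod>e\<in>E. q * h e True + (1 - q) * h e False)"
proof -
  have "(\<Prod>e\<in>E. q * h e True + (1 - q) * h e False)
      = (\<Sum>G\<in>Pow E. (\<Prod>e\<in>G. q * h e True) * (\<Prod>e\<in>E - G. (1 - q) * h e False))"
    by (rule prod_add[OF assms])
  also have "\<dots> = bernE q E (\<lambda>G. \<Prod>e\<in>E. h e (e \<in> G))"
    unfolding bernE_def
  proof (intro sum.cong refl)
    fix G assume "G \<in> Pow E"
    then have G: "G \<subseteq> E" "finite G" using assms finite_subset by auto
    have "(\<Prod>e\<in>E. h e (e \<in> G)) = (\<Prod>e\<in>E - G. h e (e \<in> G)) * (\<Prod>e\<in>G. h e (e \<in> G))"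
      by (rule prod.subset_diff[OF G(1) assms])
    also have "\<dots> = (\<Prod>e\<in>E - G. h e False) * (\<Prod>e\<in>G. h e True)"
      by (intro arg_cong2[where f = "(*)"] prod.cong) auto
    finally show "(\<Prod>e\<in>G. q * h e True) * (\<Prod>e\<in>E - G. (1 - q) * h e False)
       = q ^ card G * (1 - q) ^ card (E - G) * (\<Prod>e\<in>E. h e (e \<in> G))"
      by (simp add: prod.distrib)
  qed
  finally show ?thesis by simp
qed

lemma bernE_const: "finite E \<Longrightarrow> bernE q E (\<lambda>_. c) = c"
  using bernE_prod[of E q "\<lambda>_ _. 1"] bernE_cmult[of q E c "\<lambda>_. 1"] by simp

lemma bernE_insert:
  assumes "finite E" "e \<notin> E"
  shows "bernE q (insert e E) f = q * bernE q E (\<lambda>G. f (insert e G)) + (1 - q) * bernE q E f"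
proof -
  have fin: "finite G" and notin: "e \<notin> G" if "G \<in> Pow E" for G
    using that assms finite_subset by auto
  have inj: "inj_on (insert e) (Pow E)"
    using assms(2) by (auto simp: inj_on_def dest!: insert_ident[THEN iffD1, rotated 2])
  have d1: "insert e E - G = insert e (E - G)" if "G \<in> Pow E" for G using notin[OF that] by auto
  have d2: "insert e E - insert e G = E - G" if "G \<in> Pow E" for G using assms(2) by auto
  have "bernE q (insert e E) f = (\<Sum>G\<in>Pow E. q ^ card G * (1 - q) ^ card (insert e E - G) * f G)
      + (\<Sum>G\<in>insert e ` Pow E. q ^ card G * (1 - q) ^ card (insert e E - G) * f G)"
    unfolding bernE_def Pow_insert using assms by (intro sum.union_disjoint) auto
  also have "(\<Sum>G\<in>insert e ` Pow E. q ^ card G * (1 - q) ^ card (insert e E - G) * f G)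
     = q * bernE q E (\<lambda>G. f (insert e G))"
    unfolding sum.reindex[OF inj] bernE_def sum_distrib_left o_def
    by (intro sum.cong refl) (simp add: d2 fin notin del: insert_Diff_single insert_Diff1 Diff_insert0)
  also have "(\<Sum>G\<in>Pow E. q ^ card G * (1 - q) ^ card (insert e E - G) * f G) = (1 - q) * bernE q E f"
    unfolding bernE_def sum_distrib_left
    using assms by (intro sum.cong refl) (simp add: d1 fin notin)
  finally show ?thesis by simp
qed

lemma of_bool_prod: "finite E \<Longrightarrow> of_bool (\<forall>e\<in>E. P e) = (\<Prod>e\<in>E. of_bool (P e) :: real)"
  by (induction E rule: finite_induct) auto

lemma bernE_subset:
  assumes "finite E" "S \<subseteq> E"
  shows "bernE q E (\<lambda>G. of_bool (S \<subseteq> G)) = q ^ card S"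
proof -
  have "of_bool (S \<subseteq> G) = (\<Prod>e\<in>E. of_bool (e \<in> S \<longrightarrow> e \<in> G) :: real)" for G
    using assms by (subst of_bool_prod[symmetric]) (auto intro!: arg_cong[of _ _ of_bool])
  then have "bernE q E (\<lambda>G. of_bool (S \<subseteq> G)) = (\<Prod>e\<in>E. if e \<in> S then q else 1)"
    using bernE_prod[OF assms(1), of q "\<lambda>e b. of_bool (e \<in> S \<longrightarrow> b)"]
    by (auto intro!: prod.cong)
  also have "\<dots> = q ^ card S"
    using assms by (simp add: prod.If_cases Int_absorb1)
  finally show ?thesis .
qed

text \<open>
  The binomial moment generating function is at most that of the Poisson law with the same mean.
\<close>

lemma bernE_exp_card:
  assumes "finite E" "0 \<le> q" "q \<le> 1"
  shows "bernE q E (\<lambda>G. exp (t * real (card G))) \<le> exp (real (card E) * q * (exp t - 1))"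
proof -
  have "exp (t * real (card G)) = (\<Prod>e\<in>E. if e \<in> G then exp t else 1)" if "G \<subseteq> E" for G
    using that assms(1) by (simp add: prod.If_cases Int_absorb1 exp_of_nat2_mult)
  then have "bernE q E (\<lambda>G. exp (t * real (card G))) = bernE q E (\<lambda>G. \<Prod>e\<in>E. if e \<in> G then exp t else 1)"
    by (rule bernE_cong)
  also have "\<dots> = (1 + q * (exp t - 1)) ^ card E"
    using bernE_prod[OF assms(1), of q "\<lambda>e b. if b then exp t else 1"] by (simp add: algebra_simps)
  also have "\<dots> \<le> exp (q * (exp t - 1)) ^ card E"
  proof (intro power_mono exp_ge_add_one_self)
    have "q * (exp t - 1) \<ge> q * (- 1)" using assms by (intro mult_left_mono) auto
    then show "0 \<le> 1 + q * (exp t - 1)" using assms by simp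
  qed
  also have "\<dots> = exp (real (card E) * q * (exp t - 1))" by (simp add: exp_of_nat_mult[symmetric] mult_ac)
  finally show ?thesis .
qed

text \<open>
  The elements at which \<open>\<phi>\<close> holds form a random subset of the same kind, since each element is decided
  independently; \<open>t\<close> is the probability that \<open>\<phi>\<close> holds at a given element. Writing \<open>f\<close> as a combination of
  indicators of single subsets reduces the claim to products over \<open>E\<close>.
\<close>

lemma bernE_pair_push:
  assumes E: "finite E"
    and w: "q * (r * of_bool (\<phi> True True) + (1 - r) * of_bool (\<phi> True False))
      + (1 - q) * (r * of_bool (\<phi> False True) + (1 - r) * of_bool (\<phi> False False)) = t"
  shows "bernE q E (\<lambda>A. bernE r E (\<lambda>B. f {e \<in> E. \<phi> (e \<in> A) (e \<in> B)})) = bernE t E f"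
proof -
  let ?h = "\<lambda>C e a b. of_bool (\<phi> a b = (e \<in> C)) :: real"
  have "f {e \<in> E. \<phi> (e \<in> A) (e \<in> B)} = (\<Sum>C\<in>Pow E. f C * (\<Prod>e\<in>E. ?h C e (e \<in> A) (e \<in> B)))" for A B
  proof -
    have "(\<Prod>e\<in>E. ?h C e (e \<in> A) (e \<in> B)) = of_bool (C = {e \<in> E. \<phi> (e \<in> A) (e \<in> B)})" if "C \<subseteq> E" for C
      unfolding of_bool_prod[OF E, symmetric] using that by (auto intro!: arg_cong[of _ _ of_bool])
    then have "(\<Sum>C\<in>Pow E. f C * (\<Prod>e\<in>E. ?h C e (e \<in> A) (e \<in> B)))
       = (\<Sum>C\<in>Pow E. if C = {e \<in> E. \<phi> (e \<in> A) (e \<in> B)} then f C else 0)"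
      by (intro sum.cong refl) auto
    also have "\<dots> = f {e \<in> E. \<phi> (e \<in> A) (e \<in> B)}" using E by (subst sum.delta) auto
    finally show ?thesis by simp
  qed
  then have "bernE q E (\<lambda>A. bernE r E (\<lambda>B. f {e \<in> E. \<phi> (e \<in> A) (e \<in> B)}))
    = (\<Sum>C\<in>Pow E. f C * bernE q E (\<lambda>A. bernE r E (\<lambda>B. \<Prod>e\<in>E. ?h C e (e \<in> A) (e \<in> B))))"
    by (simp add: bernE_sum bernE_cmult)
  also have "\<dots> = bernE t E f"
    unfolding bernE_def[of t]
  proof (intro sum.cong refl)
    fix C assume C: "C \<in> Pow E"
    have "bernE q E (\<lambda>A. bernE r E (\<lambda>B. \<Prod>e\<in>E. ?h C e (e \<in> A) (e \<in> B)))
       = bernE q E (\<lambda>A. \<Prod>e\<in>E. r * ?h C e (e \<in> A) True + (1 - r) * ?h C e (e \<in> A) False)"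
      by (subst bernE_prod[OF E]) simp
    also have "\<dots> = (\<Prod>e\<in>E. q * (r * ?h C e True True + (1 - r) * ?h C e True False)
         + (1 - q) * (r * ?h C e False True + (1 - r) * ?h C e False False))"
      by (rule bernE_prod[OF E, of q "\<lambda>e a. r * ?h C e a True + (1 - r) * ?h C e a False"])
    also have "\<dots> = (\<Prod>e\<in>E. if e \<in> C then t else 1 - t)"
      using w by (intro prod.cong refl) (auto simp: of_bool_def algebra_simps split: if_splits)
    also have "\<dots> = t ^ card C * (1 - t) ^ card (E - C)"
      using E C by (auto simp: prod.If_cases Int_absorb1 Diff_eq)
    finally show "f C * bernE q E (\<lambda>A. bernE r E (\<lambda>B. \<Prod>e\<in>E. ?h C e (e \<in> A) (e \<in> B)))
      = t ^ card C * (1 - t) ^ card (E - C) * f C" by simp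
  qed
  finally show ?thesis .
qed

lemma bernE_inter:
  assumes "finite E"
  shows "bernE q E (\<lambda>A. bernE r E (\<lambda>B. f (A \<inter> B))) = bernE (q * r) E f"
proof -
  have "bernE q E (\<lambda>A. bernE r E (\<lambda>B. f (A \<inter> B)))
     = bernE q E (\<lambda>A. bernE r E (\<lambda>B. f {e \<in> E. e \<in> A \<and> e \<in> B}))"
    by (intro bernE_cong arg_cong[of _ _ f]) auto
  also have "\<dots> = bernE (q * r) E f" by (rule bernE_pair_push[OF assms]) simp
  finally show ?thesis .
qed

text \<open>
  In terms of signs: the product of two independent uniform sign vectors is a uniform sign vector.
\<close>

lemma bernE_agree:
  assumes "finite E"
  shows "bernE (1/2) E (\<lambda>A. bernE (1/2) E (\<lambda>B. f {e \<in> E. e \<in> A \<longleftrightarrow> e \<in> B})) = bernE (1/2) E f"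
  by (rule bernE_pair_push[OF assms]) simp

lemma card_inter_sum: "finite F \<Longrightarrow> real (card (G \<inter> F)) = (\<Sum>e\<in>F. of_bool (e \<in> G))"
  by (simp add: Int_commute of_bool_def sum.If_cases)

lemma bernE_Chebyshev:
  assumes E: "finite E" and F: "F \<subseteq> E" and q: "0 \<le> q" "q \<le> 1" and t: "t > 0"
  shows "bernE q E (\<lambda>G. of_bool (\<bar>real (card (G \<inter> F)) - q * card F\<bar> \<ge> t)) \<le> q * card F / t\<^sup>2"
proof -
  have finF: "finite F" using E F finite_subset by blast
  let ?n = "real (card F)"
  have 1: "bernE q E (\<lambda>G. real (card (G \<inter> F))) = q * ?n"
  proof -
    have "bernE q E (\<lambda>G. of_bool (e \<in> G)) = q" if "e \<in> F" for e
      using bernE_subset[OF E, of "{e}" q] that F by auto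
    then show ?thesis by (simp add: card_inter_sum[OF finF] bernE_sum mult.commute)
  qed
  have 2: "bernE q E (\<lambda>G. (real (card (G \<inter> F)))\<^sup>2) \<le> ?n * q + ?n\<^sup>2 * q\<^sup>2"
  proof -
    have "bernE q E (\<lambda>G. of_bool (e \<in> G) * of_bool (e' \<in> G)) \<le> (if e = e' then q else 0) + q\<^sup>2"
      if "e \<in> F" "e' \<in> F" for e e'
    proof -
      have "bernE q E (\<lambda>G. of_bool (e \<in> G) * of_bool (e' \<in> G)) = bernE q E (\<lambda>G. of_bool ({e, e'} \<subseteq> G))"
        by (rule bernE_cong) auto
      also have "\<dots> = q ^ card {e, e'}" using that F by (intro bernE_subset E) auto
      also have "\<dots> \<le> (if e = e' then q else 0) + q\<^sup>2" using q by (auto simp: power2_eq_square)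
      finally show ?thesis .
    qed
    then have "bernE q E (\<lambda>G. (real (card (G \<inter> F)))\<^sup>2) \<le> (\<Sum>e\<in>F. \<Sum>e'\<in>F. (if e = e' then q else 0) + q\<^sup>2)"
      unfolding card_inter_sum[OF finF] power2_eq_square sum_product bernE_sum
      by (intro sum_mono) (auto simp: power2_eq_square)
    also have "\<dots> = ?n * q + ?n\<^sup>2 * q\<^sup>2"
      by (simp add: sum.distrib finF power2_eq_square algebra_simps)
    finally show ?thesis .
  qed
  have "bernE q E (\<lambda>G. of_bool (\<bar>real (card (G \<inter> F)) - q * ?n\<bar> \<ge> t))
     \<le> bernE q E (\<lambda>G. (real (card (G \<inter> F)) - q * ?n)\<^sup>2 * (1 / t\<^sup>2))"
  proof (rule bernE_mono[OF q])
    fix G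
    show "of_bool (t \<le> \<bar>real (card (G \<inter> F)) - q * ?n\<bar>) \<le> (real (card (G \<inter> F)) - q * ?n)\<^sup>2 * (1 / t\<^sup>2)"
      using t abs_le_square_iff[of t "real (card (G \<inter> F)) - q * ?n"] by (auto simp: field_simps)
  qed
  also have "\<dots> = bernE q E (\<lambda>G. (real (card (G \<inter> F)))\<^sup>2 + ((- 2 * (q * ?n)) * real (card (G \<inter> F)) + (q * ?n)\<^sup>2)) / t\<^sup>2"
    unfolding bernE_cmult_right by (simp add: power2_diff algebra_simps)
  also have "\<dots> \<le> (?n * q) / t\<^sup>2"
    unfolding bernE_add bernE_cmult 1 bernE_const[OF E] using 2
    by (intro divide_right_mono) (simp_all add: power2_eq_square algebra_simps)
  finally show ?thesis by (simp add: mult.commute)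
qed

section \<open>Thinned random supports\<close>

text \<open>
  A set of positions is viewed as a bipartite graph between rows and columns. Emptying every row and
  column of degree above \<open>k\<close> leaves a \<open>k\<close>-sparse support contained in the given one.
\<close>

definition thin :: "nat \<Rightarrow> ('a \<times> 'a) set \<Rightarrow> ('a \<times> 'a) set" where
  "thin k H = {(i, j) \<in> H. card (H `` {i}) \<le> k \<and> card (H\<inverse> `` {j}) \<le> k}"

lemma thin_subset: "thin k H \<subseteq> H"
  by (auto simp: thin_def)

lemma thin_degrees:
  assumes "finite H"
  shows "card (thin k H `` {i}) \<le> k" "card ((thin k H)\<inverse> `` {j}) \<le> k"
proof -
  have fin: "finite (H `` {i})" "finite (H\<inverse> `` {j})"
    using assms by (auto intro!: finite_Image)
  show "card (thin k H `` {i}) \<le> k"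
  proof (cases "thin k H `` {i} = {}")
    case False
    then have "card (H `` {i}) \<le> k" by (auto simp: thin_def)
    moreover have "card (thin k H `` {i}) \<le> card (H `` {i})"
      by (intro card_mono fin) (auto simp: thin_def)
    ultimately show ?thesis by simp
  qed simp
  show "card ((thin k H)\<inverse> `` {j}) \<le> k"
  proof (cases "(thin k H)\<inverse> `` {j} = {}")
    case False
    then have "card (H\<inverse> `` {j}) \<le> k" by (auto simp: thin_def)
    moreover have "card ((thin k H)\<inverse> `` {j}) \<le> card (H\<inverse> `` {j})"
      by (intro card_mono fin) (auto simp: thin_def)
    ultimately show ?thesis by simp
  qed simp
qed

text \<open>
  An edge is removed only if its row or its column contains at least \<open>k\<close> further edges. Counting these
  bounds \<open>k\<close> times the number of removed edges by the number of ordered pairs of edges in a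
  common row or column.
\<close>

lemma card_removed_by_thin:
  assumes I: "finite I" and H: "H \<subseteq> I \<times> I" and k: "k > 0"
  shows "real k * card (H - thin k H) \<le>
     (\<Sum>i\<in>I. \<Sum>j\<in>I. \<Sum>l\<in>I - {j}. of_bool ((i,j) \<in> H \<and> (i,l) \<in> H))
   + (\<Sum>i\<in>I. \<Sum>j\<in>I. \<Sum>l\<in>I - {i}. of_bool ((i,j) \<in> H \<and> (l,j) \<in> H))"
proof -
  have fin: "finite H" using I H finite_subset by blast
  have row: "real k * of_bool ((i,j) \<in> H \<and> \<not> card (H `` {i}) \<le> k) \<le> (\<Sum>l\<in>I - {j}. of_bool ((i,j) \<in> H \<and> (i,l) \<in> H))" for i j
  proof (cases "(i,j) \<in> H \<and> \<not> card (H `` {i}) \<le> k")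
    case True
    then have "k \<le> card (H `` {i} - {j})" using fin by (subst card_Diff_singleton) auto
    also have "H `` {i} - {j} = (I - {j}) \<inter> {l. (i,l) \<in> H}" using H by auto
    finally show ?thesis using True I by (simp add: of_bool_def sum.If_cases)
  next
    case False
    then have "of_bool ((i,j) \<in> H \<and> \<not> card (H `` {i}) \<le> k) = (0 :: real)" by (simp only: of_bool_eq)
    then show ?thesis by (simp only: mult_zero_right) (intro sum_nonneg, simp)
  qed
  have col: "real k * of_bool ((i,j) \<in> H \<and> \<not> card (H\<inverse> `` {j}) \<le> k) \<le> (\<Sum>l\<in>I - {i}. of_bool ((i,j) \<in> H \<and> (l,j) \<in> H))" for i j
  proof (cases "(i,j) \<in> H \<and> \<not> card (H\<inverse> `` {j}) \<le> k")
    case True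
    then have "k \<le> card (H\<inverse> `` {j} - {i})" using fin by (subst card_Diff_singleton) auto
    also have "H\<inverse> `` {j} - {i} = (I - {i}) \<inter> {l. (l,j) \<in> H}" using H by auto
    finally show ?thesis using True I by (simp add: of_bool_def sum.If_cases)
  next
    case False
    then have "of_bool ((i,j) \<in> H \<and> \<not> card (H\<inverse> `` {j}) \<le> k) = (0 :: real)" by (simp only: of_bool_eq)
    then show ?thesis by (simp only: mult_zero_right) (intro sum_nonneg, simp)
  qed
  have "real (card (H - thin k H)) = (\<Sum>(i,j)\<in>I \<times> I. of_bool ((i,j) \<in> H - thin k H))"
  proof -
    have "(H - thin k H) \<inter> (I \<times> I) = H - thin k H" using H by auto
    then show ?thesis
      using card_inter_sum[of "I \<times> I" "H - thin k H"] I by (simp add: case_prod_unfold)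
  qed
  also have "\<dots> \<le> (\<Sum>(i,j)\<in>I \<times> I. of_bool ((i,j) \<in> H \<and> \<not> card (H `` {i}) \<le> k)
      + of_bool ((i,j) \<in> H \<and> \<not> card (H\<inverse> `` {j}) \<le> k))"
    by (intro sum_mono) (auto simp: thin_def)
  finally have "real k * card (H - thin k H) \<le> (\<Sum>(i,j)\<in>I \<times> I. real k * of_bool ((i,j) \<in> H \<and> \<not> card (H `` {i}) \<le> k)
      + real k * of_bool ((i,j) \<in> H \<and> \<not> card (H\<inverse> `` {j}) \<le> k))"
    using k by (simp add: case_prod_unfold distrib_left[symmetric] sum_distrib_left[symmetric])
  also have "\<dots> \<le> (\<Sum>(i,j)\<in>I \<times> I. (\<Sum>l\<in>I - {j}. of_bool ((i,j) \<in> H \<and> (i,l) \<in> H))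
       + (\<Sum>l\<in>I - {i}. of_bool ((i,j) \<in> H \<and> (l,j) \<in> H)))"
    by (intro sum_mono, unfold case_prod_unfold, intro add_mono row col)
  finally show ?thesis
    by (simp add: sum.cartesian_product[symmetric] sum.distrib)
qed

definition supportE :: "real \<Rightarrow> real \<Rightarrow> 'a set \<Rightarrow> ('a set \<Rightarrow> 'a set \<Rightarrow> ('a \<times> 'a) set \<Rightarrow> real) \<Rightarrow> real" where
  "supportE \<alpha> q I f = bernE \<alpha> I (\<lambda>A. bernE \<alpha> I (\<lambda>B. bernE q (I \<times> I) (\<lambda>G. f A B G)))"

lemma supportE_mono:
  assumes "0 \<le> \<alpha>" "\<alpha> \<le> 1" "0 \<le> q" "q \<le> 1"
    "\<And>A B G. A \<subseteq> I \<Longrightarrow> B \<subseteq> I \<Longrightarrow> G \<subseteq> I \<times> I \<Longrightarrow> f A B G \<le> g A B G"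
  shows "supportE \<alpha> q I f \<le> supportE \<alpha> q I g"
  unfolding supportE_def using assms by (intro bernE_mono) auto

lemma supportE_add: "supportE \<alpha> q I (\<lambda>A B G. f A B G + g A B G) = supportE \<alpha> q I f + supportE \<alpha> q I g"
  by (simp add: supportE_def bernE_add)

lemma supportE_cmult: "supportE \<alpha> q I (\<lambda>A B G. c * f A B G) = c * supportE \<alpha> q I f"
  by (simp add: supportE_def bernE_cmult)

lemma supportE_sum: "supportE \<alpha> q I (\<lambda>A B G. \<Sum>x\<in>X. f x A B G) = (\<Sum>x\<in>X. supportE \<alpha> q I (f x))"
  by (simp add: supportE_def bernE_sum)

lemma supportE_mult:
  "supportE \<alpha> q I (\<lambda>A B G. f A * (g B * h G)) = bernE \<alpha> I f * (bernE \<alpha> I g * bernE q (I \<times> I) h)"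
  by (simp add: supportE_def bernE_cmult bernE_cmult_right)

text \<open>
  Two given positions in a common row lie in the random support with probability \<open>\<alpha> ^ 3 * q\<^sup>2\<close>: one row,
  two columns and two positions have to be selected. There are at most \<open>(card I) ^ 3\<close> such pairs, and
  the same holds for pairs in a common column.
\<close>

lemma supportE_removed:
  fixes I :: "'a set"
  assumes I: "finite I" and k: "k > 0" and \<alpha>: "0 \<le> \<alpha>" "\<alpha> \<le> 1" and q: "0 \<le> q" "q \<le> 1"
  shows "supportE \<alpha> q I (\<lambda>A B G. real (card (G \<inter> A \<times> B - thin k (G \<inter> A \<times> B)))) \<le> 2 * (real (card I) * \<alpha>) ^ 3 * q\<^sup>2 / k"
proof -
  let ?n = "real (card I)"
  have pair: "bernE \<alpha> I (\<lambda>B. of_bool ({j, l} \<subseteq> B)) = \<alpha>\<^sup>2" if "j \<in> I" "l \<in> I - {j}" for j l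
    using that by (subst bernE_subset[OF I]) (auto simp: power2_eq_square)
  have single: "bernE \<alpha> I (\<lambda>B. of_bool ({j} \<subseteq> B)) = \<alpha>" if "j \<in> I" for j
    using that by (subst bernE_subset[OF I]) auto
  have edges: "bernE q (I \<times> I) (\<lambda>G. of_bool ({e, e'} \<subseteq> G)) = q\<^sup>2" if "e \<in> I \<times> I" "e' \<in> I \<times> I" "e \<noteq> e'" for e e'
    using that I by (subst bernE_subset) (auto simp: power2_eq_square)
  have 1: "supportE \<alpha> q I (\<lambda>A B G. of_bool ((i,j) \<in> G \<inter> A \<times> B \<and> (i,l) \<in> G \<inter> A \<times> B)) = \<alpha> ^ 3 * q\<^sup>2"
    if "i \<in> I" "j \<in> I" "l \<in> I - {j}" for i j l
  proof -
    have eq: "(\<lambda>A B G. of_bool ((i,j) \<in> G \<inter> A \<times> B \<and> (i,l) \<in> G \<inter> A \<times> B) :: real)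
       = (\<lambda>A B G. of_bool ({i} \<subseteq> A) * (of_bool ({j,l} \<subseteq> B) * of_bool ({(i,j),(i,l)} \<subseteq> G)))"
      by (intro ext) (auto simp: of_bool_conj[symmetric] intro!: arg_cong[of _ _ of_bool])
    have "(i,j) \<in> I \<times> I" "(i,l) \<in> I \<times> I" "(i,j) \<noteq> (i,l)" using that by auto
    then show ?thesis
      unfolding eq supportE_mult single[OF that(1)] pair[OF that(2,3)] edges[OF \<open>(i,j) \<in> I \<times> I\<close> \<open>(i,l) \<in> I \<times> I\<close> \<open>(i,j) \<noteq> (i,l)\<close>]
      by (simp add: power3_eq_cube power2_eq_square)
  qed
  have 2: "supportE \<alpha> q I (\<lambda>A B G. of_bool ((i,j) \<in> G \<inter> A \<times> B \<and> (l,j) \<in> G \<inter> A \<times> B)) = \<alpha> ^ 3 * q\<^sup>2"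
    if "i \<in> I" "j \<in> I" "l \<in> I - {i}" for i j l
  proof -
    have eq: "(\<lambda>A B G. of_bool ((i,j) \<in> G \<inter> A \<times> B \<and> (l,j) \<in> G \<inter> A \<times> B) :: real)
       = (\<lambda>A B G. of_bool ({i,l} \<subseteq> A) * (of_bool ({j} \<subseteq> B) * of_bool ({(i,j),(l,j)} \<subseteq> G)))"
      by (intro ext) (auto simp: of_bool_conj[symmetric] intro!: arg_cong[of _ _ of_bool])
    have "(i,j) \<in> I \<times> I" "(l,j) \<in> I \<times> I" "(i,j) \<noteq> (l,j)" using that by auto
    then show ?thesis
      unfolding eq supportE_mult single[OF that(2)] pair[OF that(1,3)] edges[OF \<open>(i,j) \<in> I \<times> I\<close> \<open>(l,j) \<in> I \<times> I\<close> \<open>(i,j) \<noteq> (l,j)\<close>]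
      by (simp add: power3_eq_cube power2_eq_square)
  qed
  have S1: "(\<Sum>i\<in>I. \<Sum>j\<in>I. \<Sum>l\<in>I - {j}. c) \<le> ?n ^ 3 * c" and S2: "(\<Sum>i\<in>I. \<Sum>j\<in>I. \<Sum>l\<in>I - {i}. c) \<le> ?n ^ 3 * c"
    if "c \<ge> 0" for c :: real
  proof -
    have *: "(\<Sum>l\<in>I - {j}. c) \<le> (\<Sum>l\<in>I. c)" for j using I that by (intro sum_mono2) auto
    have eq: "?n ^ 3 * c = (\<Sum>i\<in>I. \<Sum>j\<in>I. \<Sum>l\<in>I. c)" by (simp add: power3_eq_cube)
    show "(\<Sum>i\<in>I. \<Sum>j\<in>I. \<Sum>l\<in>I - {j}. c) \<le> ?n ^ 3 * c" "(\<Sum>i\<in>I. \<Sum>j\<in>I. \<Sum>l\<in>I - {i}. c) \<le> ?n ^ 3 * c"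
      unfolding eq by (intro sum_mono *)+
  qed
  have "real k * supportE \<alpha> q I (\<lambda>A B G. real (card (G \<inter> A \<times> B - thin k (G \<inter> A \<times> B))))
    \<le> supportE \<alpha> q I (\<lambda>A B G. (\<Sum>i\<in>I. \<Sum>j\<in>I. \<Sum>l\<in>I - {j}. of_bool ((i,j) \<in> G \<inter> A \<times> B \<and> (i,l) \<in> G \<inter> A \<times> B))
        + (\<Sum>i\<in>I. \<Sum>j\<in>I. \<Sum>l\<in>I - {i}. of_bool ((i,j) \<in> G \<inter> A \<times> B \<and> (l,j) \<in> G \<inter> A \<times> B)))"
    unfolding supportE_cmult[symmetric]
    by (intro supportE_mono \<alpha> q card_removed_by_thin I k) auto
  also have "\<dots> = (\<Sum>i\<in>I. \<Sum>j\<in>I. \<Sum>l\<in>I - {j}. \<alpha> ^ 3 * q\<^sup>2) + (\<Sum>i\<in>I. \<Sum>j\<in>I. \<Sum>l\<in>I - {i}. \<alpha> ^ 3 * q\<^sup>2)"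
    unfolding supportE_add supportE_sum by (intro arg_cong2[where f = "(+)"] sum.cong refl 1 2) auto
  also have "\<dots> \<le> ?n ^ 3 * (\<alpha> ^ 3 * q\<^sup>2) + ?n ^ 3 * (\<alpha> ^ 3 * q\<^sup>2)"
    using \<alpha> by (intro add_mono S1 S2) auto
  also have "\<dots> = 2 * (?n * \<alpha>) ^ 3 * q\<^sup>2" by (simp add: power_mult_distrib)
  finally show ?thesis using k by (simp add: field_simps)
qed

text \<open>
  Here \<open>s\<close> stands for the mean size of \<open>A\<close> and of \<open>B\<close>, so that \<open>s\<^sup>2 * q\<close> is the mean number of edges before
  thinning.
\<close>

definition good_support :: "nat \<Rightarrow> real \<Rightarrow> real \<Rightarrow> 'a set \<Rightarrow> 'a set \<Rightarrow> ('a \<times> 'a) set \<Rightarrow> bool" where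
  "good_support k s q A B G \<longleftrightarrow> real (card A) \<le> 2 * s \<and> real (card B) \<le> 2 * s
     \<and> s\<^sup>2 * q / 16 \<le> real (card (thin k (G \<inter> A \<times> B)))"

text \<open>
  Three events suffice: \<open>A\<close> and \<open>B\<close> have sizes within \<open>s / 2\<close> of their mean, the number of edges in \<open>A \<times> B\<close> is at
  least half its conditional mean, and fewer than \<open>s\<^sup>2 * q / 16\<close> edges are removed. The first two fail
  with probability at most \<open>8 / s\<close> and \<open>16 / (q * s\<^sup>2)\<close> by Chebyshev's inequality, and the third with
  probability at most \<open>32 * s * q / k\<close> by Markov's inequality.
\<close>

lemma good_support_probability:
  fixes I :: "'a set"
  assumes I: "finite I" and k: "k > 0" and \<alpha>: "0 < \<alpha>" "\<alpha> \<le> 1" and q: "0 < q" "q \<le> 1"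
    and s: "s = real (card I) * \<alpha>" "s > 0"
  shows "supportE \<alpha> q I (\<lambda>A B G. of_bool (good_support k s q A B G)) \<ge> 1 - (8 / s + 16 / (q * s\<^sup>2) + 32 * s * q / k)"
proof -
  have \<alpha>': "0 \<le> \<alpha>" and q': "0 \<le> q" using \<alpha> q by auto
  have finII: "finite (I \<times> I)" using I by simp
  define dev where "dev = (\<lambda>A. of_bool (\<bar>real (card (A \<inter> I)) - s\<bar> \<ge> s / 2) :: real)"
  define rem where "rem = (\<lambda>(A :: 'a set) (B :: 'a set) G. real (card (G \<inter> A \<times> B - thin k (G \<inter> A \<times> B))))"
  define few where "few = (\<lambda>(A :: 'a set) (B :: 'a set) G. of_bool (real (card A) \<ge> s/2 \<and> real (card B) \<ge> s/2
     \<and> \<bar>real (card (G \<inter> A \<times> B)) - q * card (A \<times> B)\<bar> \<ge> q * card (A \<times> B) / 2) :: real)"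
  have Edev: "bernE \<alpha> I dev \<le> 4 / s"
  proof -
    have s': "\<alpha> * real (card I) = s" using s by simp
    have "bernE \<alpha> I dev \<le> s / (s / 2)\<^sup>2"
      using bernE_Chebyshev[OF I order_refl \<alpha>' \<alpha>(2), of "s/2"] s(2) unfolding dev_def s' by simp
    then show ?thesis using s(2) by (simp add: power2_eq_square field_simps)
  qed
  have Efew: "bernE q (I \<times> I) (few A B) \<le> 16 / (q * s\<^sup>2)" if AB: "A \<subseteq> I" "B \<subseteq> I" for A B
  proof (cases "real (card A) \<ge> s/2 \<and> real (card B) \<ge> s/2")
    case True
    let ?c = "real (card (A \<times> B))"
    have c: "?c \<ge> s\<^sup>2 / 4"
    proof -
      have "(s/2) * (s/2) \<le> real (card A) * real (card B)" using True s by (intro mult_mono) auto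
      then show ?thesis by (simp add: power2_eq_square card_cartesian_product)
    qed
    moreover have "s\<^sup>2 / 4 > 0" using zero_less_power[OF s(2), of 2] by simp
    ultimately have c0: "?c > 0" by linarith
    have "bernE q (I \<times> I) (few A B) = bernE q (I \<times> I) (\<lambda>G. of_bool (\<bar>real (card (G \<inter> A \<times> B)) - q * ?c\<bar> \<ge> q * ?c / 2))"
      using True by (simp add: few_def)
    also have "\<dots> \<le> q * ?c / (q * ?c / 2)\<^sup>2"
      using AB c0 q by (intro bernE_Chebyshev finII) auto
    also have "\<dots> = 4 / (q * ?c)" using c0 q by (simp add: power2_eq_square field_simps)
    also have "\<dots> \<le> 4 / (q * (s\<^sup>2 / 4))"
      using c c0 q s(2) by (intro divide_left_mono mult_left_mono mult_pos_pos) auto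
    finally show ?thesis by simp
  next
    case False
    then have "few A B = (\<lambda>G. 0)" unfolding few_def by auto
    then show ?thesis using bernE_const[OF finII, of q 0] q by simp
  qed
  have Erem: "supportE \<alpha> q I rem \<le> 2 * s ^ 3 * q\<^sup>2 / k"
    unfolding rem_def using supportE_removed[OF I k \<alpha>' \<alpha>(2) q' q(2)] s by simp
  have ptw: "1 + ((- 1) * (dev A + dev B + few A B G) + (- (16 / (s\<^sup>2 * q))) * rem A B G) \<le> of_bool (good_support k s q A B G)"
    if "A \<subseteq> I" "B \<subseteq> I" "G \<subseteq> I \<times> I" for A B G
  proof (rule ccontr)
    assume neg: "\<not> ?thesis"
    have r0: "rem A B G \<ge> 0" by (simp add: rem_def)
    have nn: "dev A \<ge> 0" "dev B \<ge> 0" "few A B G \<ge> 0" "16 / (s\<^sup>2 * q) * rem A B G \<ge> 0"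
      using s q r0 by (auto simp: dev_def few_def)
    have "dev A < 1" "dev B < 1" "few A B G < 1" "16 / (s\<^sup>2 * q) * rem A B G < 1"
      and ng: "\<not> good_support k s q A B G"
      using neg nn by (auto simp: of_bool_def not_le split: if_splits)
    moreover have "s\<^sup>2 * q > 0" using s(2) q by simp
    ultimately have f: "few A B G < 1" and r: "rem A B G < s\<^sup>2 * q / 16"
      and "\<bar>real (card A) - s\<bar> < s/2" "\<bar>real (card B) - s\<bar> < s/2"
      using that by (auto simp: dev_def Int_absorb2 field_simps split: if_splits)
    then have cA: "s/2 \<le> card A" "card A \<le> 2 * s" and cB: "s/2 \<le> card B" "card B \<le> 2 * s" using s(2) by linarith+
    \<comment> \<open>At least \<open>q * (s/2)\<^sup>2 / 2\<close> edges are present and less than half of that many are removed.\<close>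
    have "\<bar>real (card (G \<inter> A \<times> B)) - q * card (A \<times> B)\<bar> < q * card (A \<times> B) / 2"
      using f cA cB by (auto simp: few_def not_le)
    then have "q * card (A \<times> B) / 2 \<le> real (card (G \<inter> A \<times> B))" by linarith
    moreover have "s\<^sup>2 / 4 \<le> card (A \<times> B)"
      using mult_mono[OF cA(1) cB(1)] s(2) by (simp add: power2_eq_square card_cartesian_product)
    then have "q * (s\<^sup>2 / 4) \<le> q * card (A \<times> B)" using q by (intro mult_left_mono) auto
    ultimately have "s\<^sup>2 * q / 8 \<le> real (card (G \<inter> A \<times> B))" by (simp add: mult.commute)
    moreover have "real (card (G \<inter> A \<times> B)) = rem A B G + card (thin k (G \<inter> A \<times> B))"
    proof -
      have fin: "finite (G \<inter> A \<times> B)" using that(3) finII finite_subset by blast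
      have sub: "thin k (G \<inter> A \<times> B) \<subseteq> G \<inter> A \<times> B" by (rule thin_subset)
      from card_Diff_subset[OF finite_subset[OF sub fin] sub] card_mono[OF fin sub]
      show ?thesis unfolding rem_def by linarith
    qed
    ultimately have "good_support k s q A B G"
      using r cA cB by (simp add: good_support_def)
    with ng show False by simp
  qed
  have fT: "supportE \<alpha> q I few \<le> 16 / (q * s\<^sup>2)"
  proof -
    have "supportE \<alpha> q I few \<le> bernE \<alpha> I (\<lambda>A. bernE \<alpha> I (\<lambda>B. 16 / (q * s\<^sup>2)))"
      unfolding supportE_def by (intro bernE_mono \<alpha>' \<alpha> Efew)
    then show ?thesis by (simp add: bernE_const I)
  qed
  have d: "supportE \<alpha> q I (\<lambda>A B G. dev A) = bernE \<alpha> I dev" "supportE \<alpha> q I (\<lambda>A B G. dev B) = bernE \<alpha> I dev"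
     "supportE \<alpha> q I (\<lambda>A B G. 1) = 1"
    by (simp_all add: supportE_def bernE_const I finII)
  have "1 - (8 / s + 16 / (q * s\<^sup>2) + 32 * s * q / k)
     \<le> 1 + ((- 1) * (bernE \<alpha> I dev + bernE \<alpha> I dev + supportE \<alpha> q I few) + (- (16 / (s\<^sup>2 * q))) * supportE \<alpha> q I rem)"
  proof -
    have "16 / (s\<^sup>2 * q) * supportE \<alpha> q I rem \<le> 16 / (s\<^sup>2 * q) * (2 * s ^ 3 * q\<^sup>2 / k)"
      using Erem s q by (intro mult_left_mono) auto
    also have "\<dots> = 32 * s * q / k" using s q k by (simp add: field_simps power3_eq_cube power2_eq_square)
    finally show ?thesis using Edev fT by simp
  qed
  also have "\<dots> = supportE \<alpha> q I (\<lambda>A B G. 1 + ((- 1) * (dev A + dev B + few A B G) + (- (16 / (s\<^sup>2 * q))) * rem A B G))"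
    unfolding supportE_add supportE_cmult d ..
  also have "\<dots> \<le> supportE \<alpha> q I (\<lambda>A B G. of_bool (good_support k s q A B G))"
    using ptw by (intro supportE_mono \<alpha>' \<alpha> q q') auto
  finally show ?thesis .
qed

section \<open>Random signs\<close>

text \<open>
  A sign vector is encoded by the set of its positive coordinates, so that uniform random signs are
  random subsets with \<open>q = 1/2\<close>.
\<close>

definition sg :: "'a set \<Rightarrow> 'a \<Rightarrow> real" where
  "sg A i = (if i \<in> A then 1 else -1)"

lemma sg_square [simp]: "sg A i * sg A i = 1"
  by (simp add: sg_def)

lemma sg_agree: "i \<in> E \<Longrightarrow> sg {e \<in> E. e \<in> A \<longleftrightarrow> e \<in> B} i = sg A i * sg B i"
  by (simp add: sg_def)

abbreviation signsE :: "'a set \<Rightarrow> ('a set \<Rightarrow> real) \<Rightarrow> real" where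
  "signsE \<equiv> bernE (1/2)"

lemma signs_monomial_nonneg:
  assumes "finite I"
  shows "signsE I (\<lambda>\<sigma>. \<Prod>i\<in>I. sg \<sigma> i ^ n i) \<ge> 0"
proof -
  have "signsE I (\<lambda>\<sigma>. \<Prod>i\<in>I. sg \<sigma> i ^ n i) = (\<Prod>i\<in>I. 1/2 * 1 ^ n i + (1 - 1/2) * (-1) ^ n i)"
    using bernE_prod[OF assms, of "1/2" "\<lambda>i b. (if b then 1 else -1) ^ n i"] by (simp add: sg_def)
  also have "\<dots> \<ge> 0"
  proof (intro prod_nonneg)
    fix i show "0 \<le> 1/2 * 1 ^ n i + (1 - 1/2) * (-1::real) ^ n i"
      by (cases "even (n i)") auto
  qed
  finally show ?thesis .
qed

lemma exp_sign:
  assumes "\<epsilon> = 1 \<or> \<epsilon> = (-1::real)"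
  shows "exp (x * \<epsilon>) - 1 = (cosh x - 1) + sinh x * \<epsilon>"
  using assms by (auto simp: cosh_def sinh_def field_simps)

text \<open>
  For a sign \<open>\<epsilon>\<close>, \<open>exp (x * \<epsilon>) - 1\<close> is \<open>(cosh x - 1) + sinh x * \<epsilon>\<close>, an affine function with nonnegative
  coefficients. Expanding over the edges leaves moments of independent signs, which are 0 or 1. The
  monomial with exponents \<open>n\<close> and \<open>m\<close> is there for the induction, in which every edge multiplies it by two more
  signs.
\<close>

lemma Griffiths:
  fixes I J :: "'a set"
  assumes I: "finite I" and J: "finite J" and x: "x \<ge> 0" and S: "finite S" "S \<subseteq> I \<times> J"
  shows "signsE I (\<lambda>\<sigma>. signsE J (\<lambda>\<delta>. (\<Prod>i\<in>I. sg \<sigma> i ^ n i) * (\<Prod>j\<in>J. sg \<delta> j ^ m j)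
      * (\<Prod>(i,j)\<in>S. exp (x * (sg \<sigma> i * sg \<delta> j)) - 1))) \<ge> 0"
  using S
proof (induction S arbitrary: n m rule: finite_induct)
  case empty
  have "signsE I (\<lambda>\<sigma>. signsE J (\<lambda>\<delta>. (\<Prod>i\<in>I. sg \<sigma> i ^ n i) * (\<Prod>j\<in>J. sg \<delta> j ^ m j)))
    = signsE I (\<lambda>\<sigma>. \<Prod>i\<in>I. sg \<sigma> i ^ n i) * signsE J (\<lambda>\<delta>. \<Prod>j\<in>J. sg \<delta> j ^ m j)"
    by (simp add: bernE_cmult bernE_cmult_right)
  then show ?case using signs_monomial_nonneg[OF I, of n] signs_monomial_nonneg[OF J, of m] by simp
next
  case (insert e S)
  obtain i j where e: "e = (i,j)" "i \<in> I" "j \<in> J" using insert.prems by auto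
  let ?R = "\<lambda>\<sigma> \<delta>. \<Prod>(i,j)\<in>S. exp (x * (sg \<sigma> i * sg \<delta> j)) - 1"
  let ?P = "\<lambda>n \<sigma>. \<Prod>i\<in>I. sg \<sigma> i ^ n i" and ?Q = "\<lambda>m \<delta>. \<Prod>j\<in>J. sg \<delta> j ^ m j"
  have up: "(\<Prod>l\<in>K. sg \<sigma> l ^ (n(a := Suc (n a))) l) = sg \<sigma> a * (\<Prod>l\<in>K. sg \<sigma> l ^ n l)"
    if "finite K" "a \<in> K" for K a n and \<sigma> :: "'a set"
    using that by (simp add: prod.remove[of K a])
  have cosh1: "cosh x - 1 \<ge> 0" using cosh_real_ge_1[of x] by simp
  have sinh0: "sinh x \<ge> 0" using x by simp
  have "(?P n \<sigma> * ?Q m \<delta>) * (\<Prod>(i,j)\<in>insert e S. exp (x * (sg \<sigma> i * sg \<delta> j)) - 1)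
    = (cosh x - 1) * (?P n \<sigma> * ?Q m \<delta> * ?R \<sigma> \<delta>)
      + sinh x * (?P (n(i := Suc (n i))) \<sigma> * ?Q (m(j := Suc (m j))) \<delta> * ?R \<sigma> \<delta>)" for \<sigma> \<delta>
  proof -
    have "sg \<sigma> i * sg \<delta> j = 1 \<or> sg \<sigma> i * sg \<delta> j = -1" by (simp add: sg_def)
    from exp_sign[OF this] show ?thesis
      unfolding up[OF I e(2)] up[OF J e(3)] using insert.hyps by (simp add: e algebra_simps)
  qed
  then have "signsE I (\<lambda>\<sigma>. signsE J (\<lambda>\<delta>. (?P n \<sigma> * ?Q m \<delta>) * (\<Prod>(i,j)\<in>insert e S. exp (x * (sg \<sigma> i * sg \<delta> j)) - 1)))
    = (cosh x - 1) * signsE I (\<lambda>\<sigma>. signsE J (\<lambda>\<delta>. ?P n \<sigma> * ?Q m \<delta> * ?R \<sigma> \<delta>))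
      + sinh x * signsE I (\<lambda>\<sigma>. signsE J (\<lambda>\<delta>. ?P (n(i := Suc (n i))) \<sigma> * ?Q (m(j := Suc (m j))) \<delta> * ?R \<sigma> \<delta>))"
    by (simp only: bernE_add bernE_cmult)
  also have "\<dots> \<ge> 0"
    using insert.prems by (intro add_nonneg_nonneg mult_nonneg_nonneg cosh1 sinh0 insert.IH) auto
  finally show ?case .
qed

text \<open>
  The power series compare term by term, because \<open>2 ^ n * fact n \<le> fact (2 * n)\<close>.
\<close>

lemma cosh_le_exp_half_square: "cosh (u::real) \<le> exp (u\<^sup>2 / 2)"
proof -
  have c: "(\<lambda>n. if even n then u ^ n / fact n else 0) sums cosh u"
    using cosh_converges[of u] by (simp add: scaleR_conv_of_real divide_inverse mult.commute if_distrib cong: if_cong)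
  have "(\<lambda>n. (u ^ (2 * n)) / fact (2 * n)) sums cosh u"
  proof -
    have "(\<lambda>n. if even n then u ^ n / fact n else 0) sums cosh u \<longleftrightarrow> (\<lambda>n. (\<lambda>n. if even n then u ^ n / fact n else 0) (2 * n)) sums cosh u"
      by (rule sums_mono_reindex[symmetric]) (auto simp: strict_mono_def elim!: evenE)
    with c show ?thesis by simp
  qed
  moreover have "(\<lambda>n. (u\<^sup>2/2) ^ n / fact n) sums exp (u\<^sup>2/2)"
    using exp_converges[of "u\<^sup>2/2"] by (simp only: real_scaleR_def divide_inverse_commute)
  moreover have "u ^ (2 * n) / fact (2 * n) \<le> (u\<^sup>2/2) ^ n / fact n" for n
  proof -
    have le: "2 ^ n * fact n \<le> (fact (2 * n) :: real)"
    proof (induction n)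
      case (Suc n)
      have "2 ^ Suc n * fact (Suc n) = (2 * real (Suc n)) * (2 ^ n * fact n)" by simp
      also have "\<dots> \<le> (2 * real (Suc n) * real (Suc (2 * n))) * fact (2 * n)"
        using Suc by (intro mult_mono) (auto simp: algebra_simps)
      also have "\<dots> = fact (2 * Suc n)" by (simp add: algebra_simps)
      finally show ?case .
    qed simp
    have "u ^ (2 * n) / fact (2 * n) \<le> u ^ (2 * n) / (2 ^ n * fact n)"
      using le by (intro divide_left_mono) auto
    then show ?thesis by (simp add: power_mult power_divide)
  qed
  ultimately show ?thesis by (rule sums_le[rotated 1])
qed

lemma signs_sum_insert:
  assumes "finite J" "j \<notin> J" "B \<subseteq> J"
  shows "signsE (insert j J) (\<lambda>\<delta>. f (\<Sum>l\<in>insert j B. sg \<delta> l))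
     = (signsE J (\<lambda>\<delta>. f ((\<Sum>l\<in>B. sg \<delta> l) + 1)) + signsE J (\<lambda>\<delta>. f ((\<Sum>l\<in>B. sg \<delta> l) - 1))) / 2"
proof -
  have fin: "finite B" "j \<notin> B" using assms finite_subset by auto
  have 1: "(\<Sum>l\<in>insert j B. sg (insert j \<delta>) l) = (\<Sum>l\<in>B. sg \<delta> l) + 1" for \<delta>
    using fin by (simp add: sg_def) (intro sum.cong; auto)
  have 2: "(\<Sum>l\<in>insert j B. sg \<delta> l) = (\<Sum>l\<in>B. sg \<delta> l) - 1" if "\<delta> \<subseteq> J" for \<delta>
    using fin that assms by (auto simp: sg_def)
  have "signsE J (\<lambda>\<delta>. f (\<Sum>l\<in>insert j B. sg \<delta> l)) = signsE J (\<lambda>\<delta>. f ((\<Sum>l\<in>B. sg \<delta> l) - 1))"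
    by (rule bernE_cong) (simp only: 2)
  then show ?thesis
    unfolding bernE_insert[OF assms(1,2)] 1 by simp
qed

lemma signs_sum_notin:
  assumes "finite J" "j \<notin> J" "B \<subseteq> J"
  shows "signsE (insert j J) (\<lambda>\<delta>. f (\<Sum>l\<in>B. sg \<delta> l)) = signsE J (\<lambda>\<delta>. f (\<Sum>l\<in>B. sg \<delta> l))"
proof -
  have "(\<Sum>l\<in>B. sg (insert j \<delta>) l) = (\<Sum>l\<in>B. sg \<delta> l)" for \<delta>
    using assms by (intro sum.cong) (auto simp: sg_def)
  then show ?thesis unfolding bernE_insert[OF assms(1,2)] by simp
qed

text \<open>
  Averaging over one sign replaces \<open>t\<close> by some \<open>u \<le> t / (1 - 2 * t)\<close>, at the price of a factor \<open>exp t\<close>.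
  As \<open>1 / u \<ge> 1 / t - 2\<close>, the parameter stays below \<open>t / (1 - 2 * card B * t)\<close> through all \<open>card B\<close> steps.
\<close>

lemma signs_exp_square:
  assumes "finite J" "B \<subseteq> J" "0 \<le> t" "2 * real (card B) * t < 1"
  shows "signsE J (\<lambda>\<delta>. exp (t * (\<Sum>l\<in>B. sg \<delta> l)\<^sup>2)) \<le> exp (real (card B) * t / (1 - 2 * real (card B) * t))"
  using assms
proof (induction J arbitrary: B t rule: finite_induct)
  case empty
  then show ?case by (simp add: bernE_const)
next
  case (insert j J)
  show ?case
  proof (cases "j \<in> B")
    case False
    then have "B \<subseteq> J" using insert.prems by auto
    then show ?thesis
      using insert.IH[of B t] insert.prems signs_sum_notin[OF insert.hyps, of B "\<lambda>s. exp (t * s\<^sup>2)"] by simp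
  next
    case True
    define C where "C = B - {j}"
    have C: "B = insert j C" "C \<subseteq> J" "j \<notin> C" "finite C"
      using True insert.prems insert.hyps finite_subset unfolding C_def by auto
    define n where "n = real (card C)"
    have cB: "real (card B) = n + 1" unfolding C(1) n_def using C by simp
    have n0: "n \<ge> 0" by (simp add: n_def)
    define u where "u = t * (1 + 2 * t)"
    have lt: "2 * (n + 1) * t < 1" using insert.prems cB by simp
    have t0: "t \<ge> 0" using insert.prems by simp
    have nt: "2 * n * t \<ge> 0" using n0 t0 by simp
    have t1: "1 - 2 * t > 0" using lt nt by (simp add: algebra_simps)
    have u_le: "u \<le> t / (1 - 2 * t)"
      using t0 t1 by (simp add: u_def field_simps power2_eq_square)
    have u0: "u \<ge> 0" using t0 by (simp add: u_def)
    have d: "1 - 2 * n * (t / (1 - 2 * t)) = (1 - 2 * (n + 1) * t) / (1 - 2 * t)"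
      using t1 by (simp add: field_simps)
    have "2 * n * u \<le> 2 * n * (t / (1 - 2 * t))" using u_le n0 by (intro mult_left_mono) auto
    moreover have "(1 - 2 * (n + 1) * t) / (1 - 2 * t) > 0" using t1 lt by simp
    ultimately have nu: "(1 - 2 * (n + 1) * t) / (1 - 2 * t) \<le> 1 - 2 * n * u" "2 * n * u < 1" using d by linarith+
    have step: "exp (t * (s + 1)\<^sup>2) + exp (t * (s - 1)\<^sup>2) \<le> 2 * exp t * exp (u * s\<^sup>2)" for s
    proof -
      have "exp (t * (s + 1)\<^sup>2) + exp (t * (s - 1)\<^sup>2) = 2 * (exp t * (exp (t * s\<^sup>2) * cosh (2 * t * s)))"
        by (simp add: cosh_def mult_exp_exp algebra_simps power2_eq_square)
      also have "\<dots> \<le> 2 * (exp t * (exp (t * s\<^sup>2) * exp ((2 * t * s)\<^sup>2 / 2)))"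
        by (intro mult_left_mono cosh_le_exp_half_square) auto
      also have "\<dots> = 2 * exp t * exp (u * s\<^sup>2)"
        by (simp add: mult_exp_exp u_def algebra_simps power2_eq_square)
      finally show ?thesis .
    qed
    have "signsE (insert j J) (\<lambda>\<delta>. exp (t * (\<Sum>l\<in>B. sg \<delta> l)\<^sup>2))
       = signsE J (\<lambda>\<delta>. exp (t * ((\<Sum>l\<in>C. sg \<delta> l) + 1)\<^sup>2) + exp (t * ((\<Sum>l\<in>C. sg \<delta> l) - 1)\<^sup>2)) / 2"
      unfolding C(1) bernE_add by (rule signs_sum_insert[OF insert.hyps C(2), of "\<lambda>s. exp (t * s\<^sup>2)"])
    also have "\<dots> \<le> signsE J (\<lambda>\<delta>. 2 * exp t * exp (u * (\<Sum>l\<in>C. sg \<delta> l)\<^sup>2)) / 2"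
      by (intro divide_right_mono bernE_mono step) auto
    also have "\<dots> = exp t * signsE J (\<lambda>\<delta>. exp (u * (\<Sum>l\<in>C. sg \<delta> l)\<^sup>2))"
      by (simp add: bernE_cmult)
    also have "\<dots> \<le> exp t * exp (n * u / (1 - 2 * n * u))"
      using insert.IH[OF C(2) u0] nu unfolding n_def by (intro mult_left_mono) auto
    also have "\<dots> = exp (t + n * u / (1 - 2 * n * u))" by (simp add: exp_add)
    also have "t + n * u / (1 - 2 * n * u) \<le> (n + 1) * t / (1 - 2 * (n + 1) * t)"
    proof -
      have "n * u / (1 - 2 * n * u) \<le> n * (t / (1 - 2 * t)) / ((1 - 2 * (n + 1) * t) / (1 - 2 * t))"
        using u_le n0 u0 nu t1 lt t0 by (intro frac_le mult_left_mono) auto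
      also have "\<dots> = n * t / (1 - 2 * (n + 1) * t)" using t1 by simp
      finally have "n * u / (1 - 2 * n * u) \<le> n * t / (1 - 2 * (n + 1) * t)" .
      moreover have "t \<le> t / (1 - 2 * (n + 1) * t)"
      proof -
        have "0 \<le> 2 * (n + 1) * t" using n0 t0 by simp
        then have "t / 1 \<le> t / (1 - 2 * (n + 1) * t)" using lt t0 by (intro divide_left_mono) auto
        then show ?thesis by simp
      qed
      moreover have "(n + 1) * t / (1 - 2 * (n + 1) * t) = n * t / (1 - 2 * (n + 1) * t) + t / (1 - 2 * (n + 1) * t)"
        by (simp add: add_divide_distrib[symmetric] algebra_simps)
      ultimately show ?thesis by linarith
    qed
    finally show ?thesis unfolding cB by simp
  qed
qed

text \<open>
  The mean of \<open>exp (x * S)\<close> for uniform sign vectors \<open>\<sigma>\<close> and \<open>\<delta>\<close>, where \<open>S\<close> sums \<open>\<sigma> i * \<delta> j\<close> over those positions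
  of \<open>A \<times> B\<close> that are retained independently with probability \<open>\<rho>\<close>.
\<close>

definition sign_avg :: "'a set \<Rightarrow> real \<Rightarrow> real \<Rightarrow> 'a set \<Rightarrow> 'a set \<Rightarrow> real" where
  "sign_avg I x \<rho> A B = signsE I (\<lambda>\<sigma>. signsE I (\<lambda>\<delta>.
      \<Prod>(i,j)\<in>A \<times> B. 1 + \<rho> * (exp (x * (sg \<sigma> i * sg \<delta> j)) - 1)))"

lemma sign_avg_le_exp:
  assumes I: "finite I" and A: "A \<subseteq> I" and B: "B \<subseteq> I" and x: "0 \<le> x" and \<rho>: "0 \<le> \<rho>" "\<rho> \<le> 1"
  shows "sign_avg I x \<rho> A B \<le> signsE I (\<lambda>\<sigma>. signsE I (\<lambda>\<delta>.
      exp (\<rho> * (cosh x - 1) * (real (card A) * real (card B)) + \<rho> * sinh x * ((\<Sum>i\<in>A. sg \<sigma> i) * (\<Sum>j\<in>B. sg \<delta> j)))))"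
proof -
  have fin: "finite A" "finite B" using A B I finite_subset by auto
  show ?thesis
    unfolding sign_avg_def
  proof (intro bernE_mono)
    fix \<sigma> \<delta> :: "'a set"
    have "(\<Prod>(i,j)\<in>A \<times> B. 1 + \<rho> * (exp (x * (sg \<sigma> i * sg \<delta> j)) - 1))
       \<le> (\<Prod>(i,j)\<in>A \<times> B. exp (\<rho> * ((cosh x - 1) + sinh x * (sg \<sigma> i * sg \<delta> j))))"
    proof (rule prod_mono, clarify, rule conjI)
      fix i j
      have "\<rho> * (-1) \<le> \<rho> * (exp (x * (sg \<sigma> i * sg \<delta> j)) - 1)" using \<rho> by (intro mult_left_mono) auto
      then show "0 \<le> 1 + \<rho> * (exp (x * (sg \<sigma> i * sg \<delta> j)) - 1)" using \<rho> by linarith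
      have s: "sg \<sigma> i * sg \<delta> j = 1 \<or> sg \<sigma> i * sg \<delta> j = -1" by (simp add: sg_def)
      show "1 + \<rho> * (exp (x * (sg \<sigma> i * sg \<delta> j)) - 1) \<le> exp (\<rho> * ((cosh x - 1) + sinh x * (sg \<sigma> i * sg \<delta> j)))"
        unfolding exp_sign[OF s] by (rule exp_ge_add_one_self)
    qed
    also have "\<dots> = exp (\<Sum>(i,j)\<in>A \<times> B. \<rho> * ((cosh x - 1) + sinh x * (sg \<sigma> i * sg \<delta> j)))"
      using fin by (simp add: exp_sum case_prod_unfold)
    also have "(\<Sum>(i,j)\<in>A \<times> B. \<rho> * ((cosh x - 1) + sinh x * (sg \<sigma> i * sg \<delta> j)))
       = \<rho> * (cosh x - 1) * (real (card A) * real (card B)) + \<rho> * sinh x * ((\<Sum>i\<in>A. sg \<sigma> i) * (\<Sum>j\<in>B. sg \<delta> j))"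
      unfolding sum.cartesian_product[symmetric] sum_product
      by (simp add: distrib_left sum.distrib sum_distrib_left mult_ac)
    finally show "(\<Prod>(i,j)\<in>A \<times> B. 1 + \<rho> * (exp (x * (sg \<sigma> i * sg \<delta> j)) - 1))
       \<le> exp (\<rho> * (cosh x - 1) * (real (card A) * real (card B)) + \<rho> * sinh x * ((\<Sum>i\<in>A. sg \<sigma> i) * (\<Sum>j\<in>B. sg \<delta> j)))" .
  qed auto
qed

lemma abs_sign_sum_le: "\<bar>\<Sum>i\<in>A. sg \<sigma> i\<bar> \<le> real (card A)"
  using sum_abs[of "sg \<sigma>" A] by (simp add: sg_def if_distrib cong: if_cong)

text \<open>
  The two sign sums are at most \<open>card A\<close> and \<open>card B\<close> in absolute value.
\<close>

lemma sign_avg_crude: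
  assumes I: "finite I" and A: "A \<subseteq> I" and B: "B \<subseteq> I" and x: "0 \<le> x" and \<rho>: "0 \<le> \<rho>" "\<rho> \<le> 1"
  shows "sign_avg I x \<rho> A B \<le> exp (\<rho> * (exp x - 1) * (real (card A) * real (card B)))"
proof -
  have "sign_avg I x \<rho> A B \<le> signsE I (\<lambda>\<sigma>. signsE I (\<lambda>\<delta>. exp (\<rho> * (exp x - 1) * (real (card A) * real (card B)))))"
  proof (rule order_trans[OF sign_avg_le_exp[OF assms]], intro bernE_mono)
    fix \<sigma> \<delta> :: "'a set"
    have "(\<Sum>i\<in>A. sg \<sigma> i) * (\<Sum>j\<in>B. sg \<delta> j) \<le> \<bar>\<Sum>i\<in>A. sg \<sigma> i\<bar> * \<bar>\<Sum>j\<in>B. sg \<delta> j\<bar>"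
      by (simp add: abs_mult[symmetric])
    also have "\<dots> \<le> real (card A) * real (card B)" by (intro mult_mono abs_sign_sum_le) auto
    finally have "\<rho> * sinh x * ((\<Sum>i\<in>A. sg \<sigma> i) * (\<Sum>j\<in>B. sg \<delta> j)) \<le> \<rho> * sinh x * (real (card A) * real (card B))"
      using \<rho> x by (intro mult_left_mono) auto
    moreover have "exp x = cosh x + sinh x" by (simp add: cosh_def sinh_def field_simps)
    ultimately show "exp (\<rho> * (cosh x - 1) * (real (card A) * real (card B)) + \<rho> * sinh x * ((\<Sum>i\<in>A. sg \<sigma> i) * (\<Sum>j\<in>B. sg \<delta> j)))
       \<le> exp (\<rho> * (exp x - 1) * (real (card A) * real (card B)))"
      by (simp add: algebra_simps)
  qed auto
  then show ?thesis by (simp add: bernE_const I)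
qed

text \<open>
  The product of the two sign sums has mean zero. Averaging over the row signs first leaves the
  exponential of a multiple of the square of the column sum, so that \<open>\<rho> * sinh x\<close> enters the
  exponent only quadratically.
\<close>

lemma sign_avg_fine:
  assumes I: "finite I" and A: "A \<subseteq> I" and B: "B \<subseteq> I" and x: "0 \<le> x" and \<rho>: "0 \<le> \<rho>" "\<rho> \<le> 1"
    and small: "real (card A) * real (card B) * (\<rho> * sinh x)\<^sup>2 \<le> 1 / 2"
  shows "sign_avg I x \<rho> A B \<le> exp ((\<rho> * (cosh x - 1) + (\<rho> * sinh x)\<^sup>2) * (real (card A) * real (card B)))"
proof -
  define a b R L where "a = real (card A)" and "b = real (card B)" and "R = \<rho> * sinh x" and "L = \<rho> * (cosh x - 1)"
  define t where "t = a * R\<^sup>2 / 2"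
  have row: "signsE I (\<lambda>\<sigma>. exp (R * ((\<Sum>i\<in>A. sg \<sigma> i) * T))) \<le> exp (t * T\<^sup>2)" for T
  proof -
    have "exp (R * ((\<Sum>i\<in>A. sg \<sigma> i) * T)) = (\<Prod>i\<in>I. if i \<in> A then exp (R * T * (if i \<in> \<sigma> then 1 else -1)) else 1)" for \<sigma>
      using A I finite_subset[OF A I]
      by (simp add: prod.If_cases Int_absorb1 sum_distrib_right sum_distrib_left exp_sum sg_def mult_ac)
    then have "signsE I (\<lambda>\<sigma>. exp (R * ((\<Sum>i\<in>A. sg \<sigma> i) * T)))
       = (\<Prod>i\<in>I. 1/2 * (if i \<in> A then exp (R * T * 1) else 1) + (1 - 1/2) * (if i \<in> A then exp (R * T * -1) else 1))"
      using bernE_prod[OF I, of "1/2" "\<lambda>i b. if i \<in> A then exp (R * T * (if b then 1 else -1)) else 1"] by simp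
    also have "\<dots> = (\<Prod>i\<in>I. if i \<in> A then cosh (R * T) else 1)"
      by (intro prod.cong refl) (simp add: cosh_def field_simps)
    also have "\<dots> = cosh (R * T) ^ card A" using A I by (simp add: prod.If_cases Int_absorb1)
    also have "\<dots> \<le> exp ((R * T)\<^sup>2 / 2) ^ card A"
      by (intro power_mono cosh_le_exp_half_square) auto
    also have "\<dots> = exp (t * T\<^sup>2)"
      by (simp add: t_def a_def exp_of_nat_mult[symmetric] power_mult_distrib mult_ac)
    finally show ?thesis .
  qed
  have bt: "2 * b * t \<le> 1 / 2" using small by (simp add: t_def a_def b_def R_def mult_ac)
  have bt0: "b * t \<ge> 0" by (simp add: t_def a_def b_def)
  have t0: "t \<ge> 0" by (simp add: t_def a_def)
  have "sign_avg I x \<rho> A B \<le> signsE I (\<lambda>\<sigma>. signsE I (\<lambda>\<delta>. exp (L * (a * b)) * exp (R * ((\<Sum>i\<in>A. sg \<sigma> i) * (\<Sum>j\<in>B. sg \<delta> j)))))"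
    using sign_avg_le_exp[OF I A B x \<rho>] by (simp add: a_def b_def L_def R_def exp_add)
  also have "\<dots> = exp (L * (a * b)) * signsE I (\<lambda>\<delta>. signsE I (\<lambda>\<sigma>. exp (R * ((\<Sum>i\<in>A. sg \<sigma> i) * (\<Sum>j\<in>B. sg \<delta> j)))))"
    unfolding bernE_cmult by (subst bernE_swap) simp
  also have "\<dots> \<le> exp (L * (a * b)) * signsE I (\<lambda>\<delta>. exp (t * (\<Sum>j\<in>B. sg \<delta> j)\<^sup>2))"
    by (intro mult_left_mono bernE_mono row) auto
  also have "\<dots> \<le> exp (L * (a * b)) * exp (b * t / (1 - 2 * b * t))"
    using signs_exp_square[OF I B t0] bt unfolding b_def by (intro mult_left_mono) auto
  also have "\<dots> \<le> exp (L * (a * b)) * exp (2 * (b * t))"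
  proof (intro mult_left_mono, subst exp_le_cancel_iff)
    have "b * t / (1 - 2 * b * t) \<le> b * t / (1 / 2)"
      using bt bt0 by (intro divide_left_mono) auto
    then show "b * t / (1 - 2 * b * t) \<le> 2 * (b * t)" by simp
  qed auto
  also have "\<dots> = exp ((L + R\<^sup>2) * (a * b))" by (simp add: exp_add[symmetric] t_def algebra_simps)
  finally show ?thesis by (simp add: a_def b_def L_def R_def)
qed

section \<open>The overlap of two draws from the prior\<close>

lemma bernE_of_bool_superset_le:
  assumes "finite E" "0 \<le> q" "q \<le> 1" "S \<subseteq> E" and T: "\<And>G. T G \<subseteq> G"
  shows "bernE q E (\<lambda>G. of_bool (P G) * of_bool (S \<subseteq> T G)) \<le> q ^ card S"
proof -
  have "bernE q E (\<lambda>G. of_bool (P G) * of_bool (S \<subseteq> T G)) \<le> bernE q E (\<lambda>G. of_bool (S \<subseteq> G))"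
    using T by (intro bernE_mono assms) (auto simp: of_bool_def)
  then show ?thesis using bernE_subset[OF assms(1,4)] by simp
qed

lemma prod_one_plus_subsets:
  assumes "finite U" "H \<subseteq> U"
  shows "(\<Prod>e\<in>H. 1 + w e) = (\<Sum>S\<in>Pow U. of_bool (S \<subseteq> H) * (\<Prod>e\<in>S. w e :: real))"
proof -
  have fin: "finite H" using assms finite_subset by blast
  have "(\<Prod>e\<in>H. 1 + w e) = (\<Sum>S\<in>Pow H. \<Prod>e\<in>S. w e)"
    using prod_add[OF fin, of w "\<lambda>_. 1"] by (simp add: add.commute)
  also have "\<dots> = (\<Sum>S\<in>Pow U. of_bool (S \<subseteq> H) * (\<Prod>e\<in>S. w e))"
    using assms by (intro sum.mono_neutral_cong_left) auto
  finally show ?thesis .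
qed

text \<open>
  Products of two independent uniform signs are uniform signs. With \<open>W\<close> as in the proof, the exponential
  is the product of \<open>1 + W\<close> over the common edges, hence a sum over edge sets \<open>S\<close> of the product of \<open>W\<close> over \<open>S\<close>, counted when
  \<open>S\<close> lies in both supports. The sign average of that product is nonnegative, and the probability that \<open>S\<close> lies
  in both supports is at most \<open>(q\<^sup>2) ^ card S\<close>, the value that it has without thinning. So thinning
  can only lower the sum, and the sum without thinning folds back into a product over all edges.
\<close>

lemma thinned_overlap_le_sign_avg:
  fixes I :: "'a set"
  assumes I: "finite I" and A: "A \<subseteq> I" "A' \<subseteq> I" and B: "B \<subseteq> I" "B' \<subseteq> I"
    and q: "0 \<le> q" "q \<le> 1" and x: "0 \<le> x"
    and T: "\<And>G. T G \<subseteq> G \<inter> A \<times> B" and T': "\<And>G. T' G \<subseteq> G \<inter> A' \<times> B'"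
  shows "signsE I (\<lambda>\<sigma>. signsE I (\<lambda>\<delta>. signsE I (\<lambda>\<sigma>'. signsE I (\<lambda>\<delta>'.
      bernE q (I \<times> I) (\<lambda>G. bernE q (I \<times> I) (\<lambda>G'. of_bool (P G) * of_bool (P' G') *
        exp (x * (\<Sum>(i,j)\<in>T G \<inter> T' G'. (sg \<sigma> i * sg \<sigma>' i) * (sg \<delta> j * sg \<delta>' j)))))))))
    \<le> sign_avg I x (q\<^sup>2) (A \<inter> A') (B \<inter> B')"
proof -
  define U where "U = (A \<inter> A') \<times> (B \<inter> B')"
  have U: "finite U" "U \<subseteq> I \<times> I" "U \<subseteq> A \<times> B" "U \<subseteq> A' \<times> B'"
    using A B finite_subset[OF A(1) I] finite_subset[OF B(1) I] unfolding U_def by auto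
  have finII: "finite (I \<times> I)" using I by simp
  define W where "W = (\<lambda>(\<sigma> :: 'a set) (\<delta> :: 'a set) (i,j). exp (x * (sg \<sigma> i * sg \<delta> j)) - 1)"
  define F where "F = (\<lambda>(\<sigma> :: 'a set) (\<delta> :: 'a set). bernE q (I \<times> I) (\<lambda>G. bernE q (I \<times> I) (\<lambda>G'. of_bool (P G) * of_bool (P' G') *
        exp (x * (\<Sum>(i,j)\<in>T G \<inter> T' G'. sg \<sigma> i * sg \<delta> j)))))"
  define d where "d = (\<lambda>S. bernE q (I \<times> I) (\<lambda>G. of_bool (P G) * of_bool (S \<subseteq> T G))
       * bernE q (I \<times> I) (\<lambda>G'. of_bool (P' G') * of_bool (S \<subseteq> T' G')))"
  have F_eq: "F \<sigma> \<delta> = (\<Sum>S\<in>Pow U. d S * (\<Prod>e\<in>S. W \<sigma> \<delta> e))" for \<sigma> \<delta>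
  proof -
    have "exp (x * (\<Sum>(i,j)\<in>T G \<inter> T' G'. sg \<sigma> i * sg \<delta> j))
      = (\<Sum>S\<in>Pow U. of_bool (S \<subseteq> T G) * of_bool (S \<subseteq> T' G') * (\<Prod>e\<in>S. W \<sigma> \<delta> e))" for G G'
    proof -
      have sub: "T G \<inter> T' G' \<subseteq> U" using T[of G] T'[of G'] unfolding U_def by auto
      then have fin: "finite (T G \<inter> T' G')" using U finite_subset by blast
      have "exp (x * (\<Sum>(i,j)\<in>T G \<inter> T' G'. sg \<sigma> i * sg \<delta> j)) = (\<Prod>e\<in>T G \<inter> T' G'. 1 + W \<sigma> \<delta> e)"
        using fin by (simp add: W_def exp_sum sum_distrib_left case_prod_unfold)
      also have "\<dots> = (\<Sum>S\<in>Pow U. of_bool (S \<subseteq> T G \<inter> T' G') * (\<Prod>e\<in>S. W \<sigma> \<delta> e))"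
        by (rule prod_one_plus_subsets[OF U(1) sub])
      finally show ?thesis by (simp add: of_bool_conj)
    qed
    then have "F \<sigma> \<delta> = bernE q (I \<times> I) (\<lambda>G. bernE q (I \<times> I) (\<lambda>G'. \<Sum>S\<in>Pow U.
       (of_bool (P G) * of_bool (S \<subseteq> T G)) * ((of_bool (P' G') * of_bool (S \<subseteq> T' G')) * (\<Prod>e\<in>S. W \<sigma> \<delta> e))))"
      unfolding F_def by (simp add: sum_distrib_left mult_ac)
    then show ?thesis
      by (simp only: bernE_sum bernE_cmult bernE_cmult_right d_def) (simp only: mult.assoc)
  qed
  have "signsE I (\<lambda>\<sigma>. signsE I (\<lambda>\<delta>. signsE I (\<lambda>\<sigma>'. signsE I (\<lambda>\<delta>'.
      bernE q (I \<times> I) (\<lambda>G. bernE q (I \<times> I) (\<lambda>G'. of_bool (P G) * of_bool (P' G') *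
        exp (x * (\<Sum>(i,j)\<in>T G \<inter> T' G'. (sg \<sigma> i * sg \<sigma>' i) * (sg \<delta> j * sg \<delta>' j)))))))))
    = signsE I (\<lambda>\<sigma>. signsE I (\<lambda>\<delta>. signsE I (\<lambda>\<sigma>'. signsE I (\<lambda>\<delta>'.
        F {e \<in> I. e \<in> \<sigma> \<longleftrightarrow> e \<in> \<sigma>'} {e \<in> I. e \<in> \<delta> \<longleftrightarrow> e \<in> \<delta>'}))))"
    unfolding F_def
  proof (intro bernE_cong arg_cong[of _ _ exp] arg_cong2[where f = "(*)"] refl sum.cong, clarify)
    fix \<sigma> \<delta> \<sigma>' \<delta>' G G' i j
    assume "(i, j) \<in> T G" "(i, j) \<in> T' G'"
    then have "i \<in> I" "j \<in> I" using T A B by blast+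
    then show "sg \<sigma> i * sg \<sigma>' i * (sg \<delta> j * sg \<delta>' j)
        = sg {e \<in> I. e \<in> \<sigma> \<longleftrightarrow> e \<in> \<sigma>'} i * sg {e \<in> I. e \<in> \<delta> \<longleftrightarrow> e \<in> \<delta>'} j"
      by (simp add: sg_agree)
  qed
  also have "\<dots> = signsE I (\<lambda>\<sigma>. signsE I (\<lambda>\<sigma>'. signsE I (\<lambda>\<delta>. signsE I (\<lambda>\<delta>'.
        F {e \<in> I. e \<in> \<sigma> \<longleftrightarrow> e \<in> \<sigma>'} {e \<in> I. e \<in> \<delta> \<longleftrightarrow> e \<in> \<delta>'}))))"
    by (rule bernE_cong, rule bernE_swap)
  also have "\<dots> = signsE I (\<lambda>\<sigma>. signsE I (\<lambda>\<delta>. F \<sigma> \<delta>))"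
    unfolding bernE_agree[OF I, of "F _"]
    by (rule bernE_agree[OF I, of "\<lambda>\<sigma>. signsE I (F \<sigma>)"])
  also have "\<dots> = (\<Sum>S\<in>Pow U. d S * signsE I (\<lambda>\<sigma>. signsE I (\<lambda>\<delta>. \<Prod>e\<in>S. W \<sigma> \<delta> e)))"
    unfolding F_eq by (simp only: bernE_sum bernE_cmult)
  also have "\<dots> \<le> (\<Sum>S\<in>Pow U. (q\<^sup>2) ^ card S * signsE I (\<lambda>\<sigma>. signsE I (\<lambda>\<delta>. \<Prod>e\<in>S. W \<sigma> \<delta> e)))"
  proof (intro sum_mono mult_right_mono)
    fix S assume "S \<in> Pow U"
    then have S: "S \<subseteq> I \<times> I" "finite S" using U finite_subset by auto
    have "d S \<le> q ^ card S * q ^ card S"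
      unfolding d_def
      using T T' S q by (intro mult_mono bernE_of_bool_superset_le finII bernE_nonneg zero_le_power) auto
    then show "d S \<le> (q\<^sup>2) ^ card S" by (simp add: power_mult[symmetric] power_add[symmetric] mult_2)
    show "0 \<le> signsE I (\<lambda>\<sigma>. signsE I (\<lambda>\<delta>. \<Prod>e\<in>S. W \<sigma> \<delta> e))"
      using Griffiths[OF I I x S(2,1), of "\<lambda>_. 0" "\<lambda>_. 0"] by (simp add: W_def)
  qed
  also have "\<dots> = signsE I (\<lambda>\<sigma>. signsE I (\<lambda>\<delta>. \<Sum>S\<in>Pow U. (q\<^sup>2) ^ card S * (\<Prod>e\<in>S. W \<sigma> \<delta> e)))"
    by (simp only: bernE_sum bernE_cmult)
  also have "\<dots> = sign_avg I x (q\<^sup>2) (A \<inter> A') (B \<inter> B')"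
  proof -
    have "(\<Sum>S\<in>Pow U. (q\<^sup>2) ^ card S * (\<Prod>e\<in>S. W \<sigma> \<delta> e)) = (\<Prod>e\<in>U. 1 + q\<^sup>2 * W \<sigma> \<delta> e)" for \<sigma> \<delta>
      using prod_one_plus_subsets[OF U(1) order_refl, of "\<lambda>e. q\<^sup>2 * W \<sigma> \<delta> e"]
      by (auto simp: prod.distrib intro!: sum.cong)
    then show ?thesis unfolding sign_avg_def U_def W_def by (simp add: case_prod_unfold)
  qed
  finally show ?thesis .
qed

lemma exp_minus_one_le: "exp u - 1 \<le> u * exp (u::real)"
proof -
  have "(1 - u) * exp u \<le> exp (- u) * exp u"
    using exp_ge_add_one_self[of "- u"] by (intro mult_right_mono) auto
  then show ?thesis by (simp add: mult_exp_exp algebra_simps)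
qed

lemma exp_minus_one_le_double:
  assumes "0 \<le> u" "u \<le> (1::real)"
  shows "exp u - 1 \<le> 2 * u"
proof -
  have "u * u \<le> u * 1" using assms by (intro mult_left_mono)
  then show ?thesis using exp_bound[OF assms] unfolding power2_eq_square by linarith
qed

text \<open>
  The bound \<open>t\<close> on the overlaps is essential: identical draws with unusually large \<open>A\<close> and \<open>B\<close> would make the
  unrestricted mean far too large.
\<close>

definition overlap_moment :: "real \<Rightarrow> 'a set \<Rightarrow> real \<Rightarrow> real \<Rightarrow> real \<Rightarrow> real" where
  "overlap_moment \<beta> I t x \<rho> =
     bernE \<beta> I (\<lambda>A. bernE \<beta> I (\<lambda>B. of_bool (real (card A) \<le> t) * of_bool (real (card B) \<le> t) * sign_avg I x \<rho> A B))"

text \<open>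
  Let \<open>a\<close> and \<open>b\<close> be the sizes of the two random sets; their means are \<open>m\<close>. If both are at most \<open>J\<close>, the
  fine bound applies, and \<open>exp (K * a * b)\<close> has mean close to 1 when \<open>m\<^sup>2 * K\<close> is small. If, say, \<open>b\<close> exceeds \<open>J\<close>, the
  crude bound \<open>exp (D * a * b)\<close> is averaged over \<open>a\<close> first. The result \<open>exp (m * (exp (D * b) - 1))\<close> is at most
  \<open>exp b\<close> for \<open>b \<le> t\<close>, by the hypothesis on \<open>m * D * exp (D * t)\<close>, and \<open>b > J\<close> is rare enough to
  compensate for this.
\<close>

lemma sign_avg_overlap_bound:
  fixes I :: "'a set"
  assumes I: "finite I" and x: "0 \<le> x" and \<rho>: "0 \<le> \<rho>" "\<rho> \<le> 1" and \<beta>: "0 \<le> \<beta>" "\<beta> \<le> 1"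
  defines "D \<equiv> \<rho> * (exp x - 1)" and "K \<equiv> \<rho> * (cosh x - 1) + (\<rho> * sinh x)\<^sup>2" and "m \<equiv> real (card I) * \<beta>"
  assumes D1: "D \<le> 1" and J: "J > 0" "D * J \<le> 1 / 2" and mD: "m * D * exp (D * t) \<le> 1" and mD2: "2 * m * D \<le> 1"
  shows "overlap_moment \<beta> I t x \<rho>
    \<le> exp (4 * m\<^sup>2 * K) + 2 * exp (m * (exp 2 - 1) - J)"
proof -
  have m0: "m \<ge> 0" using \<beta> by (simp add: m_def)
  have D0: "D \<ge> 0" using x \<rho> by (simp add: D_def)
  have sinh0: "sinh x \<ge> 0" and cosh1: "cosh x \<ge> 1" using x cosh_real_ge_1 by auto
  have DLR: "D = \<rho> * (cosh x - 1) + \<rho> * sinh x"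
    by (simp add: D_def cosh_def sinh_def field_simps)
  have R: "0 \<le> \<rho> * sinh x" "\<rho> * sinh x \<le> D"
    using \<rho> sinh0 cosh1 unfolding DLR by auto
  then have "(\<rho> * sinh x)\<^sup>2 \<le> \<rho> * sinh x * 1"
    unfolding power2_eq_square using D1 by (intro mult_left_mono) auto
  then have KD: "K \<le> D" unfolding K_def DLR by simp
  have K0: "K \<ge> 0" using \<rho> cosh1 by (simp add: K_def)
  have "m * K \<le> m * D" using KD m0 by (rule mult_left_mono)
  then have mK: "2 * m * K \<le> 1" using mD2 by simp
  define main where "main = (\<lambda>(A :: 'a set) (B :: 'a set). of_bool (real (card B) \<le> J) * exp (K * real (card B) * real (card A)))"
  define tail where "tail = (\<lambda>(A :: 'a set) (B :: 'a set). of_bool (J < real (card B) \<and> real (card B) \<le> t) * exp (D * real (card B) * real (card A)))"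
  have split: "of_bool (real (card A) \<le> t) * of_bool (real (card B) \<le> t) * sign_avg I x \<rho> A B
     \<le> main A B + (tail A B + tail B A)" if A: "A \<subseteq> I" and B: "B \<subseteq> I" for A B
  proof (cases "real (card A) \<le> t \<and> real (card B) \<le> t")
    case True
    have nn: "main A B \<ge> 0" "tail A B \<ge> 0" "tail B A \<ge> 0" by (simp_all add: main_def tail_def)
    show ?thesis
    proof (cases "real (card A) \<le> J \<and> real (card B) \<le> J")
      case small: True
      have "real (card A) * real (card B) * (\<rho> * sinh x)\<^sup>2 \<le> (J * J) * D\<^sup>2"
        using small R J by (intro mult_mono power_mono) auto
      also have "\<dots> = (D * J)\<^sup>2" by (simp add: power2_eq_square mult_ac)
      also have "\<dots> \<le> (1/2)\<^sup>2" using J D0 by (intro power_mono) auto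
      finally have "real (card A) * real (card B) * (\<rho> * sinh x)\<^sup>2 \<le> 1/2" by (simp add: power2_eq_square)
      from sign_avg_fine[OF I A B x \<rho> this] True small nn show ?thesis
        by (simp add: main_def K_def mult_ac)
    next
      case False
      have "sign_avg I x \<rho> A B \<le> exp (D * (real (card A) * real (card B)))"
        using sign_avg_crude[OF I A B x \<rho>] by (simp add: D_def)
      moreover have "tail A B + tail B A \<ge> exp (D * (real (card A) * real (card B)))"
        using False True by (auto simp: tail_def mult_ac not_le)
      ultimately show ?thesis using True nn by simp
    qed
  next
    case False
    then show ?thesis by (auto simp: main_def tail_def)
  qed
  have col: "bernE \<beta> I (\<lambda>A. exp (c * real (card A))) \<le> exp (m * (exp c - 1))" for c
    using bernE_exp_card[OF I \<beta>, of c] by (simp add: m_def)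
  have Emain: "bernE \<beta> I (\<lambda>B. bernE \<beta> I (\<lambda>A. main A B)) \<le> exp (4 * m\<^sup>2 * K)"
  proof -
    have "bernE \<beta> I (\<lambda>A. main A B) \<le> exp (2 * m * K * real (card B))" for B
    proof (cases "real (card B) \<le> J")
      case True
      let ?b = "real (card B)"
      have "K * ?b \<le> D * J" using KD True D0 by (intro mult_mono) auto
      then have Kb: "0 \<le> K * ?b" "K * ?b \<le> 1" using K0 J by auto
      have "bernE \<beta> I (\<lambda>A. main A B) \<le> exp (m * (exp (K * ?b) - 1))"
        using True col[of "K * ?b"] by (simp add: main_def)
      also have "\<dots> \<le> exp (m * (2 * (K * ?b)))"
        using exp_minus_one_le_double[OF Kb] m0 by (simp add: mult_left_mono)
      finally show ?thesis by (simp add: mult_ac)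
    qed (simp add: main_def bernE_const I)
    then have "bernE \<beta> I (\<lambda>B. bernE \<beta> I (\<lambda>A. main A B)) \<le> bernE \<beta> I (\<lambda>B. exp (2 * m * K * real (card B)))"
      by (intro bernE_mono \<beta>)
    also have "\<dots> \<le> exp (m * (exp (2 * m * K) - 1))" by (rule col)
    also have "\<dots> \<le> exp (m * (2 * (2 * m * K)))"
      using exp_minus_one_le_double[of "2 * m * K"] mK m0 K0 by (simp add: mult_left_mono)
    finally show ?thesis by (simp add: power2_eq_square mult_ac)
  qed
  have Etail: "bernE \<beta> I (\<lambda>B. bernE \<beta> I (\<lambda>A. tail A B)) \<le> exp (m * (exp 2 - 1) - J)"
  proof -
    have "bernE \<beta> I (\<lambda>A. tail A B) \<le> exp (- J) * exp (2 * real (card B))" for B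
    proof (cases "J < real (card B) \<and> real (card B) \<le> t")
      case True
      let ?b = "real (card B)"
      have "bernE \<beta> I (\<lambda>A. tail A B) \<le> exp (m * (exp (D * ?b) - 1))"
        using True col[of "D * ?b"] by (simp add: tail_def)
      also have "m * (exp (D * ?b) - 1) \<le> m * (D * ?b * exp (D * ?b))"
        by (intro mult_left_mono exp_minus_one_le m0)
      also have "\<dots> \<le> m * (D * ?b * exp (D * t))"
        using True m0 D0 by (intro mult_left_mono) (auto intro!: mult_left_mono)
      also have "\<dots> = (m * D * exp (D * t)) * ?b" by simp
      also have "\<dots> \<le> 1 * ?b" using mD by (intro mult_right_mono) auto
      also have "1 * ?b \<le> - J + 2 * ?b" using True by simp
      finally show ?thesis by (simp add: mult_exp_exp)
    next
      case False
      then have "tail A B = 0" for A by (auto simp: tail_def)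
      then show ?thesis by (simp add: bernE_const I)
    qed
    then have "bernE \<beta> I (\<lambda>B. bernE \<beta> I (\<lambda>A. tail A B)) \<le> bernE \<beta> I (\<lambda>B. exp (- J) * exp (2 * real (card B)))"
      by (intro bernE_mono \<beta>)
    also have "\<dots> \<le> exp (- J) * exp (m * (exp 2 - 1))"
      unfolding bernE_cmult by (intro mult_left_mono col) auto
    finally show ?thesis by (simp add: mult_exp_exp)
  qed
  have "overlap_moment \<beta> I t x \<rho> \<le> bernE \<beta> I (\<lambda>A. bernE \<beta> I (\<lambda>B. main A B + (tail A B + tail B A)))"
    unfolding overlap_moment_def using split by (intro bernE_mono \<beta>) auto
  also have "\<dots> = bernE \<beta> I (\<lambda>A. bernE \<beta> I (\<lambda>B. main A B))
      + (bernE \<beta> I (\<lambda>A. bernE \<beta> I (\<lambda>B. tail A B)) + bernE \<beta> I (\<lambda>A. bernE \<beta> I (\<lambda>B. tail B A)))"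
    by (simp only: bernE_add)
  also have "bernE \<beta> I (\<lambda>A. bernE \<beta> I (\<lambda>B. main A B)) = bernE \<beta> I (\<lambda>B. bernE \<beta> I (\<lambda>A. main A B))" by (rule bernE_swap)
  also have "bernE \<beta> I (\<lambda>A. bernE \<beta> I (\<lambda>B. tail A B)) = bernE \<beta> I (\<lambda>B. bernE \<beta> I (\<lambda>A. tail A B))" by (rule bernE_swap)
  finally show ?thesis using Emain Etail by linarith
qed

text \<open>
  A draw consists of row and column index sets \<open>A\<close> and \<open>B\<close>, row and column signs \<open>\<sigma>\<close> and \<open>\<delta>\<close>, and a set \<open>G\<close> of
  positions.
\<close>

type_synonym 'a draw = "'a set \<times> 'a set \<times> 'a set \<times> 'a set \<times> ('a \<times> 'a) set"

definition prior_space :: "'a set \<Rightarrow> 'a draw set" where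
  "prior_space I = Pow I \<times> Pow I \<times> Pow I \<times> Pow I \<times> Pow (I \<times> I)"

definition bern_weight :: "real \<Rightarrow> 'a set \<Rightarrow> 'a set \<Rightarrow> real" where
  "bern_weight q E G = q ^ card G * (1 - q) ^ card (E - G)"

definition prior_weight where
  "prior_weight \<alpha> q I = (\<lambda>(A, B, \<sigma>, \<delta>, G). bern_weight \<alpha> I A * (bern_weight \<alpha> I B *
     (bern_weight (1/2) I \<sigma> * (bern_weight (1/2) I \<delta> * bern_weight q (I \<times> I) G))))"

lemma sum_prior:
  "(\<Sum>\<omega>\<in>prior_space I. prior_weight \<alpha> q I \<omega> * f \<omega>) = bernE \<alpha> I (\<lambda>A. bernE \<alpha> I (\<lambda>B.
     signsE I (\<lambda>\<sigma>. signsE I (\<lambda>\<delta>. bernE q (I \<times> I) (\<lambda>G. f (A, B, \<sigma>, \<delta>, G))))))"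
  unfolding prior_space_def prior_weight_def bernE_def bern_weight_def
  by (simp only: sum.cartesian_product' case_prod_conv sum_distrib_left mult.assoc)

lemma prior_weight_nonneg:
  assumes "0 \<le> \<alpha>" "\<alpha> \<le> 1" "0 \<le> q" "q \<le> 1"
  shows "prior_weight \<alpha> q I \<omega> \<ge> 0"
  using assms by (auto simp: prior_weight_def bern_weight_def split: prod.splits)

definition good_prior :: "nat \<Rightarrow> real \<Rightarrow> real \<Rightarrow> 'a draw \<Rightarrow> bool" where
  "good_prior k s q = (\<lambda>(A, B, \<sigma>, \<delta>, G). good_support k s q A B G)"

definition prior_entry :: "nat \<Rightarrow> real \<Rightarrow> 'a draw \<Rightarrow> 'a \<times> 'a \<Rightarrow> real" where
  "prior_entry k \<mu> = (\<lambda>(A, B, \<sigma>, \<delta>, G) (i, j). \<mu> * (sg \<sigma> i * sg \<delta> j) * of_bool ((i,j) \<in> thin k (G \<inter> A \<times> B)))"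

text \<open>
  After the order of the averages is changed so that the index sets come first, the signs and edges of the
  two draws are handled by \<open>thinned_overlap_le_sign_avg\<close>. The row sets enter through their intersection only,
  which is a random subset with parameter \<open>\<alpha>\<^sup>2\<close>; likewise the column sets.
\<close>

lemma prior_second_moment:
  fixes I :: "'a set" and \<alpha> q s \<mu> :: real and k :: nat
  assumes I: "finite I" and \<alpha>: "0 \<le> \<alpha>" "\<alpha> \<le> 1" and q: "0 \<le> q" "q \<le> 1"
  defines "w \<equiv> (\<lambda>\<omega>. prior_weight \<alpha> q I \<omega> * of_bool (good_prior k s q \<omega>))"
  shows "(\<Sum>\<omega>\<in>prior_space I. \<Sum>\<omega>'\<in>prior_space I. w \<omega> * w \<omega>' *
      exp (\<Sum>e\<in>I \<times> I. prior_entry k \<mu> \<omega> e * prior_entry k \<mu> \<omega>' e))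
    \<le> overlap_moment (\<alpha>\<^sup>2) I (2 * s) (\<mu>\<^sup>2) (q\<^sup>2)"
proof -
  let ?T = "\<lambda>A B G. thin k (G \<inter> A \<times> B)"
  let ?E = "\<lambda>A B A' B' \<sigma> \<delta> \<sigma>' \<delta>' G G'. of_bool (good_support k s q A B G) * of_bool (good_support k s q A' B' G') *
        exp (\<mu>\<^sup>2 * (\<Sum>(i,j)\<in>?T A B G \<inter> ?T A' B' G'. (sg \<sigma> i * sg \<sigma>' i) * (sg \<delta> j * sg \<delta>' j)))"
  let ?h = "\<lambda>A B. of_bool (real (card A) \<le> 2 * s) * of_bool (real (card B) \<le> 2 * s) * sign_avg I (\<mu>\<^sup>2) (q\<^sup>2) A B"
  have inter: "bernE \<alpha> I (\<lambda>A. bernE \<alpha> I (\<lambda>B. f (A \<inter> B))) = bernE (\<alpha>\<^sup>2) I f" for f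
    using bernE_inter[OF I, of \<alpha> \<alpha> f] by (simp add: power2_eq_square)
  have inner: "(\<Sum>e\<in>I \<times> I. prior_entry k \<mu> (A, B, \<sigma>, \<delta>, G) e * prior_entry k \<mu> (A', B', \<sigma>', \<delta>', G') e)
     = \<mu>\<^sup>2 * (\<Sum>(i,j)\<in>?T A B G \<inter> ?T A' B' G'. (sg \<sigma> i * sg \<sigma>' i) * (sg \<delta> j * sg \<delta>' j))"
    if "G \<subseteq> I \<times> I" for A B \<sigma> \<delta> G A' B' \<sigma>' \<delta>' G'
  proof -
    have "?T A B G \<inter> ?T A' B' G' \<subseteq> I \<times> I" using that thin_subset[of k "G \<inter> A \<times> B"] by blast
    then show ?thesis
      unfolding sum_distrib_left prior_entry_def using I
      by (intro sum.mono_neutral_cong_right) (auto simp: power2_eq_square mult_ac)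
  qed
  have "(\<Sum>\<omega>\<in>prior_space I. \<Sum>\<omega>'\<in>prior_space I. w \<omega> * w \<omega>' *
      exp (\<Sum>e\<in>I \<times> I. prior_entry k \<mu> \<omega> e * prior_entry k \<mu> \<omega>' e))
    = (\<Sum>\<omega>\<in>prior_space I. prior_weight \<alpha> q I \<omega> * (\<Sum>\<omega>'\<in>prior_space I. prior_weight \<alpha> q I \<omega>' *
       (of_bool (good_prior k s q \<omega>) * of_bool (good_prior k s q \<omega>') * exp (\<Sum>e\<in>I \<times> I. prior_entry k \<mu> \<omega> e * prior_entry k \<mu> \<omega>' e))))"
    by (simp add: w_def sum_distrib_left mult_ac)
  also have "\<dots> = bernE \<alpha> I (\<lambda>A. bernE \<alpha> I (\<lambda>B. signsE I (\<lambda>\<sigma>. signsE I (\<lambda>\<delta>. bernE q (I \<times> I) (\<lambda>G.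
      bernE \<alpha> I (\<lambda>A'. bernE \<alpha> I (\<lambda>B'. signsE I (\<lambda>\<sigma>'. signsE I (\<lambda>\<delta>'. bernE q (I \<times> I) (\<lambda>G'.
        ?E A B A' B' \<sigma> \<delta> \<sigma>' \<delta>' G G'))))))))))"
    unfolding sum_prior by (intro bernE_cong) (simp add: inner good_prior_def)
  also have "\<dots> = bernE \<alpha> I (\<lambda>A. bernE \<alpha> I (\<lambda>B. bernE \<alpha> I (\<lambda>A'. bernE \<alpha> I (\<lambda>B'.
       signsE I (\<lambda>\<sigma>. signsE I (\<lambda>\<delta>. signsE I (\<lambda>\<sigma>'. signsE I (\<lambda>\<delta>'.
        bernE q (I \<times> I) (\<lambda>G. bernE q (I \<times> I) (\<lambda>G'. ?E A B A' B' \<sigma> \<delta> \<sigma>' \<delta>' G G'))))))))))"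
    by (simp only: bernE_swap[of "1/2" I \<alpha> I] bernE_swap[of q "I \<times> I" \<alpha> I] bernE_swap[of q "I \<times> I" "1/2" I])
  also have "\<dots> \<le> bernE \<alpha> I (\<lambda>A. bernE \<alpha> I (\<lambda>B. bernE \<alpha> I (\<lambda>A'. bernE \<alpha> I (\<lambda>B'. ?h (A \<inter> A') (B \<inter> B')))))"
  proof (intro bernE_mono \<alpha>)
    fix A B A' B' :: "'a set"
    assume AB: "A \<subseteq> I" "B \<subseteq> I" "A' \<subseteq> I" "B' \<subseteq> I"
    let ?X = "signsE I (\<lambda>\<sigma>. signsE I (\<lambda>\<delta>. signsE I (\<lambda>\<sigma>'. signsE I (\<lambda>\<delta>'.
        bernE q (I \<times> I) (\<lambda>G. bernE q (I \<times> I) (\<lambda>G'. ?E A B A' B' \<sigma> \<delta> \<sigma>' \<delta>' G G'))))))"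
    have bound: "?X \<le> sign_avg I (\<mu>\<^sup>2) (q\<^sup>2) (A \<inter> A') (B \<inter> B')"
      using thin_subset by (intro thinned_overlap_le_sign_avg I AB q) auto
    show "?X \<le> ?h (A \<inter> A') (B \<inter> B')"
    proof (cases "real (card A) \<le> 2 * s \<and> real (card B) \<le> 2 * s")
      case True
      have "card (A \<inter> A') \<le> card A" "card (B \<inter> B') \<le> card B"
        using AB I by (auto intro!: card_mono finite_subset[OF _ I])
      then have "real (card (A \<inter> A')) \<le> 2 * s" "real (card (B \<inter> B')) \<le> 2 * s" using True by linarith+
      then show ?thesis using bound by simp
    next
      case False
      then have "\<not> good_support k s q A B G" for G by (auto simp: good_support_def)
      then have X0: "?X = 0" using I by (simp add: bernE_const)
      have "bernE q (I \<times> I) (\<lambda>G. 0) = 0" using I by (simp add: bernE_const)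
      have "0 \<le> sign_avg I (\<mu>\<^sup>2) (q\<^sup>2) (A \<inter> A') (B \<inter> B')" using bound X0 by simp
      then show ?thesis unfolding X0 by simp
    qed
  qed
  also have "\<dots> = bernE \<alpha> I (\<lambda>A. bernE \<alpha> I (\<lambda>A'. bernE \<alpha> I (\<lambda>B. bernE \<alpha> I (\<lambda>B'. ?h (A \<inter> A') (B \<inter> B')))))"
    by (rule bernE_cong, rule bernE_swap)
  also have "\<dots> = bernE (\<alpha>\<^sup>2) I (\<lambda>A. bernE (\<alpha>\<^sup>2) I (\<lambda>B. ?h A B))"
    unfolding inter[of "?h _"] by (rule inter[of "\<lambda>A. bernE (\<alpha>\<^sup>2) I (?h A)"])
  finally show ?thesis unfolding overlap_moment_def .
qed

section \<open>The observed matrix and the Bayes bound\<close>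

abbreviation positions :: "nat \<Rightarrow> (nat \<times> nat) set" where
  "positions p \<equiv> {..<p} \<times> {..<p}"

lemma space_mat_borel [simp]: "space (mat_borel p) = carrier_mat p p"
  by (simp add: mat_borel_def)

lemma entries_measurable [measurable]:
  "(\<lambda>A. \<lambda>ij\<in>positions p. A $$ ij) \<in> mat_borel p \<rightarrow>\<^sub>M PiM (positions p) (\<lambda>_. borel)"
  unfolding mat_borel_def by (rule measurable_vimage_algebra1) (auto simp: space_PiM)

lemma entry_measurable:
  assumes "e \<in> positions p"
  shows "(\<lambda>A. A $$ e) \<in> borel_measurable (mat_borel p)"
proof -
  have "(\<lambda>A. (\<lambda>ij\<in>positions p. A $$ ij) e) \<in> borel_measurable (mat_borel p)"
    by (rule measurable_compose[OF entries_measurable measurable_component_singleton[OF assms]])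
  then show ?thesis using assms by simp
qed

lemma measurable_into_mat_borel:
  assumes "\<And>x. x \<in> space N \<Longrightarrow> g x \<in> carrier_mat p p"
    and "\<And>e. e \<in> positions p \<Longrightarrow> (\<lambda>x. g x $$ e) \<in> borel_measurable N"
  shows "g \<in> N \<rightarrow>\<^sub>M mat_borel p"
  unfolding mat_borel_def
  by (rule measurable_vimage_algebra2) (use assms in \<open>auto intro!: measurable_restrict\<close>)

lemma mat_measurable: "mat p p \<in> PiM (positions p) (\<lambda>_. borel) \<rightarrow>\<^sub>M mat_borel p"
proof (rule measurable_into_mat_borel)
  fix e assume e: "e \<in> positions p"
  then have eq: "(\<lambda>z. mat p p z $$ e) = (\<lambda>z. z e :: real)" by (auto simp: fun_eq_iff)
  show "(\<lambda>z. mat p p z $$ e :: real) \<in> borel_measurable (PiM (positions p) (\<lambda>_. borel))"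
    unfolding eq by (rule measurable_component_singleton[OF e])
qed simp

text \<open>
  The likelihood ratio lives on families of entries: there the law of \<open>M + Z\<close> is a shifted Gaussian
  vector, and \<open>mat p p\<close> transports it to matrices.
\<close>

lemma obs_law_eq:
  assumes M: "M \<in> carrier_mat p p"
  shows "obs_law p M = distr (density (gauss_vec (positions p)) (shift_lr (positions p) (\<lambda>e. M $$ e))) (mat_borel p) (mat p p)"
proof -
  let ?G = "gauss_vec (positions p)"
  have mat_G: "mat p p \<in> ?G \<rightarrow>\<^sub>M mat_borel p"
    using mat_measurable by (simp cong: measurable_cong_sets add: sets_gauss_vec)
  have add_M: "(\<lambda>Z. M + Z) \<in> mat_borel p \<rightarrow>\<^sub>M mat_borel p"
  proof (rule measurable_into_mat_borel)
    fix e assume e: "e \<in> positions p"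
    have [measurable]: "(\<lambda>Z. Z $$ e) \<in> borel_measurable (mat_borel p)" by (rule entry_measurable[OF e])
    have "(\<lambda>Z. M $$ e + Z $$ e) \<in> borel_measurable (mat_borel p)" by measurable
    moreover have "(M + Z) $$ e = M $$ e + Z $$ e" if "Z \<in> space (mat_borel p)" for Z
      using that e by (auto simp: index_add_mat)
    ultimately show "(\<lambda>Z. (M + Z) $$ e) \<in> borel_measurable (mat_borel p)"
      using measurable_cong[of "mat_borel p" "\<lambda>Z. (M + Z) $$ e" "\<lambda>Z. M $$ e + Z $$ e" borel] by blast
  qed (use M in simp)
  have shift: "(\<lambda>z. \<lambda>e\<in>positions p. M $$ e + z e) \<in> ?G \<rightarrow>\<^sub>M PiM (positions p) (\<lambda>_. borel)"
    by measurable
  have "obs_law p M = distr ?G (mat_borel p) (\<lambda>z. M + mat p p z)"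
    unfolding obs_law_def gaussian_mat_def by (subst distr_distr[OF add_M mat_G]) (simp add: comp_def)
  also have "(\<lambda>z. M + mat p p z) = mat p p \<circ> (\<lambda>z. \<lambda>e\<in>positions p. M $$ e + z e)"
    using M by (intro ext eq_matI) auto
  also have "distr ?G (mat_borel p) \<dots> = distr (distr ?G (PiM (positions p) (\<lambda>_. borel)) (\<lambda>z. \<lambda>e\<in>positions p. M $$ e + z e)) (mat_borel p) (mat p p)"
    by (rule distr_distr[OF mat_measurable shift, symmetric])
  finally show ?thesis by (simp add: gauss_vec_shift)
qed

lemma decision_event:
  assumes \<phi>: "\<phi> \<in> decision_rules p" and a: "a \<in> {0,1}"
  shows "{X \<in> carrier_mat p p. \<phi> X = a} \<in> sets (mat_borel p)"
proof -
  have "\<phi> -` {a} \<inter> space (mat_borel p) \<in> sets (mat_borel p)"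
    using \<phi> a unfolding decision_rules_def by (intro measurable_sets) auto
  moreover have "\<phi> -` {a} \<inter> space (mat_borel p) = {X \<in> carrier_mat p p. \<phi> X = a}" by auto
  ultimately show ?thesis by simp
qed

lemma decision_values: "\<phi> \<in> decision_rules p \<Longrightarrow> X \<in> carrier_mat p p \<Longrightarrow> \<phi> X = 0 \<or> \<phi> X = 1"
  unfolding decision_rules_def using measurable_space[of \<phi> "mat_borel p" "count_space {0,1}" X] by simp

lemma obs_law_event:
  assumes M: "M \<in> carrier_mat p p" and E: "E \<in> sets (mat_borel p)"
  shows "measure (obs_law p M) E
     = measure (density (gauss_vec (positions p)) (shift_lr (positions p) (\<lambda>e. M $$ e)))
         {z \<in> space (gauss_vec (positions p)). mat p p z \<in> E}"
    and "{z \<in> space (gauss_vec (positions p)). mat p p z \<in> E} \<in> sets (gauss_vec (positions p))"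
    and "measure (obs_law p M) E = measure (gauss_vec (positions p))
         {z \<in> space (gauss_vec (positions p)). mat p p (\<lambda>e. M $$ e + z e) \<in> E}"
proof -
  let ?G = "gauss_vec (positions p)" and ?B = "PiM (positions p) (\<lambda>_. borel :: real measure)"
  have sp: "space ?G = space ?B" by (simp add: space_PiM)
  have mat_G: "mat p p \<in> ?G \<rightarrow>\<^sub>M mat_borel p"
    using mat_measurable by (simp cong: measurable_cong_sets add: sets_gauss_vec)
  have v: "mat p p -` E \<inter> space ?G = {z \<in> space ?G. mat p p z \<in> E}" by auto
  show "{z \<in> space ?G. mat p p z \<in> E} \<in> sets ?G"
    using measurable_sets[OF mat_G E] by (simp add: v)
  show "measure (obs_law p M) E
     = measure (density ?G (shift_lr (positions p) (\<lambda>e. M $$ e))) {z \<in> space ?G. mat p p z \<in> E}"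
    unfolding obs_law_eq[OF M] using mat_G E by (subst measure_distr) (auto simp: v)
  also have "\<dots> = measure (distr ?G ?B (\<lambda>z. \<lambda>e\<in>positions p. M $$ e + z e)) {z \<in> space ?B. mat p p z \<in> E}"
    by (simp add: gauss_vec_shift sp)
  also have "\<dots> = measure ?G ((\<lambda>z. \<lambda>e\<in>positions p. M $$ e + z e) -` {z \<in> space ?B. mat p p z \<in> E} \<inter> space ?G)"
  proof (rule measure_distr)
    show "{z \<in> space ?B. mat p p z \<in> E} \<in> sets ?B"
      using measurable_sets[OF mat_measurable E] by (simp add: vimage_def Int_def conj_commute)
  qed measurable
  also have "(\<lambda>z. \<lambda>e\<in>positions p. M $$ e + z e) -` {z \<in> space ?B. mat p p z \<in> E} \<inter> space ?G
     = {z \<in> space ?G. mat p p (\<lambda>e. M $$ e + z e) \<in> E}"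
  proof -
    have "mat p p (\<lambda>e\<in>positions p. M $$ e + z e) = mat p p (\<lambda>e. M $$ e + z e)" for z
      by (intro eq_matI) auto
    then show ?thesis by (auto simp: space_PiM)
  qed
  finally show "measure (obs_law p M) E = measure ?G {z \<in> space ?G. mat p p (\<lambda>e. M $$ e + z e) \<in> E}" .
qed

lemma prob_space_obs_law:
  assumes M: "M \<in> carrier_mat p p"
  shows "prob_space (obs_law p M)"
proof -
  have "carrier_mat p p \<in> sets (mat_borel p)" using sets.top[of "mat_borel p"] by simp
  from obs_law_event(3)[OF M this]
  have "measure (obs_law p M) (space (obs_law p M)) = measure (gauss_vec (positions p)) (space (gauss_vec (positions p)))"
    by (simp add: obs_law_def)
  also have "\<dots> = 1" using prob_space.prob_space[OF prob_space_gauss_vec] .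
  finally show ?thesis
    by (intro prob_spaceI) (metis emeasure_eq_ennreal_measure ennreal_1 measure_zero_top zero_neq_one)
qed

lemma Theta_carrier: "M \<in> Theta p k lam \<Longrightarrow> M \<in> carrier_mat p p"
  by (simp add: Theta_def sparse_mats_def)

text \<open>
  Multiples of the identity matrix are \<open>k\<close>-sparse and have arbitrarily large norm. This makes the supremum over
  the alternative one over a nonempty set.
\<close>

lemma Theta_nonempty:
  assumes "0 < k" "0 < p"
  shows "Theta p k lam \<noteq> {}"
proof -
  let ?M = "\<bar>lam\<bar> \<cdot>\<^sub>m (1\<^sub>m p) :: real mat"
  let ?e = "\<lambda>i. if i = 0 then 1 else 0 :: real"
  have M: "?M \<in> carrier_mat p p" by simp
  have "{j. j < p \<and> ?M $$ (i, j) \<noteq> 0} \<subseteq> {i}" "{l. l < p \<and> ?M $$ (l, i) \<noteq> 0} \<subseteq> {i}" if "i < p" for i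
    using that by (auto split: if_splits)
  moreover have "card X \<le> k" if "X \<subseteq> {i}" for X and i :: nat
    using card_mono[OF _ that] assms(1) by simp
  ultimately have "card {j. j < p \<and> ?M $$ (i, j) \<noteq> 0} \<le> k" "card {l. l < p \<and> ?M $$ (l, i) \<noteq> 0} \<le> k" if "i < p" for i
    using that by meson+
  then have "?M \<in> sparse_mats p k" using M unfolding sparse_mats_def by blast
  moreover have "lam \<le> spectral_norm ?M"
  proof -
    have "(\<Sum>i<p. (?e i)\<^sup>2) \<le> 1" using assms(2) by (simp add: if_distrib[of "\<lambda>x. x\<^sup>2"] cong: if_cong)
    from bilinear_le_spectral_norm[OF M assms(2) this this]
    have "(\<Sum>i<p. \<Sum>j<p. ?M $$ (i,j) * ?e i * ?e j) \<le> spectral_norm ?M" by simp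
    also have "(\<Sum>i<p. \<Sum>j<p. ?M $$ (i,j) * ?e i * ?e j) = (\<Sum>i<p. \<Sum>j<p. if i = 0 \<and> j = 0 then \<bar>lam\<bar> else 0)"
      by (intro sum.cong refl) auto
    also have "\<dots> = (\<Sum>i<p. if i = 0 then (\<Sum>j<p. if j = 0 then \<bar>lam\<bar> else 0) else 0)"
      by (intro sum.cong refl) auto
    also have "\<dots> = \<bar>lam\<bar>" using assms(2) by simp
    finally show ?thesis by simp
  qed
  ultimately show ?thesis unfolding Theta_def by blast
qed

lemma obs_measure_bdd: "bdd_above ((\<lambda>M. measure (obs_law p M) E) ` Theta p k lam)"
  using prob_space.prob_le_1[OF prob_space_obs_law[OF Theta_carrier]] by (intro bdd_aboveI2[of _ _ 1]) blast

lemma decision_rules_nonempty: "decision_rules p \<noteq> {}"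
proof -
  have "(\<lambda>_. 0) \<in> decision_rules p" unfolding decision_rules_def by simp
  then show ?thesis by blast
qed

text \<open>
  The vectors of signs on \<open>A\<close> and on \<open>B\<close> have squared length at most \<open>2 * s\<close>, and the bilinear form of the
  matrix at these vectors is \<open>\<mu>\<close> times its number of entries, since all the signs square to 1.
\<close>

lemma prior_matrix_in_Theta:
  assumes A: "A \<subseteq> {..<p}" and B: "B \<subseteq> {..<p}" and G: "G \<subseteq> positions p" and p: "0 < p"
    and good: "good_support k s q A B G" and s: "0 < s" and \<mu>: "0 \<le> \<mu>" and lam: "lam \<le> \<mu> * s * q / 32"
  shows "mat p p (prior_entry k \<mu> (A, B, \<sigma>, \<delta>, G)) \<in> Theta p k lam" (is "?M \<in> _")
proof -
  let ?H = "G \<inter> A \<times> B"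
  let ?T = "thin k ?H"
  have finH: "finite ?H" using G by (auto intro: finite_subset[OF _ finite_cartesian_product[OF finite_lessThan finite_lessThan]])
  have finT: "finite ?T" using finite_subset[OF thin_subset finH] .
  have M: "?M \<in> carrier_mat p p" by simp
  have entry: "?M $$ (i,j) = \<mu> * (sg \<sigma> i * sg \<delta> j) * of_bool ((i,j) \<in> ?T)" if "i < p" "j < p" for i j
    using that by (simp add: prior_entry_def)
  have "?M \<in> sparse_mats p k"
    unfolding sparse_mats_def
  proof (intro CollectI conjI allI impI M)
    fix i assume i: "i < p"
    have "{j. j < p \<and> ?M $$ (i, j) \<noteq> 0} \<subseteq> ?T `` {i}" using i by (auto simp: entry simp del: index_mat split: if_splits)
    then have "card {j. j < p \<and> ?M $$ (i, j) \<noteq> 0} \<le> card (?T `` {i})"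
      using finT by (intro card_mono) (auto intro: finite_Image)
    then show "card {j. j < p \<and> ?M $$ (i, j) \<noteq> 0} \<le> k" using thin_degrees(1)[OF finH, of k i] by linarith
  next
    fix j assume j: "j < p"
    have "{i. i < p \<and> ?M $$ (i, j) \<noteq> 0} \<subseteq> ?T\<inverse> `` {j}" using j by (auto simp: entry simp del: index_mat split: if_splits)
    then have "card {i. i < p \<and> ?M $$ (i, j) \<noteq> 0} \<le> card (?T\<inverse> `` {j})"
      using finT by (intro card_mono) (auto intro: finite_Image)
    then show "card {i. i < p \<and> ?M $$ (i, j) \<noteq> 0} \<le> k" using thin_degrees(2)[OF finH, of k j] by linarith
  qed
  moreover have "lam \<le> spectral_norm ?M"
  proof -
    let ?u = "\<lambda>i. sg \<sigma> i * of_bool (i \<in> A)" and ?v = "\<lambda>j. sg \<delta> j * of_bool (j \<in> B)"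
    have sq: "(sg \<tau> i * of_bool (i \<in> C))\<^sup>2 = of_bool (i \<in> C)" for \<tau> C :: "nat set" and i
      by (simp add: sg_def)
    have "(\<Sum>i<p. (?u i)\<^sup>2) = real (card A)" "(\<Sum>j<p. (?v j)\<^sup>2) = real (card B)"
      unfolding sq using card_inter_sum[of "{..<p}" A] card_inter_sum[of "{..<p}" B] A B
      by (simp_all add: Int_absorb2)
    then have uv: "(\<Sum>i<p. (?u i)\<^sup>2) \<le> 2 * s" "(\<Sum>j<p. (?v j)\<^sup>2) \<le> 2 * s"
      using good by (auto simp: good_support_def)
    have sub: "?T \<subseteq> positions p" using G thin_subset[of k ?H] by blast
    have subAB: "i \<in> A \<and> j \<in> B" if "(i,j) \<in> ?T" for i j using that thin_subset[of k ?H] by blast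
    have "\<mu> * (s\<^sup>2 * q / 16) \<le> \<mu> * real (card ?T)"
      using good \<mu> by (intro mult_left_mono) (auto simp: good_support_def)
    also have "\<dots> = (\<Sum>e\<in>positions p. \<mu> * of_bool (e \<in> ?T))"
      using card_inter_sum[of "positions p" ?T] sub by (simp add: Int_absorb2 sum_distrib_left[symmetric])
    also have "\<dots> = (\<Sum>i<p. \<Sum>j<p. \<mu> * of_bool ((i,j) \<in> ?T))"
      by (simp only: sum.cartesian_product case_prod_unfold prod.collapse)
    also have "\<dots> = (\<Sum>i<p. \<Sum>j<p. ?M $$ (i,j) * ?u i * ?v j)"
      using subAB by (intro sum.cong refl) (auto simp: entry sg_def simp del: index_mat)
    also have "\<dots> \<le> spectral_norm ?M * (2 * s)" by (rule bilinear_le_spectral_norm[OF M p uv])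
    finally have "\<mu> * s * q / 32 \<le> spectral_norm ?M" using s by (simp add: power2_eq_square field_simps)
    with lam show ?thesis by simp
  qed
  ultimately show ?thesis unfolding Theta_def by blast
qed

text \<open>
  The supremum over the alternative is at least the average over the good draws of the prior. Bad
  draws, of probability at most \<open>b\<close>, only reduce the mass of the mixture.
\<close>

lemma opt_error_lower_bound:
  fixes \<alpha> q s \<mu> lam :: real
  assumes k: "0 < k" and p: "0 < p" and \<alpha>: "0 < \<alpha>" "\<alpha> \<le> 1" and q: "0 < q" "q \<le> 1"
    and s: "s = real p * \<alpha>" and \<mu>: "0 \<le> \<mu>" and lam: "lam \<le> \<mu> * s * q / 32"
    and bad: "8 / s + 16 / (q * s\<^sup>2) + 32 * s * q / k \<le> b"
    and V: "overlap_moment (\<alpha>\<^sup>2) {..<p} (2 * s) (\<mu>\<^sup>2) (q\<^sup>2) \<le> v"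
  shows "opt_error p k lam \<ge> 1 - sqrt (v - 1 + 2 * b)"
  unfolding opt_error_def
proof (rule cINF_greatest[OF decision_rules_nonempty])
  fix \<phi> assume \<phi>: "\<phi> \<in> decision_rules p"
  let ?I = "positions p" and ?G = "gauss_vec (positions p)"
  let ?P = "\<lambda>M a. measure (obs_law p M) {X \<in> carrier_mat p p. \<phi> X = a}"
  let ?sup = "SUP M\<in>Theta p k lam. ?P M 0"
  have s0: "s > 0" using \<alpha> p s by simp
  have \<alpha>': "0 \<le> \<alpha>" and q': "0 \<le> q" using \<alpha> q by auto
  define W where "W = prior_space {..<p}"
  define w where "w = (\<lambda>\<omega>. prior_weight \<alpha> q {..<p} \<omega> * of_bool (good_prior k s q \<omega>))"
  define a where "a = (prior_entry k \<mu> :: _ \<Rightarrow> nat \<times> nat \<Rightarrow> real)"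
  define S where "S = {z \<in> space ?G. mat p p z \<in> {X \<in> carrier_mat p p. \<phi> X = 0}}"
  have finW: "finite W" unfolding W_def prior_space_def by simp
  have pw: "prior_weight \<alpha> q {..<p} \<omega> \<ge> 0" for \<omega> :: "nat draw"
    using \<alpha> q by (intro prior_weight_nonneg) auto
  have w0: "w \<omega> \<ge> 0" for \<omega> unfolding w_def using pw by simp
  have "sum w W = supportE \<alpha> q {..<p} (\<lambda>A B G. of_bool (good_support k s q A B G))"
    unfolding w_def W_def sum_prior supportE_def by (simp add: good_prior_def bernE_const)
  also have "\<dots> \<ge> 1 - (8 / s + 16 / (q * s\<^sup>2) + 32 * s * q / k)"
    using s s0 by (intro good_support_probability k \<alpha> q) auto
  finally have W1: "sum w W \<ge> 1 - b" using bad by simp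
  have "sum w W \<le> (\<Sum>\<omega>\<in>W. prior_weight \<alpha> q {..<p} \<omega> * 1)"
    unfolding w_def using pw by (intro sum_mono mult_left_mono) auto
  also have "\<dots> = 1" unfolding W_def sum_prior[where f = "\<lambda>_. 1"] by (simp add: bernE_const)
  finally have W2: "sum w W \<le> 1" .
  have in_Theta: "mat p p (a \<omega>) \<in> Theta p k lam" if "\<omega> \<in> W" "good_prior k s q \<omega>" for \<omega>
  proof -
    obtain A B \<sigma> \<delta> G where \<omega>: "\<omega> = (A, B, \<sigma>, \<delta>, G)" by (cases \<omega>)
    show ?thesis unfolding \<omega> a_def
      using that by (intro prior_matrix_in_Theta[OF _ _ _ p _ s0 \<mu> lam]) (auto simp: \<omega> W_def prior_space_def good_prior_def)
  qed
  have nonempty: "Theta p k lam \<noteq> {}" by (rule Theta_nonempty[OF k p])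
  have sup0: "?sup \<ge> 0"
  proof -
    obtain M where M: "M \<in> Theta p k lam" using nonempty by blast
    have "0 \<le> ?P M 0" by simp
    also have "\<dots> \<le> ?sup" by (rule cSUP_upper[OF M obs_measure_bdd])
    finally show ?thesis .
  qed
  have E0: "{X \<in> carrier_mat p p. \<phi> X = 0} \<in> sets (mat_borel p)" and E1: "{X \<in> carrier_mat p p. \<phi> X = 1} \<in> sets (mat_borel p)"
    using decision_event[OF \<phi>] by auto
  have SG: "S \<in> sets ?G" unfolding S_def using obs_law_event(2)[OF _ E0, of "0\<^sub>m p p"] by simp
  have each: "w \<omega> * measure (density ?G (shift_lr ?I (a \<omega>))) S \<le> w \<omega> * ?sup" if "\<omega> \<in> W" for \<omega>
  proof (cases "good_prior k s q \<omega>")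
    case True
    have lr: "shift_lr ?I (a \<omega>) = shift_lr ?I (\<lambda>e. mat p p (a \<omega>) $$ e)"
      by (auto simp: shift_lr_def fun_eq_iff intro!: arg_cong2[where f = "(-)"] sum.cong)
    have "measure (density ?G (shift_lr ?I (a \<omega>))) S = ?P (mat p p (a \<omega>)) 0"
      unfolding lr S_def by (rule obs_law_event(1)[OF _ E0, symmetric]) simp
    also have "\<dots> \<le> ?sup" by (rule cSUP_upper[OF in_Theta[OF that True] obs_measure_bdd])
    finally show ?thesis using w0 by (intro mult_left_mono)
  next
    case False
    then show ?thesis by (simp add: w_def)
  qed
  have "(\<Sum>\<omega>\<in>W. w \<omega> * measure (density ?G (shift_lr ?I (a \<omega>))) S) \<le> (\<Sum>\<omega>\<in>W. w \<omega> * ?sup)"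
    by (intro sum_mono each)
  also have "\<dots> = sum w W * ?sup" by (simp add: sum_distrib_right)
  also have "\<dots> \<le> 1 * ?sup" using W2 sup0 by (intro mult_right_mono)
  finally have avg: "(\<Sum>\<omega>\<in>W. w \<omega> * measure (density ?G (shift_lr ?I (a \<omega>))) S) \<le> ?sup" by simp
  have null: "?P (0\<^sub>m p p) 1 = measure ?G (space ?G - S)"
  proof -
    have z: "mat p p (\<lambda>e. 0\<^sub>m p p $$ e + z e) = mat p p z" for z :: "nat \<times> nat \<Rightarrow> real" by (intro eq_matI) auto
    have "?P (0\<^sub>m p p) 1 = measure ?G {z \<in> space ?G. mat p p z \<in> {X \<in> carrier_mat p p. \<phi> X = 1}}"
      using obs_law_event(3)[OF _ E1, of "0\<^sub>m p p"] by (simp add: z)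
    also have "{z \<in> space ?G. mat p p z \<in> {X \<in> carrier_mat p p. \<phi> X = 1}} = space ?G - S"
    proof -
      have "\<phi> (mat p p z) = 1 \<longleftrightarrow> \<phi> (mat p p z) \<noteq> 0" for z
        using decision_values[OF \<phi>, of "mat p p z"] by auto
      then show ?thesis by (auto simp: S_def)
    qed
    finally show ?thesis .
  qed
  let ?V = "\<Sum>x\<in>W. \<Sum>y\<in>W. w x * w y * exp (\<Sum>e\<in>?I. a x e * a y e)"
  have "?V \<le> v"
    unfolding w_def W_def a_def
    by (rule order_trans[OF prior_second_moment[OF finite_lessThan \<alpha>' \<alpha>(2) q' q(2)] V])
  then have "sqrt (1 - 2 * sum w W + ?V) \<le> sqrt (v - 1 + 2 * b)"
    using W1 by (intro real_sqrt_le_mono) linarith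
  moreover have "measure ?G (space ?G - S) + (\<Sum>\<omega>\<in>W. w \<omega> * measure (density ?G (shift_lr ?I (a \<omega>))) S)
      \<ge> 1 - sqrt (1 - 2 * sum w W + ?V)"
    using w0 by (intro mixture_testing_lower_bound finW SG) auto
  ultimately show "1 - sqrt (v - 1 + 2 * b) \<le> ?P (0\<^sub>m p p) 1 + ?sup"
    using avg null by linarith
qed

section \<open>Calibration of the prior\<close>

lemma one_plus_ln_le:
  assumes "(z::real) > 0"
  shows "1 + ln z \<le> z"
  using ln_add_one_self_le_self2[of "z - 1"] assms by simp

lemma powr_third_cubed: "0 < (u::real) \<Longrightarrow> (u powr (1/3)) ^ 3 = u"
  by (simp add: powr_power)

lemma powr_fourth_squared: "0 \<le> (u::real) \<Longrightarrow> (u powr (1/4))\<^sup>2 = sqrt u"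
  by (simp add: power2_eq_square powr_add[symmetric] powr_half_sqrt)

lemma mult_sqrt_inside: "0 \<le> a \<Longrightarrow> a * sqrt b = sqrt (a\<^sup>2 * b)"
  by (simp add: real_sqrt_mult)

text \<open>
  This is \<open>1 + ln r \<le> r\<close> for the cube root \<open>r\<close> of \<open>z\<close>.
\<close>

lemma one_plus_ln_cubed:
  assumes z: "z \<ge> (1::real)"
  shows "(1 + ln z) ^ 3 \<le> 27 * z"
proof -
  define r where "r = z powr (1/3)"
  have r: "r > 0" "r ^ 3 = z" "ln r = ln z / 3"
    using z powr_third_cubed[of z] by (auto simp: r_def ln_powr)
  have "1 + ln z \<le> 3 * r" using one_plus_ln_le[OF r(1)] r(3) by simp
  moreover have "0 \<le> 1 + ln z" using z by simp
  ultimately have "(1 + ln z) ^ 3 \<le> (3 * r) ^ 3" by (intro power_mono) auto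
  then show ?thesis using r by (simp add: power_mult_distrib)
qed

text \<open>
  The index sets have about \<open>s = sqrt (k p / L)\<close> elements, the degrees are about \<open>\<eta> k\<close>, and the overlap of two
  index sets has mean \<open>m = k / L\<close>. With \<open>x = \<mu>\<^sup>2\<close> and \<open>y = p L / k ^ 3\<close>, the hypothesis on the signal reads
  \<open>exp x - 1 \<le> sqrt y\<close>. Since \<open>\<rho>\<close> is \<open>\<eta>\<^sup>2 k L / p\<close>, the quantity \<open>m\<^sup>2 * \<rho>\<close> is \<open>\<eta>\<^sup>2 / y\<close>, and
  \<open>cosh x - 1 \<le> (exp x - 1)\<^sup>2 / 2 \<le> y / 2\<close> cancels the \<open>y\<close>. That is the reason for this
  condition; the remaining estimates bound \<open>D\<close> and \<open>m * D\<close> by multiples of \<open>\<eta>\<^sup>2\<close>.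
\<close>

lemma opt_error_lower_bound_calibrated:
  fixes k p :: nat and \<eta> lam :: real
  assumes k: "1 \<le> k" "k \<le> p" and \<eta>: "0 < \<eta>" "\<eta>\<^sup>2 \<le> 1 / 112" and lam: "0 \<le> lam"
    and sig: "exp ((32 * lam / (\<eta> * k))\<^sup>2) - 1 \<le> sqrt (p * ln (exp 1 * p / k) / real k ^ 3)"
  shows "opt_error p k lam \<ge> 1 - sqrt ((exp (4 * \<eta>\<^sup>2) - 1 + 2 * exp (- 1 / (14 * \<eta>\<^sup>2)) + 64 * \<eta>) + 48 / (\<eta> * sqrt (p / (1 + ln p))))"
proof -
  define n \<kappa> L x y where "n = real p" and "\<kappa> = real k" and "L = ln (exp 1 * p / k)"
    and "x = (32 * lam / (\<eta> * k))\<^sup>2" and "y = real p * L / real k ^ 3"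
  have \<kappa>: "\<kappa> \<ge> 1" and n: "n \<ge> \<kappa>" using k by (auto simp: n_def \<kappa>_def)
  then have n1: "n \<ge> 1" by simp
  have \<eta>1: "\<eta> \<le> 1"
    using \<eta> power2_le_imp_le[of \<eta> 1] by simp
  have L_eq: "L = 1 + ln (n / \<kappa>)"
    using k unfolding L_def n_def \<kappa>_def by (simp add: ln_mult ln_div)
  have z: "n / \<kappa> \<ge> 1" using \<kappa> n by simp
  have L1: "L \<ge> 1" using z by (simp add: L_eq)
  have expL: "exp L = exp 1 * (n / \<kappa>)" using \<kappa> n by (simp add: L_eq exp_add)
  have L3: "L ^ 3 \<le> 27 * (n / \<kappa>)" unfolding L_eq by (rule one_plus_ln_cubed[OF z])
  have Lle: "\<kappa> * L \<le> n" using one_plus_ln_le[of "n / \<kappa>"] \<kappa> n by (simp add: L_eq field_simps)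
  have y: "y = n * L / \<kappa> ^ 3" by (simp add: y_def n_def \<kappa>_def)
  have y0: "y \<ge> 0" using \<kappa> n1 L1 by (simp add: y)
  have x0: "x \<ge> 0" by (simp add: x_def)
  have sig': "exp x - 1 \<le> sqrt y" using sig by (simp add: x_def y_def L_def)
  define \<alpha> q s m \<rho> where "\<alpha> = sqrt (\<kappa> / (n * L))" and "q = \<eta> * sqrt (\<kappa> * L / n)" and "s = sqrt (\<kappa> * n / L)"
    and "m = \<kappa> / L" and "\<rho> = \<eta>\<^sup>2 * (\<kappa> * L / n)"
  have \<alpha>: "0 < \<alpha>" "\<alpha> \<le> 1"
  proof -
    show "0 < \<alpha>" using \<kappa> n1 L1 by (simp add: \<alpha>_def)
    have "\<kappa> \<le> n * L" using mult_mono[of \<kappa> n 1 L] n L1 \<kappa> by simp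
    then show "\<alpha> \<le> 1" using n1 L1 by (simp add: \<alpha>_def)
  qed
  have ratio: "0 < \<kappa> * L / n" "\<kappa> * L / n \<le> 1" using Lle n1 \<kappa> L1 by auto
  then have sr: "0 < sqrt (\<kappa> * L / n)" "sqrt (\<kappa> * L / n) \<le> 1" by auto
  have q: "0 < q" "q \<le> 1" using \<eta> \<eta>1 sr mult_mono[of \<eta> 1 "sqrt (\<kappa> * L / n)" 1] by (auto simp: q_def)
  have s0: "s > 0" using \<kappa> n1 L1 by (simp add: s_def)
  have s_eq: "s = n * \<alpha>"
  proof -
    have "n * \<alpha> = sqrt (n\<^sup>2 * (\<kappa> / (n * L)))"  unfolding \<alpha>_def using n1 by (intro mult_sqrt_inside) simp
    also have "n\<^sup>2 * (\<kappa> / (n * L)) = \<kappa> * n / L" using n1 L1 by (simp add: power2_eq_square field_simps)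
    finally show ?thesis by (simp add: s_def)
  qed
  have sq_eq: "s * q = \<eta> * \<kappa>"
  proof -
    have "s * q = \<eta> * sqrt ((\<kappa> * n / L) * (\<kappa> * L / n))"
      unfolding s_def q_def by (subst real_sqrt_mult) (rule mult.left_commute)
    also have "(\<kappa> * n / L) * (\<kappa> * L / n) = \<kappa>\<^sup>2" using n1 L1 by (simp add: power2_eq_square field_simps)
    finally show ?thesis using \<kappa> by simp
  qed
  have \<rho>_eq: "\<rho> = q\<^sup>2" using ratio by (simp add: \<rho>_def q_def power_mult_distrib)
  have \<rho>: "0 \<le> \<rho>" "\<rho> \<le> 1" using q by (auto simp: \<rho>_eq power_le_one)
  have \<beta>: "\<alpha>\<^sup>2 = \<kappa> / (n * L)" using \<kappa> n1 L1 by (simp add: \<alpha>_def)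
  have m_eq: "m = n * \<alpha>\<^sup>2" using n1 L1 by (simp add: \<beta> m_def)
  have m0: "m > 0" using \<kappa> L1 by (simp add: m_def)
  define D where "D = \<rho> * (exp x - 1)"
  have D0: "D \<ge> 0" using \<rho> x0 by (simp add: D_def)
  have D_le: "D \<le> \<eta>\<^sup>2 * sqrt (L ^ 3 / (\<kappa> * n))"
  proof -
    have "D \<le> \<rho> * sqrt y" unfolding D_def using \<rho> sig' by (intro mult_left_mono)
    also have "\<dots> = \<eta>\<^sup>2 * (sqrt ((\<kappa> * L / n)\<^sup>2) * sqrt y)"
    proof -
      have "sqrt ((\<kappa> * L / n)\<^sup>2) = \<kappa> * L / n" using ratio(1) by (metis abs_of_pos real_sqrt_abs)
      then show ?thesis unfolding \<rho>_def by simp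
    qed
    also have "sqrt ((\<kappa> * L / n)\<^sup>2) * sqrt y = sqrt ((\<kappa> * L / n)\<^sup>2 * y)" by (simp add: real_sqrt_mult)
    also have "(\<kappa> * L / n)\<^sup>2 * y = L ^ 3 / (\<kappa> * n)"
      using \<kappa> n1 by (simp add: y power2_eq_square power3_eq_cube field_simps)
    finally show ?thesis .
  qed
  have D6: "D \<le> 6 * \<eta>\<^sup>2"
  proof -
    have "L ^ 3 / (\<kappa> * n) \<le> 27 * (n / \<kappa>) / (\<kappa> * n)"
      using L3 \<kappa> n1 by (intro divide_right_mono) auto
    also have "\<dots> = 27 / \<kappa>\<^sup>2" using n1 by (simp add: power2_eq_square)
    also have "\<dots> \<le> 27 / 1" using \<kappa> by (intro divide_left_mono) auto
    finally have "sqrt (L ^ 3 / (\<kappa> * n)) \<le> sqrt 36" by (intro real_sqrt_le_mono) simp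
    also have "sqrt 36 = (6::real)" by (simp add: real_sqrt_unique)
    finally have "\<eta>\<^sup>2 * sqrt (L ^ 3 / (\<kappa> * n)) \<le> \<eta>\<^sup>2 * 6" by (intro mult_left_mono) auto
    then show ?thesis using D_le by simp
  qed
  have mD: "m * D \<le> \<eta>\<^sup>2 * sqrt (\<kappa> * L / n)"
  proof -
    have "m * D \<le> m * (\<eta>\<^sup>2 * sqrt (L ^ 3 / (\<kappa> * n)))" using D_le m0 by (intro mult_left_mono) auto
    also have "\<dots> = \<eta>\<^sup>2 * sqrt (m\<^sup>2 * (L ^ 3 / (\<kappa> * n)))"
      by (simp only: mult.left_commute[of m] mult_sqrt_inside[OF less_imp_le[OF m0]])
    also have "m\<^sup>2 * (L ^ 3 / (\<kappa> * n)) = \<kappa> * L / n"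
      using \<kappa> n1 L1 by (simp add: m_def power2_eq_square power3_eq_cube field_simps)
    finally show ?thesis .
  qed
  also have "\<dots> \<le> \<eta>\<^sup>2 * 1" using sr by (intro mult_left_mono) auto
  finally have mD1: "m * D \<le> \<eta>\<^sup>2" by simp
  have Dt: "D * (2 * s) \<le> L / 4"
  proof -
    have "D * (2 * s) \<le> (\<eta>\<^sup>2 * sqrt (L ^ 3 / (\<kappa> * n))) * (2 * s)" using D_le s0 by (intro mult_right_mono) auto
    also have "\<dots> = 2 * \<eta>\<^sup>2 * sqrt ((L ^ 3 / (\<kappa> * n)) * (\<kappa> * n / L))" unfolding s_def real_sqrt_mult by simp
    also have "(L ^ 3 / (\<kappa> * n)) * (\<kappa> * n / L) = L\<^sup>2"
      using \<kappa> n1 L1 by (simp add: power2_eq_square power3_eq_cube field_simps)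
    also have "2 * \<eta>\<^sup>2 * sqrt (L\<^sup>2) = 2 * \<eta>\<^sup>2 * L" using L1 by simp
    also have "\<dots> \<le> 1 / 4 * L" using \<eta> L1 by (intro mult_right_mono) auto
    finally show ?thesis by simp
  qed
  have mDe: "m * D * exp (D * (2 * s)) \<le> 1"
  proof -
    have "sqrt (\<kappa> * L / n) * exp (L / 4) \<le> 2"
    proof (rule power2_le_imp_le)
      have "\<kappa> * L / n = L * exp (1 - L)" using \<kappa> n1 by (simp add: expL exp_diff)
      then have "(sqrt (\<kappa> * L / n) * exp (L / 4))\<^sup>2 = L * exp (1 - L) * exp (L / 2)"
        using ratio by (simp add: power_mult_distrib exp_of_nat_mult[of 2, simplified, symmetric])
      also have "\<dots> = L * exp (1 - L / 2)" by (simp add: mult_exp_exp)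
      also have "\<dots> \<le> 2 * exp (L / 2 - 1) * exp (1 - L / 2)"
        using exp_ge_add_one_self[of "L / 2 - 1"] by (intro mult_right_mono) auto
      also have "\<dots> = 2" by (simp add: mult_exp_exp)
      finally show "(sqrt (\<kappa> * L / n) * exp (L / 4))\<^sup>2 \<le> 2\<^sup>2" by simp
    qed simp
    then have "\<eta>\<^sup>2 * (sqrt (\<kappa> * L / n) * exp (L / 4)) \<le> 1 / 112 * 2"
      using \<eta> sr by (intro mult_mono) auto
    moreover have "m * D * exp (D * (2 * s)) \<le> (\<eta>\<^sup>2 * sqrt (\<kappa> * L / n)) * exp (L / 4)"
      by (rule mult_mono) (use mD Dt sr in auto)
    ultimately show ?thesis by simp
  qed
  \<comment> \<open>The largest order that \<open>D * J \<le> 1 / 2\<close> permits. For small \<open>\<eta>\<close> it is far above the mean overlap \<open>m\<close>.\<close>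
  define J where "J = (1 + m) / (14 * \<eta>\<^sup>2)"
  have \<eta>2: "\<eta>\<^sup>2 > 0" using \<eta> by simp
  have J: "J > 0" "D * J \<le> 1 / 2"
  proof -
    show "J > 0" using m0 \<eta>2 by (simp add: J_def)
    have "D * (1 + m) \<le> 7 * \<eta>\<^sup>2" using D6 mD1 by (simp add: algebra_simps)
    then show "D * J \<le> 1 / 2" using \<eta>2 by (simp add: J_def field_simps)
  qed
  have tail: "m * (exp 2 - 1) - J \<le> - 1 / (14 * \<eta>\<^sup>2)"
  proof -
    have "exp (1 + 1 :: real) \<le> 3 * 3" unfolding exp_add using exp_le by (intro mult_mono) auto
    then have "m * (exp 2 - 1) \<le> m * 8" using m0 by (intro mult_left_mono) auto
    also have "\<dots> \<le> m * (1 / (14 * \<eta>\<^sup>2))"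
      using \<eta> \<eta>2 m0 by (intro mult_left_mono) (auto simp: field_simps)
    finally show ?thesis by (simp add: J_def add_divide_distrib)
  qed
  define K where "K = \<rho> * (cosh x - 1) + (\<rho> * sinh x)\<^sup>2"
  have m2K: "m\<^sup>2 * K \<le> \<eta>\<^sup>2"
  proof -
    have cosh: "cosh x - 1 \<le> y / 2"
    proof -
      have "cosh x - 1 = (exp x - 1)\<^sup>2 / (2 * exp x)"
        by (simp add: cosh_def field_simps power2_eq_square exp_minus)
      also have "\<dots> \<le> (exp x - 1)\<^sup>2 / 2"
        using x0 by (intro divide_left_mono) auto
      also have "(exp x - 1)\<^sup>2 \<le> (sqrt y)\<^sup>2" using sig' x0 by (intro power_mono) auto
      finally show ?thesis using y0 by simp
    qed
    have "m\<^sup>2 * (\<rho> * (cosh x - 1)) \<le> m\<^sup>2 * (\<rho> * (y / 2))" using cosh \<rho> by (intro mult_left_mono) auto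
    also have "\<dots> = \<eta>\<^sup>2 / 2"
      using \<kappa> n1 L1 by (simp add: m_def \<rho>_def y power2_eq_square power3_eq_cube field_simps)
    finally have 1: "m\<^sup>2 * (\<rho> * (cosh x - 1)) \<le> \<eta>\<^sup>2 / 2" .
    have "sinh x \<le> exp x - 1" using cosh_real_ge_1[of x] by (simp add: cosh_def sinh_def field_simps)
    then have "\<rho> * sinh x \<le> D" unfolding D_def using \<rho> by (intro mult_left_mono)
    then have "m * (\<rho> * sinh x) \<le> m * D" using m0 by (intro mult_left_mono) auto
    then have "m * (\<rho> * sinh x) \<le> \<eta>\<^sup>2" using mD1 by linarith
    then have "(m * (\<rho> * sinh x))\<^sup>2 \<le> (\<eta>\<^sup>2)\<^sup>2" using m0 \<rho> x0 by (intro power_mono) auto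
    also have "\<dots> \<le> \<eta>\<^sup>2 / 2" using \<eta> \<eta>2 mult_left_mono[of "\<eta>\<^sup>2" "1/2" "\<eta>\<^sup>2"] by (simp add: power2_eq_square)
    finally have 2: "m\<^sup>2 * (\<rho> * sinh x)\<^sup>2 \<le> \<eta>\<^sup>2 / 2" by (simp add: power_mult_distrib)
    show ?thesis using 1 2 by (simp add: K_def distrib_left)
  qed
  define v where "v = exp (4 * \<eta>\<^sup>2) + 2 * exp (- 1 / (14 * \<eta>\<^sup>2))"
  define \<mu> where "\<mu> = 32 * lam / (\<eta> * k)"
  have V: "overlap_moment (\<alpha>\<^sup>2) {..<p} (2 * s) (\<mu>\<^sup>2) (q\<^sup>2) \<le> v"
  proof -
    have "\<mu>\<^sup>2 = x" by (simp add: \<mu>_def x_def)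
    moreover have "overlap_moment (\<alpha>\<^sup>2) {..<p} (2 * s) x \<rho> \<le> exp (4 * m\<^sup>2 * K) + 2 * exp (m * (exp 2 - 1) - J)"
      using sign_avg_overlap_bound[of "{..<p}" x \<rho> "\<alpha>\<^sup>2" J "2 * s"] x0 \<rho> \<alpha> J mDe mD1 \<eta> D6
      by (simp add: D_def[symmetric] K_def[symmetric] m_eq n_def power_le_one)
    moreover have "exp (4 * m\<^sup>2 * K) + 2 * exp (m * (exp 2 - 1) - J) \<le> v"
      unfolding v_def using m2K tail by (intro add_mono) auto
    ultimately show ?thesis unfolding \<rho>_eq by simp
  qed
  define b where "b = 24 / (\<eta> * sqrt (n / (1 + ln n))) + 32 * \<eta>"
  have bad: "8 / s + 16 / (q * s\<^sup>2) + 32 * s * q / k \<le> b"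
  proof -
    have s_ge: "s \<ge> sqrt (n / (1 + ln n))"
    proof -
      have "L \<le> 1 + ln n" using \<kappa> n1 by (simp add: L_eq ln_div)
      then have "n / (1 + ln n) \<le> \<kappa> * n / L"
        using \<kappa> n1 L1 by (intro frac_le) auto
      then show ?thesis unfolding s_def by (rule real_sqrt_le_mono)
    qed
    have r0: "sqrt (n / (1 + ln n)) > 0" using n1 by (simp add: add_pos_nonneg)
    have "q * s\<^sup>2 = \<eta> * \<kappa> * s" using sq_eq by (simp add: power2_eq_square mult_ac)
    also have "\<dots> \<ge> \<eta> * 1 * s" using \<kappa> \<eta> s0 by (intro mult_right_mono mult_left_mono) auto
    finally have "q * s\<^sup>2 \<ge> \<eta> * s" by simp
    then have "16 / (q * s\<^sup>2) \<le> 16 / (\<eta> * s)" using \<eta> s0 q by (intro divide_left_mono) auto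
    moreover have "8 / s \<le> 8 / (\<eta> * s)"
      using \<eta> \<eta>1 s0 mult_right_mono[of \<eta> 1 s] by (intro divide_left_mono) auto
    moreover have "24 / (\<eta> * s) \<le> 24 / (\<eta> * sqrt (n / (1 + ln n)))"
      using s_ge r0 \<eta> s0 by (intro divide_left_mono mult_left_mono) auto
    moreover have "32 * s * q / k = 32 * \<eta>" using sq_eq \<kappa> by (simp add: \<kappa>_def mult.assoc)
    moreover have "8 / (\<eta> * s) + 16 / (\<eta> * s) = 24 / (\<eta> * s)" by (simp add: add_divide_distrib[symmetric])
    ultimately show ?thesis by (simp add: b_def)
  qed
  have "lam \<le> \<mu> * s * q / 32" using sq_eq \<eta> \<kappa> by (simp add: \<mu>_def \<kappa>_def mult.assoc)
  then have "opt_error p k lam \<ge> 1 - sqrt (v - 1 + 2 * b)"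
    using k \<alpha> q s_eq lam \<eta> bad V by (intro opt_error_lower_bound[where \<alpha> = \<alpha> and q = q and s = s and \<mu> = \<mu>]) (auto simp: n_def \<mu>_def)
  moreover have "v - 1 + 2 * b = (exp (4 * \<eta>\<^sup>2) - 1 + 2 * exp (- 1 / (14 * \<eta>\<^sup>2)) + 64 * \<eta>) + 48 / (\<eta> * sqrt (p / (1 + ln p)))"
    by (simp add: v_def b_def n_def)
  ultimately show ?thesis by simp
qed

text \<open>
  Put \<open>y = p L / k ^ 3\<close>. On the first branch \<open>(lambda0 k p / k)\<^sup>2\<close> is \<open>ln Y\<close> with \<open>Y = p ln p / k ^ 3 \<ge> 1\<close>, so
  the left side is at most \<open>Y powr (1/8) - 1\<close>, while \<open>y \<ge> Y / 4\<close> because \<open>k ^ 3 \<le> p\<^sup>2\<close> keeps \<open>L\<close> above \<open>ln p / 4\<close>. On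
  the second branch it is \<open>sqrt y\<close>, where \<open>y \<le> 1\<close> because \<open>L \<le> ln p\<close> as soon as \<open>k \<ge> 3 \<ge> exp 1\<close>.
\<close>

lemma signal_small_at_lambda0:
  fixes k p :: nat and c' :: real
  assumes k: "3 \<le> k" "k \<le> p" and c': "0 \<le> c'" "c' \<le> 1 / 8"
  shows "lambda0 k p \<ge> 0"
    and "exp (c' * (lambda0 k p / k)\<^sup>2) - 1 \<le> sqrt (p * ln (exp 1 * p / k) / real k ^ 3)"
proof -
  define n \<kappa> L where "n = real p" and "\<kappa> = real k" and "L = ln (exp 1 * p / k)"
  have \<kappa>: "\<kappa> \<ge> 3" and n: "n \<ge> \<kappa>" using k by (auto simp: n_def \<kappa>_def)
  have L_eq: "L = 1 + ln n - ln \<kappa>"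
    using k unfolding L_def n_def \<kappa>_def by (simp add: ln_mult ln_div)
  have ln\<kappa>: "ln \<kappa> \<ge> 1"
    using exp_le \<kappa> by (subst ln_ge_iff) auto
  have lnn: "ln n \<ge> ln \<kappa>" using \<kappa> n by simp
  have L1: "L \<ge> 1" using lnn by (simp add: L_eq)
  let ?y = "n * L / \<kappa> ^ 3"
  have "lambda0 k p \<ge> 0 \<and> exp (c' * (lambda0 k p / k)\<^sup>2) - 1 \<le> sqrt ?y"
  proof (cases "\<kappa> \<le> (n * ln n) powr (1/3)")
    case True
    have nl: "n * ln n > 0" using \<kappa> n lnn ln\<kappa> by simp
    have "\<kappa> ^ 3 \<le> ((n * ln n) powr (1/3)) ^ 3" using True \<kappa> by (intro power_mono) auto
    also have "\<dots> = n * ln n" using powr_third_cubed[OF nl] by simp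
    finally have k3: "\<kappa> ^ 3 \<le> n * ln n" .
    define Y where "Y = n * ln n / \<kappa> ^ 3"
    have Y1: "Y \<ge> 1" using k3 \<kappa> by (simp add: Y_def)
    have l0: "lambda0 k p = \<kappa> * sqrt (ln Y)"
      using True by (simp add: lambda0_def Y_def n_def \<kappa>_def)
    have "(lambda0 k p / k)\<^sup>2 = ln Y" using Y1 \<kappa> unfolding l0 by (simp add: \<kappa>_def[symmetric])
    moreover have "exp (c' * ln Y) - 1 \<le> sqrt ?y"
    proof -
      define t where "t = exp (ln Y / 8)"
      have t: "t \<ge> 1" using Y1 by (simp add: t_def)
      have "c' * ln Y \<le> 1 / 8 * ln Y" using c' Y1 by (intro mult_right_mono) auto
      then have "exp (c' * ln Y) - 1 \<le> t - 1" by (simp add: t_def)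
      also have "\<dots> \<le> t\<^sup>2 / 4" using zero_le_power2[of "t - 2"] by (simp add: power2_eq_square algebra_simps)
      also have "\<dots> \<le> t ^ 4 / 2"
      proof -
        have "t\<^sup>2 * 1 \<le> t\<^sup>2 * t\<^sup>2" using t by (intro mult_left_mono one_le_power) auto
        then have "t\<^sup>2 \<le> t ^ 4" by (simp add: power_add[symmetric])
        moreover have "0 \<le> t\<^sup>2" by simp
        ultimately show ?thesis by linarith
      qed
      also have "t ^ 4 / 2 = sqrt (Y / 4)"
      proof -
        have "(t ^ 4)\<^sup>2 = Y" using Y1 by (simp add: t_def exp_of_nat_mult[symmetric])
        then have "sqrt Y = t ^ 4" by (rule real_sqrt_unique) (use t in simp)
        then show ?thesis by (simp add: real_sqrt_divide)
      qed
      also have "\<dots> \<le> sqrt ?y"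
      proof (intro real_sqrt_le_mono)
        have "3 * ln \<kappa> = ln (\<kappa> ^ 3)" using \<kappa> by (simp add: ln_realpow)
        also have "\<dots> \<le> ln (n * ln n)" using k3 \<kappa> nl by (subst ln_le_cancel_iff) auto
        also have "\<dots> \<le> ln (n * n)"
        proof -
          have "ln n \<le> n" using ln_bound[of n] \<kappa> n by simp
          then have "n * ln n \<le> n * n" using \<kappa> n by (intro mult_left_mono) auto
          then show ?thesis using nl by simp
        qed
        also have "\<dots> = 2 * ln n" using \<kappa> n by (simp add: ln_mult)
        finally have "ln n / 4 \<le> L" using lnn ln\<kappa> by (simp add: L_eq)
        then have "n * (ln n / 4) / \<kappa> ^ 3 \<le> ?y" using \<kappa> n by (intro divide_right_mono mult_left_mono) auto
        then show "Y / 4 \<le> ?y" by (simp add: Y_def mult.commute)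
      qed
      finally show ?thesis .
    qed
    moreover have "lambda0 k p \<ge> 0" using Y1 \<kappa> by (simp add: l0)
    ultimately show ?thesis by simp
  next
    case False
    have nl: "n * ln n > 0" using \<kappa> n lnn ln\<kappa> by simp
    have "n * ln n = ((n * ln n) powr (1/3)) ^ 3" using powr_third_cubed[OF nl] by simp
    also have "\<dots> \<le> \<kappa> ^ 3" using False by (intro power_mono) auto
    finally have k3: "n * ln n \<le> \<kappa> ^ 3" .
    have "n * L \<le> n * ln n" using \<kappa> n ln\<kappa> by (intro mult_left_mono) (auto simp: L_eq)
    then have y1: "?y \<le> 1" using k3 \<kappa> by simp
    have y0: "?y \<ge> 0" using \<kappa> n L1 by simp
    have l0: "lambda0 k p = (\<kappa> * n * L) powr (1/4)"
      using False by (simp add: lambda0_def L_def n_def \<kappa>_def)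
    have "(lambda0 k p)\<^sup>2 = sqrt (\<kappa> * n * L)"
      using \<kappa> n L1 unfolding l0 by (intro powr_fourth_squared) simp
    then have "(lambda0 k p / k)\<^sup>2 = sqrt (\<kappa> * n * L) / \<kappa>\<^sup>2" by (simp add: power_divide \<kappa>_def)
    also have "\<dots> = sqrt (\<kappa> * n * L / (\<kappa>\<^sup>2)\<^sup>2)"
      by (simp only: real_sqrt_divide real_sqrt_abs abs_of_nonneg[OF zero_le_power2])
    also have "\<kappa> * n * L / (\<kappa>\<^sup>2)\<^sup>2 = ?y" using \<kappa> by (simp add: power2_eq_square power3_eq_cube field_simps)
    finally have eq: "(lambda0 k p / k)\<^sup>2 = sqrt ?y" .
    have sy: "0 \<le> sqrt ?y" "sqrt ?y \<le> 1" using y0 y1 by auto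
    have cs: "0 \<le> c' * sqrt ?y" "c' * sqrt ?y \<le> 1 / 2 * sqrt ?y"
      using c' sy(1) by (intro mult_nonneg_nonneg mult_right_mono; linarith)+
    then have "c' * sqrt ?y \<le> 1" using sy by linarith
    from exp_minus_one_le_double[OF cs(1) this] have "exp (c' * sqrt ?y) - 1 \<le> sqrt ?y" using cs by simp
    then show ?thesis unfolding eq by (simp add: l0)
  qed
  then show "lambda0 k p \<ge> 0" "exp (c' * (lambda0 k p / k)\<^sup>2) - 1 \<le> sqrt (p * ln (exp 1 * p / k) / real k ^ 3)"
    by (auto simp: n_def \<kappa>_def L_def)
qed

text \<open>
  The density parameter is \<open>\<eta> = sqrt c\<close>. It tends to 0 with \<open>c\<close>, as the second moment bound and the thinning require,
  and so does \<open>(32 / \<eta>)\<^sup>2 * c\<^sup>2 = 1024 * c\<close>, the factor in front of \<open>(lambda0 k p / k)\<^sup>2\<close> in the squared entry size.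
\<close>

theorem minimax_lower_bound:
  fixes k p :: nat and c lam :: real
  assumes k: "3 \<le> k" "k \<le> p" and c: "0 < c" "c \<le> 1 / 8192" and lam: "0 \<le> lam" "lam \<le> c * lambda0 k p"
  shows "opt_error p k lam \<ge> (1 - sqrt (exp (4 * c) - 1 + 2 * exp (- 1 / (14 * c)) + 64 * sqrt c))
     - sqrt (48 / (sqrt c * sqrt (p / (1 + ln p))))"
proof -
  let ?\<eta> = "sqrt c"
  note small = signal_small_at_lambda0[OF k, of "1024 * c"]
  have l0: "lambda0 k p \<ge> 0" using small c by simp
  have "(32 * lam / (?\<eta> * k))\<^sup>2 \<le> (32 * (c * lambda0 k p) / (?\<eta> * k))\<^sup>2"
    using lam c by (intro power_mono divide_right_mono) auto
  also have "\<dots> = 1024 * c * (lambda0 k p / k)\<^sup>2"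
    using c by (simp add: power_mult_distrib power_divide) (simp add: power2_eq_square)
  finally have "exp ((32 * lam / (?\<eta> * k))\<^sup>2) \<le> exp (1024 * c * (lambda0 k p / k)\<^sup>2)" by simp
  then have "exp ((32 * lam / (?\<eta> * k))\<^sup>2) - 1 \<le> sqrt (p * ln (exp 1 * p / k) / real k ^ 3)"
    using small(2) c by linarith
  from opt_error_lower_bound_calibrated[OF _ k(2) _ _ lam(1) this]
  have "opt_error p k lam \<ge> 1 - sqrt ((exp (4 * c) - 1 + 2 * exp (- 1 / (14 * c)) + 64 * sqrt c) + 48 / (?\<eta> * sqrt (p / (1 + ln p))))"
    using c k by simp
  moreover have "sqrt ((exp (4 * c) - 1 + 2 * exp (- 1 / (14 * c)) + 64 * sqrt c) + 48 / (?\<eta> * sqrt (p / (1 + ln p))))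
     \<le> sqrt (exp (4 * c) - 1 + 2 * exp (- 1 / (14 * c)) + 64 * sqrt c) + sqrt (48 / (?\<eta> * sqrt (p / (1 + ln p))))"
    using c k by (intro sqrt_add_le_add_sqrt add_nonneg_nonneg) (auto intro!: divide_nonneg_nonneg mult_nonneg_nonneg add_nonneg_nonneg)
  ultimately show ?thesis by linarith
qed

section \<open>Energy and scan statistics\<close>

lemma opt_error_le_test:
  assumes k: "0 < k" and p: "0 < p" and E: "E \<in> sets (mat_borel p)"
    and null: "measure (obs_law p (0\<^sub>m p p)) E \<le> a"
    and alt: "\<And>M. M \<in> Theta p k lam \<Longrightarrow> measure (obs_law p M) (carrier_mat p p - E) \<le> b"
  shows "opt_error p k lam \<le> a + b"
proof -
  define \<phi> where "\<phi> = (\<lambda>X. if X \<in> E then 1 else 0 :: nat)"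
  have \<phi>: "\<phi> \<in> decision_rules p"
    unfolding decision_rules_def \<phi>_def using E sets.Int_space_eq2[OF E] by (intro measurable_If_set) auto
  have EC: "E \<subseteq> carrier_mat p p" using sets.sets_into_space[OF E] by simp
  let ?R = "\<lambda>\<phi>. measure (obs_law p (0\<^sub>m p p)) {X \<in> carrier_mat p p. \<phi> X = 1} +
     (SUP M\<in>Theta p k lam. measure (obs_law p M) {X \<in> carrier_mat p p. \<phi> X = 0})"
  have "?R \<psi> \<ge> 0" for \<psi>
  proof -
    obtain M where M: "M \<in> Theta p k lam" using Theta_nonempty[OF k p] by blast
    have "0 \<le> measure (obs_law p M) {X \<in> carrier_mat p p. \<psi> X = 0}" by simp
    also have "\<dots> \<le> (SUP M\<in>Theta p k lam. measure (obs_law p M) {X \<in> carrier_mat p p. \<psi> X = 0})"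
      by (rule cSUP_upper[OF M obs_measure_bdd])
    finally show ?thesis by simp
  qed
  then have "bdd_below (?R ` decision_rules p)" by (intro bdd_belowI2[of _ 0])
  then have "opt_error p k lam \<le> ?R \<phi>"
    unfolding opt_error_def using \<phi> by (rule cINF_lower)
  also have "\<dots> \<le> a + b"
  proof (rule add_mono)
    have "{X \<in> carrier_mat p p. \<phi> X = 1} = E" using EC by (auto simp: \<phi>_def)
    then show "measure (obs_law p (0\<^sub>m p p)) {X \<in> carrier_mat p p. \<phi> X = 1} \<le> a" using null by simp
    have "{X \<in> carrier_mat p p. \<phi> X = 0} = carrier_mat p p - E" by (auto simp: \<phi>_def)
    then show "(SUP M\<in>Theta p k lam. measure (obs_law p M) {X \<in> carrier_mat p p. \<phi> X = 0}) \<le> b"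
      using alt Theta_nonempty[OF k p] by (intro cSUP_least) auto
  qed
  finally show ?thesis .
qed

definition linear_stat :: "nat \<Rightarrow> (nat \<times> nat \<Rightarrow> real) \<Rightarrow> real mat \<Rightarrow> real" where
  "linear_stat p A X = (\<Sum>e\<in>positions p. A e * X $$ e)"

definition energy_stat :: "nat \<Rightarrow> real mat \<Rightarrow> real" where
  "energy_stat p X = (\<Sum>e\<in>positions p. (X $$ e)\<^sup>2 - 1)"

lemma linear_stat_measurable [measurable]: "linear_stat p A \<in> borel_measurable (mat_borel p)"
  unfolding linear_stat_def[abs_def] by (intro borel_measurable_sum borel_measurable_times entry_measurable) auto

lemma energy_stat_measurable [measurable]: "energy_stat p \<in> borel_measurable (mat_borel p)"
  unfolding energy_stat_def[abs_def]
  by (intro borel_measurable_sum borel_measurable_diff borel_measurable_power entry_measurable) auto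

lemma linear_stat_shift: "linear_stat p A (mat p p (\<lambda>e. M $$ e + z e)) = linear_stat p A M + (\<Sum>e\<in>positions p. A e * z e)"
  unfolding linear_stat_def by (simp add: case_prod_unfold sum.distrib[symmetric] distrib_left[symmetric]) (intro sum.cong refl; auto)

lemma energy_stat_shift: "energy_stat p (mat p p (\<lambda>e. M $$ e + z e))
    = (\<Sum>e\<in>positions p. (M $$ e)\<^sup>2) + (\<Sum>e\<in>positions p. (z e)\<^sup>2 - 1 + 2 * M $$ e * z e)"
  unfolding energy_stat_def sum.distrib[symmetric]
  by (intro sum.cong refl) (auto simp: power2_sum)

lemma obs_law_le:
  assumes M: "M \<in> carrier_mat p p" and E: "E \<in> sets (mat_borel p)"
    and sub: "\<And>z. z \<in> space (gauss_vec (positions p)) \<Longrightarrow> mat p p (\<lambda>e. M $$ e + z e) \<in> E \<Longrightarrow> P z"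
    and meas: "{z \<in> space (gauss_vec (positions p)). P z} \<in> sets (gauss_vec (positions p))"
    and bound: "measure (gauss_vec (positions p)) {z \<in> space (gauss_vec (positions p)). P z} \<le> b"
  shows "measure (obs_law p M) E \<le> b"
proof -
  interpret prob_space "gauss_vec (positions p)" by (rule prob_space_gauss_vec)
  have "measure (obs_law p M) E \<le> measure (gauss_vec (positions p)) {z \<in> space (gauss_vec (positions p)). P z}"
    unfolding obs_law_event(3)[OF M E] using sub by (intro finite_measure_mono meas) auto
  then show ?thesis using bound by simp
qed

lemma linear_stat_null:
  assumes A: "(\<Sum>e\<in>positions p. (A e)\<^sup>2) \<le> 1" and t: "0 \<le> t"
  shows "measure (obs_law p (0\<^sub>m p p)) {X \<in> carrier_mat p p. linear_stat p A X \<ge> t} \<le> exp (- t\<^sup>2 / 2)"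
proof (rule obs_law_le)
  have "{X \<in> space (mat_borel p). linear_stat p A X \<ge> t} \<in> sets (mat_borel p)" by measurable
  then show "{X \<in> carrier_mat p p. linear_stat p A X \<ge> t} \<in> sets (mat_borel p)" by simp
  have z: "linear_stat p A (0\<^sub>m p p) = 0" unfolding linear_stat_def by (intro sum.neutral) auto
  show "(\<Sum>e\<in>positions p. A e * z e) \<ge> t"
    if "mat p p (\<lambda>e. 0\<^sub>m p p $$ e + z e) \<in> {X \<in> carrier_mat p p. linear_stat p A X \<ge> t}" for z
    using that by (simp add: linear_stat_shift z)
  show "measure (gauss_vec (positions p)) {z \<in> space (gauss_vec (positions p)). (\<Sum>e\<in>positions p. A e * z e) \<ge> t} \<le> exp (- t\<^sup>2 / 2)"
    using A t by (intro gauss_vec_linear_tail) auto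
qed (simp, measurable)

lemma linear_stat_alt:
  assumes M: "M \<in> carrier_mat p p" and A: "(\<Sum>e\<in>positions p. (A e)\<^sup>2) \<le> 1" and t: "0 \<le> t"
    and signal: "linear_stat p A M \<ge> 2 * t"
  shows "measure (obs_law p M) {X \<in> carrier_mat p p. linear_stat p A X < t} \<le> exp (- t\<^sup>2 / 2)"
proof (rule obs_law_le[OF M])
  have "{X \<in> space (mat_borel p). linear_stat p A X < t} \<in> sets (mat_borel p)" by measurable
  then show "{X \<in> carrier_mat p p. linear_stat p A X < t} \<in> sets (mat_borel p)" by simp
  show "(\<Sum>e\<in>positions p. (- A e) * z e) \<ge> t"
    if "mat p p (\<lambda>e. M $$ e + z e) \<in> {X \<in> carrier_mat p p. linear_stat p A X < t}" for z
    using that signal by (simp add: linear_stat_shift sum_negf)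
  show "measure (gauss_vec (positions p)) {z \<in> space (gauss_vec (positions p)). (\<Sum>e\<in>positions p. (- A e) * z e) \<ge> t} \<le> exp (- t\<^sup>2 / 2)"
    using A t by (intro gauss_vec_linear_tail) auto
qed measurable

lemma energy_stat_null:
  assumes t: "0 < t"
  shows "measure (obs_law p (0\<^sub>m p p)) {X \<in> carrier_mat p p. energy_stat p X \<ge> t} \<le> 2 * (real p)\<^sup>2 / t\<^sup>2"
proof (rule obs_law_le)
  let ?Q = "\<lambda>z. \<Sum>e\<in>positions p. (z e)\<^sup>2 - 1 + 2 * 0\<^sub>m p p $$ e * z e :: real"
  have "{X \<in> space (mat_borel p). energy_stat p X \<ge> t} \<in> sets (mat_borel p)" by measurable
  then show "{X \<in> carrier_mat p p. energy_stat p X \<ge> t} \<in> sets (mat_borel p)" by simp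
  have z: "(\<Sum>e\<in>positions p. (0\<^sub>m p p $$ e :: real)\<^sup>2) = 0" by (intro sum.neutral) auto
  show "\<bar>?Q z\<bar> \<ge> t"
    if "mat p p (\<lambda>e. 0\<^sub>m p p $$ e + z e) \<in> {X \<in> carrier_mat p p. energy_stat p X \<ge> t}" for z
    using that unfolding mem_Collect_eq energy_stat_shift z by linarith
  have "measure (gauss_vec (positions p)) {z \<in> space (gauss_vec (positions p)). \<bar>?Q z\<bar> \<ge> t}
     \<le> (\<Sum>e\<in>positions p. 2 + 4 * (0\<^sub>m p p $$ e)\<^sup>2) / t\<^sup>2"
    using t by (intro gauss_vec_quadratic_tail) auto
  also have "(\<Sum>e\<in>positions p. 2 + 4 * (0\<^sub>m p p $$ e)\<^sup>2) = 2 * (real p)\<^sup>2"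
    unfolding sum.distrib sum_distrib_left[symmetric] z by (simp add: power2_eq_square)
  finally show "measure (gauss_vec (positions p)) {z \<in> space (gauss_vec (positions p)). \<bar>?Q z\<bar> \<ge> t} \<le> 2 * (real p)\<^sup>2 / t\<^sup>2" .
qed (simp, measurable)

text \<open>
  The signal raises the mean of the statistic to its energy \<open>F\<close>, at least \<open>2 * t\<close>, so a miss is a deviation by at
  least \<open>F / 2\<close>. The variance grows with \<open>F\<close> as well, which gives rise to the term \<open>8 / t\<close>.
\<close>

lemma energy_stat_alt:
  assumes M: "M \<in> carrier_mat p p" and t: "0 < t" and signal: "(\<Sum>e\<in>positions p. (M $$ e)\<^sup>2) \<ge> 2 * t"
  shows "measure (obs_law p M) {X \<in> carrier_mat p p. energy_stat p X < t} \<le> 2 * (real p)\<^sup>2 / t\<^sup>2 + 8 / t"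
proof (rule obs_law_le[OF M])
  define F where "F = (\<Sum>e\<in>positions p. (M $$ e)\<^sup>2)"
  have F: "F \<ge> 2 * t" "F > 0" using signal t by (simp_all add: F_def)
  let ?Q = "\<lambda>z. \<Sum>e\<in>positions p. (z e)\<^sup>2 - 1 + 2 * M $$ e * z e"
  have "{X \<in> space (mat_borel p). energy_stat p X < t} \<in> sets (mat_borel p)" by measurable
  then show "{X \<in> carrier_mat p p. energy_stat p X < t} \<in> sets (mat_borel p)" by simp
  show "\<bar>?Q z\<bar> \<ge> F / 2"
    if "mat p p (\<lambda>e. M $$ e + z e) \<in> {X \<in> carrier_mat p p. energy_stat p X < t}" for z
    using that F unfolding mem_Collect_eq energy_stat_shift F_def[symmetric] by linarith
  have "measure (gauss_vec (positions p)) {z \<in> space (gauss_vec (positions p)). \<bar>?Q z\<bar> \<ge> F / 2}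
     \<le> (\<Sum>e\<in>positions p. 2 + 4 * (M $$ e)\<^sup>2) / (F / 2)\<^sup>2"
    using F by (intro gauss_vec_quadratic_tail) auto
  also have "(\<Sum>e\<in>positions p. 2 + 4 * (M $$ e)\<^sup>2) = 2 * (real p)\<^sup>2 + 4 * F"
    unfolding sum.distrib sum_distrib_left[symmetric] F_def by (simp add: power2_eq_square)
  also have "(2 * (real p)\<^sup>2 + 4 * F) / (F / 2)\<^sup>2 = 2 * (real p)\<^sup>2 / (F / 2)\<^sup>2 + 16 / F"
  proof -
    have "4 * F / (F / 2)\<^sup>2 = 16 / F" using F(2) by (simp add: power2_eq_square)
    then show ?thesis by (simp only: add_divide_distrib)
  qed
  also have "\<dots> \<le> 2 * (real p)\<^sup>2 / t\<^sup>2 + 16 / (2 * t)"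
    using F t by (intro add_mono divide_left_mono power_mono) auto
  finally show "measure (gauss_vec (positions p)) {z \<in> space (gauss_vec (positions p)). \<bar>?Q z\<bar> \<ge> F / 2}
     \<le> 2 * (real p)\<^sup>2 / t\<^sup>2 + 8 / t" by simp
qed measurable

text \<open>
  The test rejects when the energy statistic reaches \<open>c\<^sup>2 * p / 32\<close> or when some form in \<open>\<F>\<close> reaches \<open>u\<close>. Only the
  false alarms need a union bound; a miss is controlled through the one statistic that sees the signal.
\<close>

lemma opt_error_le_energy_or_scan:
  assumes k: "0 < k" and p: "0 < p" and F: "finite \<F>" "\<And>A. A \<in> \<F> \<Longrightarrow> (\<Sum>e\<in>positions p. (A e)\<^sup>2) \<le> 1"
    and c: "0 < c" and u: "0 \<le> u"
    and cover: "\<And>M. M \<in> Theta p k lam \<Longrightarrow>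
      (\<Sum>e\<in>positions p. (M $$ e)\<^sup>2) \<ge> c\<^sup>2 * p / 16 \<or> (\<exists>A\<in>\<F>. linear_stat p A M \<ge> 2 * u)"
  shows "opt_error p k lam \<le> (4096 / c ^ 4 + 256 / c\<^sup>2) + (real (card \<F>) + 1) * exp (- u\<^sup>2 / 2)"
proof -
  define t where "t = c\<^sup>2 * p / 32"
  have t: "t > 0" using c p by (simp add: t_def)
  define EQ where "EQ = {X \<in> carrier_mat p p. energy_stat p X \<ge> t}"
  define EL where "EL = (\<lambda>A. {X \<in> carrier_mat p p. linear_stat p A X \<ge> u})"
  define E where "E = EQ \<union> (\<Union>A\<in>\<F>. EL A)"
  have "{X \<in> space (mat_borel p). energy_stat p X \<ge> t} \<in> sets (mat_borel p)" by measurable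
  then have EQ: "EQ \<in> sets (mat_borel p)" by (simp add: EQ_def)
  have EL: "EL A \<in> sets (mat_borel p)" for A
  proof -
    have "{X \<in> space (mat_borel p). linear_stat p A X \<ge> u} \<in> sets (mat_borel p)" by measurable
    then show ?thesis by (simp add: EL_def)
  qed
  have E: "E \<in> sets (mat_borel p)" unfolding E_def using EQ EL F(1) by (intro sets.Un sets.finite_UN) auto
  have sets_obs: "sets (obs_law p M) = sets (mat_borel p)" for M by (simp add: obs_law_def)
  have b0: "0 \<le> 2 * (real p)\<^sup>2 / t\<^sup>2 + 8 / t" "0 \<le> exp (- u\<^sup>2 / 2)" using t by auto
  have "opt_error p k lam \<le> (2 * (real p)\<^sup>2 / t\<^sup>2 + real (card \<F>) * exp (- u\<^sup>2 / 2))
      + (2 * (real p)\<^sup>2 / t\<^sup>2 + 8 / t + exp (- u\<^sup>2 / 2))"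
  proof (rule opt_error_le_test[OF k p E])
    let ?N = "obs_law p (0\<^sub>m p p)"
    interpret N: prob_space ?N by (rule prob_space_obs_law) simp
    have "measure ?N E \<le> measure ?N EQ + measure ?N (\<Union>A\<in>\<F>. EL A)"
      unfolding E_def using EQ EL F(1) by (intro measure_Un_le) (auto simp: sets_obs intro!: sets.finite_UN)
    also have "measure ?N (\<Union>A\<in>\<F>. EL A) \<le> (\<Sum>A\<in>\<F>. measure ?N (EL A))"
      using EL F(1) by (intro measure_UNION_le) (auto simp: sets_obs)
    also have "\<dots> \<le> (\<Sum>A\<in>\<F>. exp (- u\<^sup>2 / 2))"
      unfolding EL_def using F(2) u by (intro sum_mono linear_stat_null) auto
    also have "measure ?N EQ \<le> 2 * (real p)\<^sup>2 / t\<^sup>2" unfolding EQ_def by (rule energy_stat_null[OF t])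
    finally show "measure ?N E \<le> 2 * (real p)\<^sup>2 / t\<^sup>2 + real (card \<F>) * exp (- u\<^sup>2 / 2)" by simp
  next
    fix M assume M: "M \<in> Theta p k lam"
    have MC: "M \<in> carrier_mat p p" by (rule Theta_carrier[OF M])
    interpret N: prob_space "obs_law p M" by (rule prob_space_obs_law[OF MC])
    have mono: "measure (obs_law p M) (carrier_mat p p - E) \<le> measure (obs_law p M) (carrier_mat p p - B)"
      if "B \<subseteq> E" "B \<in> sets (mat_borel p)" for B
      using that sets.compl_sets[OF that(2)] by (intro N.finite_measure_mono) (auto simp: sets_obs)
    from cover[OF M] show "measure (obs_law p M) (carrier_mat p p - E) \<le> 2 * (real p)\<^sup>2 / t\<^sup>2 + 8 / t + exp (- u\<^sup>2 / 2)"
    proof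
      assume "(\<Sum>e\<in>positions p. (M $$ e)\<^sup>2) \<ge> c\<^sup>2 * p / 16"
      then have big: "(\<Sum>e\<in>positions p. (M $$ e)\<^sup>2) \<ge> 2 * t" by (simp add: t_def mult.commute)
      have "carrier_mat p p - EQ = {X \<in> carrier_mat p p. energy_stat p X < t}" by (auto simp: EQ_def)
      then have "measure (obs_law p M) (carrier_mat p p - E) \<le> 2 * (real p)\<^sup>2 / t\<^sup>2 + 8 / t"
        using mono[of EQ] EQ energy_stat_alt[OF MC t big] by (simp add: E_def)
      then show ?thesis using b0 by linarith
    next
      assume "\<exists>A\<in>\<F>. linear_stat p A M \<ge> 2 * u"
      then obtain A where A: "A \<in> \<F>" "linear_stat p A M \<ge> 2 * u" by blast
      have "carrier_mat p p - EL A = {X \<in> carrier_mat p p. linear_stat p A X < u}" by (auto simp: EL_def)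
      moreover have "EL A \<subseteq> E" using A(1) by (auto simp: E_def)
      ultimately have "measure (obs_law p M) (carrier_mat p p - E) \<le> exp (- u\<^sup>2 / 2)"
        using mono[of "EL A"] EL linear_stat_alt[OF MC F(2)[OF A(1)] u A(2)] by simp
      then show ?thesis using b0 by linarith
    qed
  qed
  then have "opt_error p k lam \<le> (4 * (real p)\<^sup>2 / t\<^sup>2 + 8 / t) + (real (card \<F>) + 1) * exp (- u\<^sup>2 / 2)"
    by (simp add: algebra_simps)
  moreover have "4 * (real p)\<^sup>2 / t\<^sup>2 = 4096 / c ^ 4"
    using p c by (simp add: t_def power_mult_distrib power_divide field_simps)
  moreover have "8 / t \<le> 256 / c\<^sup>2"
  proof -
    have "c\<^sup>2 * 1 \<le> c\<^sup>2 * real p" using p by (intro mult_left_mono) auto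
    then have "256 / (c\<^sup>2 * real p) \<le> 256 / c\<^sup>2" using c p by (intro divide_left_mono) auto
    then show ?thesis by (simp add: t_def)
  qed
  ultimately show ?thesis by linarith
qed

text \<open>
  The Schur test: \<open>\<bar>u i * v j\<bar>\<close> is at most the mean of \<open>(u i)\<^sup>2\<close> and \<open>(v j)\<^sup>2\<close>, and every square occurs for at most \<open>k\<close>
  nonzero entries.
\<close>

lemma sparse_bilinear_le_max_entry:
  assumes M: "M \<in> sparse_mats p k"
    and b: "\<And>i j. i < p \<Longrightarrow> j < p \<Longrightarrow> \<bar>M $$ (i,j)\<bar> \<le> b" "0 \<le> b"
    and u: "(\<Sum>i<p. (u i)\<^sup>2) = 1" and v: "(\<Sum>j<p. (v j)\<^sup>2) = 1"
  shows "(\<Sum>i<p. \<Sum>j<p. M $$ (i,j) * u i * v j) \<le> k * b"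
proof -
  let ?o = "\<lambda>i j. of_bool (M $$ (i,j) \<noteq> 0) :: real"
  have rows: "(\<Sum>j<p. ?o i j) \<le> k" and cols: "(\<Sum>l<p. ?o l i) \<le> k" if "i < p" for i
  proof -
    have "(\<Sum>j<p. ?o i j) = real (card {j. j < p \<and> M $$ (i,j) \<noteq> 0})"
      "(\<Sum>l<p. ?o l i) = real (card {l. l < p \<and> M $$ (l,i) \<noteq> 0})"
      by (simp_all add: of_bool_def sum.If_cases lessThan_def Int_def conj_commute)
    then show "(\<Sum>j<p. ?o i j) \<le> k" "(\<Sum>l<p. ?o l i) \<le> k"
      using M that unfolding sparse_mats_def by auto
  qed
  have "M $$ (i,j) * u i * v j \<le> b / 2 * ((u i)\<^sup>2 * ?o i j) + b / 2 * ((v j)\<^sup>2 * ?o i j)" if "i < p" "j < p" for i j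
  proof (cases "M $$ (i,j) = 0")
    case False
    have "M $$ (i,j) * (u i * v j) \<le> \<bar>M $$ (i,j)\<bar> * \<bar>u i * v j\<bar>" by (simp add: abs_mult[symmetric])
    also have "\<dots> \<le> b * \<bar>u i * v j\<bar>" using b(1)[OF that] by (intro mult_right_mono) auto
    also have "\<dots> \<le> b * (((u i)\<^sup>2 + (v j)\<^sup>2) / 2)"
    proof (intro mult_left_mono b(2))
      have "0 \<le> (\<bar>u i\<bar> - \<bar>v j\<bar>)\<^sup>2" by simp
      then show "\<bar>u i * v j\<bar> \<le> ((u i)\<^sup>2 + (v j)\<^sup>2) / 2" by (simp add: power2_diff abs_mult)
    qed
    finally show ?thesis using False by (simp add: algebra_simps)
  qed simp
  then have "(\<Sum>i<p. \<Sum>j<p. M $$ (i,j) * u i * v j)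
      \<le> (\<Sum>i<p. \<Sum>j<p. b / 2 * ((u i)\<^sup>2 * ?o i j) + b / 2 * ((v j)\<^sup>2 * ?o i j))"
    by (intro sum_mono) auto
  also have "\<dots> = b / 2 * (\<Sum>i<p. (u i)\<^sup>2 * (\<Sum>j<p. ?o i j)) + b / 2 * (\<Sum>i<p. \<Sum>j<p. (v j)\<^sup>2 * ?o i j)"
    by (simp only: sum.distrib sum_distrib_left)
  also have "(\<Sum>i<p. \<Sum>j<p. (v j)\<^sup>2 * ?o i j) = (\<Sum>j<p. (v j)\<^sup>2 * (\<Sum>i<p. ?o i j))"
    by (subst sum.swap) (simp only: sum_distrib_left)
  also have "b / 2 * (\<Sum>i<p. (u i)\<^sup>2 * (\<Sum>j<p. ?o i j)) + b / 2 * (\<Sum>j<p. (v j)\<^sup>2 * (\<Sum>i<p. ?o i j))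
     \<le> b / 2 * (\<Sum>i<p. (u i)\<^sup>2 * k) + b / 2 * (\<Sum>j<p. (v j)\<^sup>2 * k)"
    using b(2) rows cols by (intro add_mono mult_left_mono sum_mono) auto
  also have "\<dots> = k * b" unfolding sum_distrib_right[symmetric] u v by simp
  finally show ?thesis .
qed

lemma Theta_singular_vectors:
  assumes M: "M \<in> Theta p k lam" and p: "0 < p" and lam: "0 < lam"
  obtains u v where "(\<Sum>i<p. (u i)\<^sup>2) = 1" "(\<Sum>j<p. (v j)\<^sup>2) = 1"
    "(\<Sum>i<p. \<Sum>j<p. M $$ (i,j) * u i * v j) \<ge> lam"
proof -
  have "spectral_norm M \<ge> lam" using M by (simp add: Theta_def)
  then have "spectral_norm M > 0" using lam by simp
  then obtain u v where "(\<Sum>i<p. (u i)\<^sup>2) = 1" "(\<Sum>j<p. (v j)\<^sup>2) = 1"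
    "(\<Sum>i<p. \<Sum>j<p. M $$ (i,j) * u i * v j) = spectral_norm M"
    by (rule spectral_norm_singular_vectors[OF Theta_carrier[OF M] p])
  then show ?thesis using \<open>spectral_norm M \<ge> lam\<close> by (intro that[of u v]) auto
qed

lemma Theta_large_entry:
  assumes M: "M \<in> Theta p k lam" and p: "0 < p" and k: "0 < k" and lam: "0 < lam"
  obtains e where "e \<in> positions p" "\<bar>M $$ e\<bar> \<ge> lam / k"
proof -
  obtain u v where uv: "(\<Sum>i<p. (u i)\<^sup>2) = 1" "(\<Sum>j<p. (v j)\<^sup>2) = 1"
    "(\<Sum>i<p. \<Sum>j<p. M $$ (i,j) * u i * v j) \<ge> lam"
    by (rule Theta_singular_vectors[OF M p lam])
  define b where "b = Max ((\<lambda>e. \<bar>M $$ e\<bar>) ` positions p)"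
  have ne: "positions p \<noteq> {}" using p by auto
  have "b \<in> (\<lambda>e. \<bar>M $$ e\<bar>) ` positions p" unfolding b_def using ne by (intro Max_in) auto
  then obtain e where e: "e \<in> positions p" "b = \<bar>M $$ e\<bar>" by blast
  have "\<bar>M $$ (i,j)\<bar> \<le> b" if "i < p" "j < p" for i j
    unfolding b_def using that by (intro Max_ge) auto
  from sparse_bilinear_le_max_entry[OF _ this _ uv(1,2)] have "lam \<le> k * b"
    using M uv(3) e by (force simp: Theta_def)
  then have "\<bar>M $$ e\<bar> \<ge> lam / k" using k e by (simp add: field_simps)
  with e(1) show ?thesis by (rule that)
qed

text \<open>
  Some entry has absolute value at least \<open>lam / k \<ge> c * sqrt (ln p)\<close>, and there are only \<open>2 * p\<^sup>2\<close> signed entries to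
  scan.
\<close>

lemma entrywise_test:
  assumes k: "0 < k" and p: "2 \<le> p" and c: "4 \<le> c" and lam: "lam \<ge> c * (k * sqrt (ln p))"
  shows "opt_error p k lam \<le> (4096 / c ^ 4 + 256 / c\<^sup>2) + 3 * exp (1 - c\<^sup>2 / 16)"
proof -
  define A where "A = (\<lambda>(e :: nat \<times> nat, b) e'. if e' = e then (if b then 1 else -1) else 0 :: real)"
  define \<F> where "\<F> = A ` (positions p \<times> UNIV)"
  define u where "u = c / 2 * sqrt (ln p)"
  have ln2: "ln (real p) \<ge> 1 / 2"
  proof -
    have "1 \<le> ln ((2::real)\<^sup>2)" using exp_le by (subst ln_ge_iff) auto
    then have "1 / 2 \<le> ln (2::real)" unfolding ln_realpow by simp
    also have "\<dots> \<le> ln p" using p by simp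
    finally show ?thesis .
  qed
  have c0: "0 < c" using c by simp
  have u0: "u > 0" using c ln2 by (simp add: u_def)
  have lam0: "lam > 0"
  proof -
    have "0 < c * (k * sqrt (ln p))" using c k ln2 by simp
    then show ?thesis using lam by simp
  qed
  have finF: "finite \<F>" unfolding \<F>_def by simp
  have "card \<F> \<le> card (positions p \<times> (UNIV :: bool set))" unfolding \<F>_def by (rule card_image_le) simp
  then have "real (card \<F>) \<le> real (card (positions p \<times> (UNIV :: bool set)))" by (simp only: of_nat_le_iff)
  then have cardF: "real (card \<F>) \<le> 2 * (real p)\<^sup>2" by (simp add: card_cartesian_product power2_eq_square)
  have "opt_error p k lam \<le> (4096 / c ^ 4 + 256 / c\<^sup>2) + (real (card \<F>) + 1) * exp (- u\<^sup>2 / 2)"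
  proof (rule opt_error_le_energy_or_scan[OF k _ finF _ c0 less_imp_le[OF u0]])
    fix B assume "B \<in> \<F>"
    then obtain e b where B: "B = A (e, b)" "e \<in> positions p" unfolding \<F>_def by auto
    have "(\<Sum>e'\<in>positions p. (B e')\<^sup>2) = (\<Sum>e'\<in>positions p. if e' = e then 1 else 0)"
      by (intro sum.cong) (auto simp: B A_def)
    then show "(\<Sum>e'\<in>positions p. (B e')\<^sup>2) \<le> 1" using B by simp
  next
    fix M assume M: "M \<in> Theta p k lam"
    obtain e where e: "e \<in> positions p" "\<bar>M $$ e\<bar> \<ge> lam / k"
      using Theta_large_entry[OF M _ k lam0] p by auto
    have "lam / k \<ge> 2 * u" using lam k by (simp add: u_def field_simps)
    moreover have "linear_stat p (A (e, M $$ e \<ge> 0)) M = \<bar>M $$ e\<bar>"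
    proof -
      have "linear_stat p (A (e, M $$ e \<ge> 0)) M = (\<Sum>e'\<in>positions p. if e' = e then \<bar>M $$ e\<bar> else 0)"
        unfolding linear_stat_def A_def by (intro sum.cong) auto
      then show ?thesis using e by simp
    qed
    ultimately have "\<exists>B\<in>\<F>. linear_stat p B M \<ge> 2 * u"
      using e unfolding \<F>_def by (intro bexI[of _ "A (e, M $$ e \<ge> 0)"]) auto
    then show "(\<Sum>e\<in>positions p. (M $$ e)\<^sup>2) \<ge> c\<^sup>2 * p / 16 \<or> (\<exists>B\<in>\<F>. linear_stat p B M \<ge> 2 * u)" ..
  qed (use p in simp)
  moreover have "(real (card \<F>) + 1) * exp (- u\<^sup>2 / 2) \<le> 3 * exp (1 - c\<^sup>2 / 16)"
  proof -
    have "u\<^sup>2 = c\<^sup>2 / 4 * ln p" using ln2 by (simp add: u_def power_mult_distrib power_divide)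
    then have "2 * ln p - u\<^sup>2 / 2 = - ((c\<^sup>2 / 8 - 2) * ln p)" by (simp add: algebra_simps)
    moreover have "(c\<^sup>2 / 8 - 2) * (1 / 2) \<le> (c\<^sup>2 / 8 - 2) * ln p"
    proof (intro mult_left_mono ln2)
      have "4\<^sup>2 \<le> c\<^sup>2" using c by (intro power_mono) auto
      then show "0 \<le> c\<^sup>2 / 8 - 2" by simp
    qed
    ultimately have exponent: "2 * ln p - u\<^sup>2 / 2 \<le> 1 - c\<^sup>2 / 16" by simp
    have p1: "1 \<le> (real p)\<^sup>2" using p by (simp add: one_le_power)
    have "(real (card \<F>) + 1) * exp (- u\<^sup>2 / 2) \<le> (3 * (real p)\<^sup>2) * exp (- u\<^sup>2 / 2)"
      using cardF p1 by (intro mult_right_mono) auto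
    also have "(real p)\<^sup>2 = exp (2 * ln p)" using p by (simp add: exp_double power2_eq_square)
    also have "3 * exp (2 * ln (real p)) * exp (- u\<^sup>2 / 2) = 3 * exp (2 * ln p - u\<^sup>2 / 2)"
      by (simp add: mult_exp_exp)
    also have "\<dots> \<le> 3 * exp (1 - c\<^sup>2 / 16)" using exponent by simp
    finally show ?thesis .
  qed
  ultimately show ?thesis by linarith
qed

text \<open>
  In each row at most \<open>k\<close> of the perturbations \<open>d j\<close> meet a nonzero entry, so Cauchy's inequality costs a factor
  \<open>k * \<tau>\<^sup>2\<close> instead of the squared length of \<open>d\<close>, which can be as large as \<open>p * \<tau>\<^sup>2\<close>.
\<close>

lemma sparse_bilinear_perturbation:
  fixes A :: "nat \<Rightarrow> nat \<Rightarrow> real" and u d :: "nat \<Rightarrow> real" and p k :: nat and \<tau> :: real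
  assumes sparse: "\<And>i. i < p \<Longrightarrow> card {j. j < p \<and> A i j \<noteq> 0} \<le> k"
    and d: "\<And>j. j < p \<Longrightarrow> \<bar>d j\<bar> \<le> \<tau>" and u: "(\<Sum>i<p. (u i)\<^sup>2) \<le> 1"
  shows "\<bar>\<Sum>i<p. \<Sum>j<p. A i j * u i * d j\<bar> \<le> sqrt ((\<Sum>i<p. \<Sum>j<p. (A i j)\<^sup>2) * (k * \<tau>\<^sup>2) :: real)"
proof -
  have row: "(\<Sum>j<p. A i j * d j)\<^sup>2 \<le> (\<Sum>j<p. (A i j)\<^sup>2) * (k * \<tau>\<^sup>2)" if i: "i < p" for i
  proof -
    let ?S = "{j. j < p \<and> A i j \<noteq> 0}"
    have S: "?S \<subseteq> {..<p}" by auto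
    then have "finite ?S" by (rule finite_subset) simp
    have "(\<Sum>j<p. A i j * d j) = (\<Sum>j\<in>?S. A i j * d j)" using S by (intro sum.mono_neutral_right) auto
    then have "(\<Sum>j<p. A i j * d j)\<^sup>2 \<le> (\<Sum>j\<in>?S. (A i j)\<^sup>2) * (\<Sum>j\<in>?S. (d j)\<^sup>2)"
      using Cauchy_Schwarz_ineq_sum by simp
    also have "\<dots> \<le> (\<Sum>j<p. (A i j)\<^sup>2) * (k * \<tau>\<^sup>2)"
    proof (intro mult_mono sum_nonneg)
      show "(\<Sum>j\<in>?S. (A i j)\<^sup>2) \<le> (\<Sum>j<p. (A i j)\<^sup>2)" using S by (intro sum_mono2) auto
      have "(\<Sum>j\<in>?S. (d j)\<^sup>2) \<le> (\<Sum>j\<in>?S. \<tau>\<^sup>2)"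
        using d by (intro sum_mono) (auto simp: abs_le_square_iff[symmetric] intro: order_trans[OF _ abs_ge_self])
      also have "\<dots> \<le> k * \<tau>\<^sup>2" using sparse[OF i] by (simp add: mult_right_mono)
      finally show "(\<Sum>j\<in>?S. (d j)\<^sup>2) \<le> k * \<tau>\<^sup>2" .
    qed auto
    finally show ?thesis .
  qed
  have "(\<Sum>i<p. \<Sum>j<p. A i j * u i * d j) = (\<Sum>i<p. u i * (\<Sum>j<p. A i j * d j))"
    by (simp add: sum_distrib_left mult_ac)
  then have "(\<Sum>i<p. \<Sum>j<p. A i j * u i * d j)\<^sup>2 \<le> (\<Sum>i<p. (u i)\<^sup>2) * (\<Sum>i<p. (\<Sum>j<p. A i j * d j)\<^sup>2)"
    using Cauchy_Schwarz_ineq_sum by simp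
  also have "\<dots> \<le> 1 * (\<Sum>i<p. (\<Sum>j<p. (A i j)\<^sup>2) * (k * \<tau>\<^sup>2))"
    using u row by (intro mult_mono sum_mono) (auto intro!: sum_nonneg)
  also have "\<dots> = (\<Sum>i<p. \<Sum>j<p. (A i j)\<^sup>2) * (k * \<tau>\<^sup>2)" by (simp add: sum_distrib_right)
  finally show ?thesis by (intro real_le_rsqrt) simp
qed

section \<open>Scanning a grid of vectors\<close>

text \<open>
  The explicit range of the coordinates follows from the bound on the squares; it makes the set
  visibly finite.
\<close>

definition grid_vectors :: "nat \<Rightarrow> real \<Rightarrow> (nat \<Rightarrow> int) set" where
  "grid_vectors p s = {w \<in> PiE {..<p} (\<lambda>_. {- \<lfloor>s\<rfloor>..\<lfloor>s\<rfloor>}). (\<Sum>j<p. (real_of_int (w j))\<^sup>2) \<le> s}"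

lemma finite_grid_vectors: "finite (grid_vectors p s)"
  unfolding grid_vectors_def by (intro finite_subset[OF _ finite_PiE[of "{..<p}" "\<lambda>_. {- \<lfloor>s\<rfloor>..\<lfloor>s\<rfloor>}"]]) auto

lemma two_sided_geometric_le:
  fixes q :: real
  assumes "0 \<le> q" "q \<le> 1 / 2"
  shows "(\<Sum>a\<in>{- int n..int n}. q ^ nat \<bar>a\<bar>) \<le> 1 + 4 * q - 4 * q ^ Suc n"
proof (induction n)
  case (Suc n)
  have "{- int (Suc n)..int (Suc n)} = insert (- int (Suc n)) (insert (int (Suc n)) {- int n..int n})" by auto
  then have "(\<Sum>a\<in>{- int (Suc n)..int (Suc n)}. q ^ nat \<bar>a\<bar>) = 2 * q ^ Suc n + (\<Sum>a\<in>{- int n..int n}. q ^ nat \<bar>a\<bar>)"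
    by (simp add: nat_add_distrib)
  also have "\<dots> \<le> 1 + 4 * q - 2 * q ^ Suc n" using Suc by simp
  also have "4 * q ^ Suc (Suc n) \<le> 2 * q ^ Suc n"
    using assms mult_right_mono[of q "1/2" "q ^ Suc n"] by simp
  then have "1 + 4 * q - 2 * q ^ Suc n \<le> 1 + 4 * q - 4 * q ^ Suc (Suc n)" by linarith
  finally show ?case .
qed simp

text \<open>
  The absolute values of the coordinates of a grid vector add up to at most \<open>s\<close>, as \<open>\<bar>a\<bar> \<le> a\<^sup>2\<close> for
  integers. Weighting every integer vector by \<open>q\<close> to the power of this sum turns the count into a
  product over the coordinates, and \<open>q = s / (2 * p)\<close> is nearly the best choice.
\<close>

lemma card_grid_vectors_le:
  assumes s: "0 < s" "s \<le> real p"
  shows "real (card (grid_vectors p s)) \<le> exp (s * ln (2 * p / s) + 2 * s)"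
proof -
  define q where "q = s / (2 * p)"
  have p: "real p > 0" using s by linarith
  have q: "0 < q" "q \<le> 1 / 2" using s p by (auto simp: q_def field_simps)
  have fl: "\<lfloor>s\<rfloor> = int (nat \<lfloor>s\<rfloor>)" using s by simp
  have one: "1 \<le> q powr (- s) * (\<Prod>j<p. q ^ nat \<bar>w j\<bar>)" if "w \<in> grid_vectors p s" for w
  proof -
    have "(\<Sum>j<p. real (nat \<bar>w j\<bar>)) \<le> (\<Sum>j<p. (real_of_int (w j))\<^sup>2)"
    proof (intro sum_mono)
      fix j
      have "\<bar>w j\<bar> \<le> \<bar>w j\<bar> * \<bar>w j\<bar>" using mult_left_mono[of 1 "\<bar>w j\<bar>" "\<bar>w j\<bar>"] by (cases "w j = 0") auto
      then have "real_of_int \<bar>w j\<bar> \<le> real_of_int (\<bar>w j\<bar> * \<bar>w j\<bar>)" by (simp only: of_int_le_iff)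
      then show "real (nat \<bar>w j\<bar>) \<le> (real_of_int (w j))\<^sup>2" by (simp add: power2_eq_square)
    qed
    also have "\<dots> \<le> s" using that by (simp add: grid_vectors_def)
    finally have le: "real (\<Sum>j<p. nat \<bar>w j\<bar>) \<le> s" by simp
    have "(\<Prod>j<p. q ^ nat \<bar>w j\<bar>) = q ^ (\<Sum>j<p. nat \<bar>w j\<bar>)" by (simp add: power_sum)
    also have "\<dots> = q powr (real (\<Sum>j<p. nat \<bar>w j\<bar>))" using q by (simp only: powr_realpow)
    also have "\<dots> \<ge> q powr s" using q le by (intro powr_mono') auto
    finally have "q powr (- s) * q powr s \<le> q powr (- s) * (\<Prod>j<p. q ^ nat \<bar>w j\<bar>)"
      using q by (intro mult_left_mono) auto
    then show ?thesis using q by (simp add: powr_add[symmetric])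
  qed
  have "real (card (grid_vectors p s)) = (\<Sum>w\<in>grid_vectors p s. 1)" by simp
  also have "\<dots> \<le> (\<Sum>w\<in>grid_vectors p s. q powr (- s) * (\<Prod>j<p. q ^ nat \<bar>w j\<bar>))"
    using one by (intro sum_mono) auto
  also have "\<dots> \<le> (\<Sum>w\<in>PiE {..<p} (\<lambda>_. {- \<lfloor>s\<rfloor>..\<lfloor>s\<rfloor>}). q powr (- s) * (\<Prod>j<p. q ^ nat \<bar>w j\<bar>))"
  proof (rule sum_mono2)
    show "finite (PiE {..<p} (\<lambda>_. {- \<lfloor>s\<rfloor>..\<lfloor>s\<rfloor>}))" by (intro finite_PiE) auto
    show "grid_vectors p s \<subseteq> PiE {..<p} (\<lambda>_. {- \<lfloor>s\<rfloor>..\<lfloor>s\<rfloor>})" unfolding grid_vectors_def by blast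
    show "0 \<le> q powr (- s) * (\<Prod>j<p. q ^ nat \<bar>w j\<bar>)" for w
      using q by (intro mult_nonneg_nonneg prod_nonneg) auto
  qed
  also have "\<dots> = q powr (- s) * (\<Prod>j<p. \<Sum>a\<in>{- \<lfloor>s\<rfloor>..\<lfloor>s\<rfloor>}. q ^ nat \<bar>a\<bar>)"
    by (subst prod_sum_PiE) (simp_all add: sum_distrib_left)
  also have "\<dots> \<le> q powr (- s) * (\<Prod>j<p. exp (4 * q))"
  proof (intro mult_left_mono prod_mono conjI sum_nonneg)
    have "(\<Sum>a\<in>{- \<lfloor>s\<rfloor>..\<lfloor>s\<rfloor>}. q ^ nat \<bar>a\<bar>) \<le> 1 + 4 * q - 4 * q ^ Suc (nat \<lfloor>s\<rfloor>)"
      using two_sided_geometric_le[of q "nat \<lfloor>s\<rfloor>"] q s by simp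
    also have "\<dots> \<le> 1 + 4 * q" using q by simp
    also have "\<dots> \<le> exp (4 * q)" by (rule exp_ge_add_one_self)
    finally show "(\<Sum>a\<in>{- \<lfloor>s\<rfloor>..\<lfloor>s\<rfloor>}. q ^ nat \<bar>a\<bar>) \<le> exp (4 * q)" .
  qed (use q in auto)
  also have "(\<Prod>j<p. exp (4 * q)) = exp (2 * s)"
    using p by (simp add: exp_of_nat_mult[symmetric] q_def)
  also have "q powr (- s) = exp (s * ln (2 * p / s))"
    using q s p by (simp add: powr_def q_def ln_div algebra_simps)
  finally show ?thesis by (simp add: exp_add)
qed

text \<open>
  Rounding is towards zero, so that it does not increase the length of a vector.
\<close>

definition truncate_to :: "real \<Rightarrow> real \<Rightarrow> int" where
  "truncate_to \<tau> x = (if x \<ge> 0 then \<lfloor>x / \<tau>\<rfloor> else - \<lfloor>- x / \<tau>\<rfloor>)"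

lemma truncate_to_bounds:
  assumes \<tau>: "\<tau> > 0"
  shows "\<bar>\<tau> * truncate_to \<tau> x\<bar> \<le> \<bar>x\<bar>" and "\<bar>x - \<tau> * truncate_to \<tau> x\<bar> \<le> \<tau>"
proof -
  have *: "0 \<le> \<tau> * real_of_int \<lfloor>y / \<tau>\<rfloor> \<and> \<tau> * real_of_int \<lfloor>y / \<tau>\<rfloor> \<le> y
      \<and> y - \<tau> * real_of_int \<lfloor>y / \<tau>\<rfloor> \<le> \<tau>"
    if "y \<ge> 0" for y
  proof -
    have "0 \<le> y / \<tau>" using that \<tau> by simp
    then have a: "0 \<le> real_of_int \<lfloor>y / \<tau>\<rfloor>" "real_of_int \<lfloor>y / \<tau>\<rfloor> \<le> y / \<tau>" "y / \<tau> \<le> real_of_int \<lfloor>y / \<tau>\<rfloor> + 1"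
      by (simp_all del: divide_nonneg_pos)
    have "\<tau> * real_of_int \<lfloor>y / \<tau>\<rfloor> \<le> \<tau> * (y / \<tau>)" "\<tau> * (y / \<tau>) \<le> \<tau> * (real_of_int \<lfloor>y / \<tau>\<rfloor> + 1)"
      using a \<tau> by (intro mult_left_mono; simp)+
    then show ?thesis using a \<tau> by (simp add: algebra_simps)
  qed
  show "\<bar>\<tau> * truncate_to \<tau> x\<bar> \<le> \<bar>x\<bar>" "\<bar>x - \<tau> * truncate_to \<tau> x\<bar> \<le> \<tau>"
    using *[of x] *[of "- x"] by (auto simp: truncate_to_def abs_le_iff)
qed

lemma grid_approximation:
  assumes s: "0 < s" and v: "(\<Sum>j<p. (v j)\<^sup>2) \<le> 1"
  obtains w where "w \<in> grid_vectors p s" "(\<Sum>j<p. (real_of_int (w j) / sqrt s)\<^sup>2) \<le> 1"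
    "\<And>j. j < p \<Longrightarrow> \<bar>v j - real_of_int (w j) / sqrt s\<bar> \<le> 1 / sqrt s"
proof -
  define \<tau> where "\<tau> = 1 / sqrt s"
  have \<tau>: "\<tau> > 0" using s by (simp add: \<tau>_def)
  define w where "w = (\<lambda>j\<in>{..<p}. truncate_to \<tau> (v j))"
  have w\<tau>: "real_of_int (w j) / sqrt s = \<tau> * truncate_to \<tau> (v j)" if "j < p" for j
    using that by (simp add: w_def \<tau>_def)
  have "(\<Sum>j<p. (real_of_int (w j) / sqrt s)\<^sup>2) \<le> (\<Sum>j<p. (v j)\<^sup>2)"
    using truncate_to_bounds(1)[OF \<tau>] by (intro sum_mono) (simp add: w\<tau> abs_le_square_iff)
  with v have n1: "(\<Sum>j<p. (real_of_int (w j) / sqrt s)\<^sup>2) \<le> 1" by simp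
  then have n2: "(\<Sum>j<p. (real_of_int (w j))\<^sup>2) \<le> s"
    using s by (simp add: power_divide sum_divide_distrib[symmetric])
  have "w j \<in> {- \<lfloor>s\<rfloor>..\<lfloor>s\<rfloor>}" if "j < p" for j
  proof -
    have "(real_of_int (w j))\<^sup>2 \<le> (\<Sum>j<p. (real_of_int (w j))\<^sup>2)" using that by (intro member_le_sum) auto
    then have "(real_of_int (w j))\<^sup>2 \<le> s" using n2 by linarith
    moreover have "\<bar>w j\<bar> \<le> (w j)\<^sup>2"
      using mult_left_mono[of 1 "\<bar>w j\<bar>" "\<bar>w j\<bar>"] by (cases "w j = 0") (auto simp: power2_eq_square)
    then have "real_of_int \<bar>w j\<bar> \<le> (real_of_int (w j))\<^sup>2" by (metis of_int_le_iff of_int_power)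
    ultimately have "real_of_int \<bar>w j\<bar> \<le> s" by linarith
    then have "\<bar>w j\<bar> \<le> \<lfloor>s\<rfloor>" by (simp only: le_floor_iff)
    then show ?thesis by (auto simp: abs_le_iff)
  qed
  then have "w \<in> grid_vectors p s" using n2 by (auto simp: grid_vectors_def w_def)
  moreover have "\<bar>v j - real_of_int (w j) / sqrt s\<bar> \<le> 1 / sqrt s" if "j < p" for j
    using truncate_to_bounds(2)[OF \<tau>, of "v j"] by (simp add: w\<tau>[OF that] \<tau>_def)
  ultimately show ?thesis using n1 by (intro that[of w])
qed

text \<open>
  The singular vectors are rounded to the grid of mesh \<open>1 / sqrt s\<close> with \<open>s = sqrt (k p / L)\<close>. With \<open>l = lambda1 k p\<close> on this
  range, \<open>k p / s\<close> and \<open>s L\<close> both equal \<open>l\<^sup>2\<close>. The first identity bounds the loss of the rounding by a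
  small multiple of \<open>c * l\<close> unless the energy exceeds \<open>c\<^sup>2 * p / 16\<close>, and the second one bounds the
  number of scanned pairs by \<open>exp (6 * l\<^sup>2)\<close>, against tails \<open>exp (- c\<^sup>2 * l\<^sup>2 / 32)\<close>.
\<close>

lemma scan_test:
  fixes k p :: nat and c lam :: real
  assumes k: "1 \<le> k" "k \<le> p" and c: "14 \<le> c"
    and lam: "lam \<ge> c * (real k * real p * ln (exp 1 * p / k)) powr (1/4)"
  shows "opt_error p k lam \<le> (4096 / c ^ 4 + 256 / c\<^sup>2) + 2 * exp (6 - c\<^sup>2 / 32)"
proof -
  define n \<kappa> L where "n = real p" and "\<kappa> = real k" and "L = ln (exp 1 * real p / real k)"
  have \<kappa>: "\<kappa> \<ge> 1" and n: "n \<ge> \<kappa>" using k by (auto simp: n_def \<kappa>_def)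
  then have n1: "n \<ge> 1" by simp
  have L_eq: "L = 1 + ln (n / \<kappa>)"
    using k unfolding L_def n_def \<kappa>_def by (simp add: ln_mult ln_div)
  have z: "n / \<kappa> \<ge> 1" using \<kappa> n by simp
  have L1: "L \<ge> 1" using z by (simp add: L_eq)
  have Lle: "\<kappa> * L \<le> n" using one_plus_ln_le[of "n / \<kappa>"] \<kappa> n by (simp add: L_eq field_simps)
  define l s u where "l = (\<kappa> * n * L) powr (1/4)" and "s = sqrt (\<kappa> * n / L)" and "u = c * l / 4"
  have l2: "l\<^sup>2 = sqrt (\<kappa> * n * L)" unfolding l_def using \<kappa> n1 L1 by (intro powr_fourth_squared) auto
  have knL: "1 \<le> \<kappa> * n * L"
    using mult_mono[of 1 \<kappa> 1 n] mult_mono[of 1 "\<kappa> * n" 1 L] \<kappa> n1 L1 by simp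
  have l2_1: "l\<^sup>2 \<ge> 1" unfolding l2 using knL by simp
  have l0: "l > 0" unfolding l_def using \<kappa> n1 L1 by simp
  have lam': "lam \<ge> c * l" using lam by (simp add: l_def \<kappa>_def n_def L_def)
  have lam0: "lam > 0"
  proof -
    have "0 < c * l" using c l0 by simp
    then show ?thesis using lam' by linarith
  qed
  have s0: "s > 0" using \<kappa> n1 L1 by (simp add: s_def)
  have s_k: "s \<ge> \<kappa>"
  proof -
    have "\<kappa>\<^sup>2 \<le> \<kappa> * n / L" using Lle \<kappa> L1 by (simp add: power2_eq_square field_simps)
    then show ?thesis unfolding s_def by (rule real_le_rsqrt)
  qed
  have s_n: "s \<le> n"
  proof -
    have "\<kappa> * n / L \<le> n * n / 1" using \<kappa> n n1 L1 by (intro frac_le mult_right_mono) auto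
    then have "\<kappa> * n / L \<le> n\<^sup>2" by (simp add: power2_eq_square)
    then show ?thesis unfolding s_def using n1 by (intro real_le_lsqrt) auto
  qed
  have sL: "s * L = l\<^sup>2"
  proof -
    have "L * s = sqrt (L\<^sup>2 * (\<kappa> * n / L))" unfolding s_def using L1 by (intro mult_sqrt_inside) simp
    also have "L\<^sup>2 * (\<kappa> * n / L) = \<kappa> * n * L" using L1 by (simp add: power2_eq_square)
    finally show ?thesis using l2 by (simp add: mult.commute)
  qed
  have pk_s: "\<kappa> * n / s = l\<^sup>2"
  proof -
    have "s * l\<^sup>2 = sqrt ((\<kappa> * n / L) * (\<kappa> * n * L))" unfolding s_def l2 by (rule real_sqrt_mult[symmetric])
    also have "(\<kappa> * n / L) * (\<kappa> * n * L) = (\<kappa> * n)\<^sup>2" using L1 by (simp add: power2_eq_square)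
    finally have "s * l\<^sup>2 = \<kappa> * n" using \<kappa> n1 by simp
    then show ?thesis using s0 by (simp add: field_simps)
  qed
  define A where "A = (\<lambda>(w :: nat \<Rightarrow> int, w' :: nat \<Rightarrow> int) (i, j). real_of_int (w i) / sqrt s * (real_of_int (w' j) / sqrt s))"
  define N where "N = grid_vectors p s"
  define \<F> where "\<F> = A ` (N \<times> N)"
  have finN: "finite N" unfolding N_def by (rule finite_grid_vectors)
  have finF: "finite \<F>" unfolding \<F>_def using finN by simp
  have cardN: "real (card N) \<le> exp (3 * l\<^sup>2)"
  proof -
    have "real (card N) \<le> exp (s * ln (2 * n / s) + 2 * s)"
      unfolding N_def n_def using s0 s_n by (intro card_grid_vectors_le) (auto simp: n_def)
    also have "s * ln (2 * n / s) + 2 * s \<le> s * (3 * L)"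
    proof -
      have "ln (2 * n / s) \<le> ln (2 * (n / \<kappa>))"
        using s_k s0 \<kappa> n1 by (subst ln_le_cancel_iff) (auto intro!: divide_left_mono)
      also have "\<dots> = ln 2 + ln (n / \<kappa>)" by (subst ln_mult) (use \<kappa> n1 in auto)
      also have "ln (2::real) \<le> 1" using ln_le_minus_one[of 2] by simp
      finally have "ln (2 * n / s) + 2 \<le> 3 * L" using L1 by (simp add: L_eq)
      then have "s * (ln (2 * n / s) + 2) \<le> s * (3 * L)" using s0 by (intro mult_left_mono) auto
      then show ?thesis by (simp add: algebra_simps)
    qed
    also have "s * (3 * L) = 3 * l\<^sup>2" using sL by (simp add: algebra_simps)
    finally show ?thesis by simp
  qed
  have cardF: "real (card \<F>) \<le> exp (6 * l\<^sup>2)"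
  proof -
    have "card \<F> \<le> card N * card N"
      using card_image_le[of "N \<times> N" A] finN unfolding \<F>_def by (simp add: card_cartesian_product)
    then have "real (card \<F>) \<le> real (card N) * real (card N)" using of_nat_mono by fastforce
    also have "\<dots> \<le> exp (3 * l\<^sup>2) * exp (3 * l\<^sup>2)" using cardN by (intro mult_mono) auto
    finally show ?thesis by (simp add: mult_exp_exp)
  qed
  have c0: "0 < c" using c by simp
  have u0: "u \<ge> 0" using c l0 by (simp add: u_def)
  have "opt_error p k lam \<le> (4096 / c ^ 4 + 256 / c\<^sup>2) + (real (card \<F>) + 1) * exp (- u\<^sup>2 / 2)"
  proof (rule opt_error_le_energy_or_scan[OF _ _ finF _ c0 u0])
    fix B assume "B \<in> \<F>"
    then obtain w w' where B: "B = A (w, w')" and w: "w \<in> N" "w' \<in> N" unfolding \<F>_def by auto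
    have le1: "(\<Sum>j<p. (real_of_int (w j) / sqrt s)\<^sup>2) \<le> 1" if "w \<in> N" for w
      using that s0 by (simp add: N_def grid_vectors_def power_divide sum_divide_distrib[symmetric])
    have "(\<Sum>e\<in>positions p. (B e)\<^sup>2) = (\<Sum>i<p. (real_of_int (w i) / sqrt s)\<^sup>2) * (\<Sum>j<p. (real_of_int (w' j) / sqrt s)\<^sup>2)"
      unfolding sum_product sum.cartesian_product B A_def
      by (intro sum.cong refl) (simp only: case_prod_unfold fst_conv snd_conv power_mult_distrib)
    also have "\<dots> \<le> 1 * 1" using le1 w by (intro mult_mono) (auto intro!: sum_nonneg)
    finally show "(\<Sum>e\<in>positions p. (B e)\<^sup>2) \<le> 1" by simp
  next
    fix M assume M: "M \<in> Theta p k lam"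
    show "(\<Sum>e\<in>positions p. (M $$ e)\<^sup>2) \<ge> c\<^sup>2 * p / 16 \<or> (\<exists>B\<in>\<F>. linear_stat p B M \<ge> 2 * u)"
    proof (rule disjCI)
      assume "\<not> (\<exists>B\<in>\<F>. linear_stat p B M \<ge> 2 * u)"
      then have no: "linear_stat p B M < 2 * u" if "B \<in> \<F>" for B using that by auto
      show "(\<Sum>e\<in>positions p. (M $$ e)\<^sup>2) \<ge> c\<^sup>2 * p / 16"
      proof (rule ccontr)
        assume "\<not> (\<Sum>e\<in>positions p. (M $$ e)\<^sup>2) \<ge> c\<^sup>2 * p / 16"
        then have small: "(\<Sum>i<p. \<Sum>j<p. (M $$ (i,j))\<^sup>2) \<le> c\<^sup>2 * n / 16"
          by (simp add: sum.cartesian_product case_prod_unfold n_def not_le mult.commute)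
        have pos: "0 < p" using k by simp
        obtain a b where ab: "(\<Sum>i<p. (a i)\<^sup>2) = 1" "(\<Sum>j<p. (b j)\<^sup>2) = 1"
          "(\<Sum>i<p. \<Sum>j<p. M $$ (i,j) * a i * b j) \<ge> lam"
          by (rule Theta_singular_vectors[OF M pos lam0])
        obtain w where w: "w \<in> N" "(\<Sum>i<p. (real_of_int (w i) / sqrt s)\<^sup>2) \<le> 1"
          "\<And>i. i < p \<Longrightarrow> \<bar>a i - real_of_int (w i) / sqrt s\<bar> \<le> 1 / sqrt s"
          unfolding N_def using grid_approximation[OF s0, where p = p and v = a] ab(1) by auto
        obtain w' where w': "w' \<in> N" "(\<Sum>i<p. (real_of_int (w' i) / sqrt s)\<^sup>2) \<le> 1"
          "\<And>i. i < p \<Longrightarrow> \<bar>b i - real_of_int (w' i) / sqrt s\<bar> \<le> 1 / sqrt s"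
          unfolding N_def using grid_approximation[OF s0, where p = p and v = b] ab(2) by auto
        define a' b' where "a' = (\<lambda>i. real_of_int (w i) / sqrt s)" and "b' = (\<lambda>j. real_of_int (w' j) / sqrt s)"
        have rows: "card {j. j < p \<and> M $$ (i,j) \<noteq> 0} \<le> k" and cols: "card {l. l < p \<and> M $$ (l,i) \<noteq> 0} \<le> k" if "i < p" for i
          using M that by (auto simp: Theta_def sparse_mats_def)
        \<comment> \<open>Each of the two roundings costs a quarter of the signal, which leaves the \<open>c * l / 2 = 2 * u\<close> that the scan needs.\<close>
        have err: "sqrt (F * (k * (1 / sqrt s)\<^sup>2)) \<le> c * l / 4" if "F \<le> c\<^sup>2 * n / 16" for F
        proof (rule real_le_lsqrt)
          have "F * (k * (1 / sqrt s)\<^sup>2) \<le> (c\<^sup>2 * n / 16) * (k * (1 / sqrt s)\<^sup>2)"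
            using that by (intro mult_right_mono) auto
          also have "\<dots> = c\<^sup>2 / 16 * (\<kappa> * n / s)" using s0 by (simp add: \<kappa>_def power_divide)
          also have "\<dots> = (c * l / 4)\<^sup>2" unfolding pk_s by (simp add: power_mult_distrib power_divide)
          finally show "F * (k * (1 / sqrt s)\<^sup>2) \<le> (c * l / 4)\<^sup>2" .
        qed (use u0 in \<open>simp add: u_def\<close>)
        have e1: "\<bar>\<Sum>i<p. \<Sum>j<p. M $$ (i,j) * a i * (b j - b' j)\<bar> \<le> c * l / 4"
          using order_trans[OF sparse_bilinear_perturbation[of p "\<lambda>i j. M $$ (i,j)" k "\<lambda>j. b j - b' j" "1 / sqrt s" a] err[OF small]]
            rows w'(3) ab(1) by (simp add: b'_def)
        have small': "(\<Sum>j<p. \<Sum>i<p. (M $$ (i,j))\<^sup>2) \<le> c\<^sup>2 * n / 16"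
          using small by (subst sum.swap)
        have "\<bar>\<Sum>j<p. \<Sum>i<p. M $$ (i,j) * b' j * (a i - a' i)\<bar> \<le> c * l / 4"
          using order_trans[OF sparse_bilinear_perturbation[of p "\<lambda>j i. M $$ (i,j)" k "\<lambda>i. a i - a' i" "1 / sqrt s" b'] err[OF small']]
            cols w(3) w'(2) by (simp add: a'_def b'_def)
        then have e2: "\<bar>\<Sum>i<p. \<Sum>j<p. M $$ (i,j) * b' j * (a i - a' i)\<bar> \<le> c * l / 4"
          by (subst sum.swap)
        have "(\<Sum>i<p. \<Sum>j<p. M $$ (i,j) * a i * b j) = (\<Sum>i<p. \<Sum>j<p. M $$ (i,j) * a' i * b' j)
          + (\<Sum>i<p. \<Sum>j<p. M $$ (i,j) * a i * (b j - b' j)) + (\<Sum>i<p. \<Sum>j<p. M $$ (i,j) * b' j * (a i - a' i))"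
          unfolding sum.distrib[symmetric] by (intro sum.cong refl) (simp add: algebra_simps)
        moreover have "linear_stat p (A (w, w')) M = (\<Sum>i<p. \<Sum>j<p. M $$ (i,j) * a' i * b' j)"
          unfolding linear_stat_def sum.cartesian_product
          by (intro sum.cong) (auto simp: A_def a'_def b'_def)
        moreover have "linear_stat p (A (w, w')) M < 2 * u" using no w(1) w'(1) unfolding \<F>_def by auto
        ultimately show False using ab(3) lam' e1 e2 by (simp add: u_def)
      qed
    qed
  qed (use k in auto)
  moreover have "(real (card \<F>) + 1) * exp (- u\<^sup>2 / 2) \<le> 2 * exp (6 - c\<^sup>2 / 32)"
  proof -
    have "1 \<le> exp (6 * l\<^sup>2)" using l2_1 by simp
    then have "real (card \<F>) + 1 \<le> 2 * exp (6 * l\<^sup>2)" using cardF by linarith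
    then have "(real (card \<F>) + 1) * exp (- u\<^sup>2 / 2) \<le> (2 * exp (6 * l\<^sup>2)) * exp (- u\<^sup>2 / 2)"
      by (rule mult_right_mono) simp
    also have "\<dots> = 2 * exp (- ((c\<^sup>2 / 32 - 6) * l\<^sup>2))"
      by (simp add: mult_exp_exp u_def power_mult_distrib power_divide algebra_simps)
    also have "(c\<^sup>2 / 32 - 6) * 1 \<le> (c\<^sup>2 / 32 - 6) * l\<^sup>2"
    proof (intro mult_left_mono l2_1)
      have "14\<^sup>2 \<le> c\<^sup>2" using c by (intro power_mono) auto
      then show "0 \<le> c\<^sup>2 / 32 - 6" by simp
    qed
    then have "2 * exp (- ((c\<^sup>2 / 32 - 6) * l\<^sup>2)) \<le> 2 * exp (6 - c\<^sup>2 / 32)" by simp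
    finally show ?thesis .
  qed
  ultimately show ?thesis by linarith
qed

theorem minimax_upper_bound:
  fixes k p :: nat and c lam :: real
  assumes k: "1 \<le> k" "k \<le> p" and c: "14 \<le> c" and lam: "lam \<ge> c * lambda1 k p"
  shows "opt_error p k lam \<le> (4096 / c ^ 4 + 256 / c\<^sup>2) + 3 * exp (1 - c\<^sup>2 / 16) + 2 * exp (6 - c\<^sup>2 / 32)"
proof (cases "real k \<le> (real p / ln (real p)) powr (1/3)")
  case True
  have "p \<noteq> 1" using True k by auto
  then have p: "2 \<le> p" using k by simp
  have "opt_error p k lam \<le> (4096 / c ^ 4 + 256 / c\<^sup>2) + 3 * exp (1 - c\<^sup>2 / 16)"
    using True k p c lam by (intro entrywise_test) (auto simp: lambda1_def)
  then show ?thesis by (rule order_trans) simp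
next
  case False
  then have "opt_error p k lam \<le> (4096 / c ^ 4 + 256 / c\<^sup>2) + 2 * exp (6 - c\<^sup>2 / 32)"
    using k c lam by (intro scan_test) (auto simp: lambda1_def)
  then show ?thesis by (rule order_trans) simp
qed

theorem theorem1:
  "\<exists>(k0::real) (c0::real) (c1::real) (\<epsilon>1::real \<Rightarrow> real) (\<epsilon>0::real \<Rightarrow> real)
      (\<delta>::real \<Rightarrow> nat \<Rightarrow> real).
     k0 > 0 \<and> c0 > 0 \<and> c1 > 0 \<and>
     (\<epsilon>1 \<longlongrightarrow> 0) at_top \<and>
     (\<epsilon>0 \<longlongrightarrow> 1) (at_right 0) \<and>
     (\<forall>c. 0 < c \<and> c < c0 \<longrightarrow> (\<delta> c \<longlongrightarrow> 0) sequentially) \<and>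
     (\<forall>(k::nat) (p::nat). k0 \<le> real k \<and> k \<le> p \<longrightarrow>
        (\<forall>c lam. c > c1 \<and> lam \<ge> c * lambda1 k p \<longrightarrow> opt_error p k lam \<le> \<epsilon>1 c) \<and>
        (\<forall>c lam. 0 < c \<and> c < c0 \<and> 0 \<le> lam \<and> lam \<le> c * lambda0 k p \<longrightarrow>
           opt_error p k lam \<ge> \<epsilon>0 c - \<delta> c p))"
proof -
  \<comment> \<open>\<open>k \<ge> 3\<close> and \<open>c < 1 / 8192\<close> serve the lower bound, \<open>c > 14\<close> makes the exponent \<open>c\<^sup>2 / 32 - 6\<close> of the scan positive.\<close>
  define \<epsilon>1 :: "real \<Rightarrow> real"
    where "\<epsilon>1 = (\<lambda>c. (4096 / c ^ 4 + 256 / c\<^sup>2) + 3 * exp (1 - c\<^sup>2 / 16) + 2 * exp (6 - c\<^sup>2 / 32))"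
  define \<epsilon>0 :: "real \<Rightarrow> real"
    where "\<epsilon>0 = (\<lambda>c. 1 - sqrt (exp (4 * c) - 1 + 2 * exp (- 1 / (14 * c)) + 64 * sqrt c))"
  define \<delta> :: "real \<Rightarrow> nat \<Rightarrow> real"
    where "\<delta> = (\<lambda>c p. sqrt (48 / (sqrt c * sqrt (p / (1 + ln p)))))"
  have "(\<epsilon>1 \<longlongrightarrow> 0) at_top" unfolding \<epsilon>1_def by real_asymp
  moreover have "(\<epsilon>0 \<longlongrightarrow> 1) (at_right 0)" unfolding \<epsilon>0_def by real_asymp
  moreover have "(\<delta> c \<longlongrightarrow> 0) sequentially" if "0 < c" for c
  proof -
    have "((\<lambda>p. sqrt (48 / (sqrt c * sqrt (real p / (1 + ln (real p)))))) \<longlongrightarrow> sqrt (48 / sqrt c * 0)) sequentially"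
    proof (intro tendsto_real_sqrt)
      have "((\<lambda>p. 1 / sqrt (real p / (1 + ln (real p)))) \<longlongrightarrow> 0) sequentially" by real_asymp
      from tendsto_mult_left[OF this, of "48 / sqrt c"]
      show "((\<lambda>p. 48 / (sqrt c * sqrt (real p / (1 + ln (real p))))) \<longlongrightarrow> 48 / sqrt c * 0) sequentially" by simp
    qed
    then show ?thesis by (simp add: \<delta>_def)
  qed
  moreover have "opt_error p k lam \<le> \<epsilon>1 c"
    if "3 \<le> real k" "k \<le> p" "c > 14" "lam \<ge> c * lambda1 k p" for k p c lam
    unfolding \<epsilon>1_def using that by (intro minimax_upper_bound) auto
  moreover have "opt_error p k lam \<ge> \<epsilon>0 c - \<delta> c p"
    if "3 \<le> real k" "k \<le> p" "0 < c" "c < 1 / 8192" "0 \<le> lam" "lam \<le> c * lambda0 k p" for k p c lam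
    unfolding \<epsilon>0_def \<delta>_def using that by (intro minimax_lower_bound) auto
  ultimately show ?thesis
    by (intro exI[of _ "3::real"] exI[of _ "1 / 8192 :: real"] exI[of _ "14::real"] exI[of _ \<epsilon>1] exI[of _ \<epsilon>0] exI[of _ \<delta>]) auto
qed

end
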